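(* For every integer $t\ge 4$, the graph $F_t$ is a connected line graph and $$[s_{(4,4,4,4,1^{t-4})}]\,X_{F_t}=-40\,(t-1)\,(t-1)!<0.$$ Consequently, the graphs $F_t$, for $t\ge 4$, form an infinite family of counterexamples to the conjecture that every claw-free graph is Schur-positive.
   Context: All graphs are finite and simple. The chromatic symmetric function of a graph $G$ is $X_G=\sum_{\kappa}\prod_{u\in V(G)}x_{\kappa(u)}$, where the sum is over all proper colorings $\kappa\colon V(G)\to\mathbb Z_{>0}$. For a partition $\lambda$, $[s_\lambda]X_G$ denotes the coefficient of the Schur function $s_\lambda$ in the Schur expansion of $X_G$; $1^{k}$ denotes $k$ parts equal to $1$. A graph is Schur-positive if all these coefficients are nonnegative. A graph is claw-free if it has no induced subgraph isomorphic to $K_{1,3}$. The line graph $L(H)$ of a (finite simple) graph $H$ has vertex set $E(H)$, two distinct edges being adjacent when they share an endpoint; a graph is a line graph if it is isomorphic to $L(H)$ for some finite simple graph $H$. The graph $H_2$ has vertex set $\{1,\dots,10\}$ and edge set $\{v_1,\dots,v_{12}\}$ with $v_1=\{1,8\}$, $v_2=\{1,9\}$, $v_3=\{2,7\}$, $v_4=\{3,6\}$, $v_5=\{3,10\}$, $v_6=\{4,5\}$, $v_7=\{4,9\}$, $v_8=\{5,9\}$, $v_9=\{6,10\}$, $v_{10}=\{7,9\}$, $v_{11}=\{7,10\}$, $v_{12}=\{8,10\}$. Set $G_2=L(H_2)$, with vertices $v_1,\dots,v_{12}$. For $t\ge4$, $F_t$ is obtained from the disjoint union of $G_2$ and a complete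 graph $K_t$ with a distinguished vertex $w\in V(K_t)$ by adding the single edge $v_3w$. *)

theory Defs
  imports "HOL-Library.FuncSet" "HOL-Library.Poly_Mapping"
begin

section \<open>Finite simple graphs\<close>

record 'a ugraph =
  verts :: "'a set"
  edges :: "'a set set"

definition simple_graph :: "'a ugraph \<Rightarrow> bool" where
  "simple_graph G \<longleftrightarrow> finite (verts G) \<and> (\<forall>e\<in>edges G. e \<subseteq> verts G \<and> card e = 2)"

definition graph_iso :: "'a ugraph \<Rightarrow> 'b ugraph \<Rightarrow> bool" where
  "graph_iso G H \<longleftrightarrow> (\<exists>f. bij_betw f (verts G) (verts H) \<and>
     (\<forall>u\<in>verts G. \<forall>v\<in>verts G. {u, v} \<in> edges G \<longleftrightarrow> {f u, f v} \<in> edges H))"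

definition induced_subgraph :: "'a ugraph \<Rightarrow> 'a set \<Rightarrow> 'a ugraph" where
  "induced_subgraph G S = \<lparr>verts = S, edges = {e \<in> edges G. e \<subseteq> S}\<rparr>"

definition connected_graph :: "'a ugraph \<Rightarrow> bool" where
  "connected_graph G \<longleftrightarrow> verts G \<noteq> {} \<and>
     (\<forall>u\<in>verts G. \<forall>v\<in>verts G. (u, v) \<in> {(a, b). {a, b} \<in> edges G}\<^sup>*)"

definition complete_graph :: "'a set \<Rightarrow> 'a ugraph" where
  "complete_graph A = \<lparr>verts = A, edges = {{u, v} | u v. u \<in> A \<and> v \<in> A \<and> u \<noteq> v}\<rparr>"

definition claw :: "nat ugraph" where
  "claw = \<lparr>verts = {0, 1, 2, 3}, edges = {{0, 1}, {0, 2}, {0, 3}}\<rparr>"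

definition claw_free :: "'a ugraph \<Rightarrow> bool" where
  "claw_free G \<longleftrightarrow> \<not> (\<exists>S \<subseteq> verts G. graph_iso (induced_subgraph G S) claw)"

definition line_graph :: "'a ugraph \<Rightarrow> 'a set ugraph" where
  "line_graph H = \<lparr>verts = edges H,
     edges = {{e, f} | e f. e \<in> edges H \<and> f \<in> edges H \<and> e \<noteq> f \<and> e \<inter> f \<noteq> {}}\<rparr>"

text \<open>Every finite graph is isomorphic to one with vertices in \<^typ>\<open>nat\<close>, so fixing the vertex
  type of the root graph loses nothing.\<close>

definition is_line_graph :: "'a ugraph \<Rightarrow> bool" where
  "is_line_graph G \<longleftrightarrow> (\<exists>H :: nat ugraph. simple_graph H \<and> graph_iso G (line_graph H))"

definition disjoint_union :: "'a ugraph \<Rightarrow> 'b ugraph \<Rightarrow> ('a + 'b) ugraph" where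
  "disjoint_union G H = \<lparr>verts = verts G <+> verts H,
     edges = (image Inl) ` edges G \<union> (image Inr) ` edges H\<rparr>"

definition add_edge :: "'a ugraph \<Rightarrow> 'a \<Rightarrow> 'a \<Rightarrow> 'a ugraph" where
  "add_edge G u v = \<lparr>verts = verts G, edges = insert {u, v} (edges G)\<rparr>"

section \<open>Symmetric functions\<close>

text \<open>A formal power series in the variables \<open>x\<^sub>1, x\<^sub>2, \<dots>\<close> is given by its coefficients, indexed by
  exponent vectors of finite support. The index \<open>0\<close> is never used by a colouring or a tableau.\<close>

type_synonym power_series = "(nat \<Rightarrow>\<^sub>0 nat) \<Rightarrow> int"

text \<open>The exponent vector of the monomial \<open>\<Prod>a\<in>A. x\<^bsub>f a\<^esub>\<close>.\<close>

definition content :: "'a set \<Rightarrow> ('a \<Rightarrow> nat) \<Rightarrow> (nat \<Rightarrow>\<^sub>0 nat)" where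
  "content A f = (\<Sum>a\<in>A. Poly_Mapping.single (f a) 1)"

definition proper_colorings :: "'a ugraph \<Rightarrow> ('a \<Rightarrow> nat) set" where
  "proper_colorings G = {\<kappa> \<in> verts G \<rightarrow>\<^sub>E {1..}.
     \<forall>u\<in>verts G. \<forall>v\<in>verts G. {u, v} \<in> edges G \<longrightarrow> \<kappa> u \<noteq> \<kappa> v}"

definition chromatic_sym :: "'a ugraph \<Rightarrow> power_series" where
  "chromatic_sym G \<alpha> = int (card {\<kappa> \<in> proper_colorings G. content (verts G) \<kappa> = \<alpha>})"

definition is_partition :: "nat list \<Rightarrow> bool" where
  "is_partition \<mu> \<longleftrightarrow> sorted_wrt (\<ge>) \<mu> \<and> 0 \<notin> set \<mu>"

definition diagram :: "nat list \<Rightarrow> (nat \<times> nat) set" where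
  "diagram \<mu> = {(i, j). i < length \<mu> \<and> j < \<mu> ! i}"

text \<open>Semistandard Young tableaux of shape \<open>\<mu>\<close>, in English notation.\<close>

definition ssyt :: "nat list \<Rightarrow> (nat \<times> nat \<Rightarrow> nat) set" where
  "ssyt \<mu> = {T \<in> diagram \<mu> \<rightarrow>\<^sub>E {1..}.
     (\<forall>i j j'. (i, j) \<in> diagram \<mu> \<and> (i, j') \<in> diagram \<mu> \<and> j < j' \<longrightarrow> T (i, j) \<le> T (i, j')) \<and>
     (\<forall>i i' j. (i, j) \<in> diagram \<mu> \<and> (i', j) \<in> diagram \<mu> \<and> i < i' \<longrightarrow> T (i, j) < T (i', j))}"

definition schur :: "nat list \<Rightarrow> power_series" where
  "schur \<mu> \<alpha> = int (card {T \<in> ssyt \<mu>. content (diagram \<mu>) T = \<alpha>})"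

definition is_schur_expansion :: "power_series \<Rightarrow> (nat list \<Rightarrow> int) \<Rightarrow> bool" where
  "is_schur_expansion F c \<longleftrightarrow> finite {\<mu>. c \<mu> \<noteq> 0} \<and> (\<forall>\<mu>. c \<mu> \<noteq> 0 \<longrightarrow> is_partition \<mu>) \<and>
     F = (\<lambda>\<alpha>. \<Sum>\<mu> | c \<mu> \<noteq> 0. c \<mu> * schur \<mu> \<alpha>)"

text \<open>The Schur functions are a \<open>\<int>\<close>-basis of the ring of symmetric functions with integer
  coefficients, so a Schur expansion of a symmetric function exists and is unique.\<close>

definition schur_coeff :: "nat list \<Rightarrow> power_series \<Rightarrow> int" where
  "schur_coeff \<mu> F = (THE c. is_schur_expansion F c) \<mu>"

definition schur_positive :: "'a ugraph \<Rightarrow> bool" where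
  "schur_positive G \<longleftrightarrow> (\<forall>\<mu>. is_partition \<mu> \<longrightarrow> schur_coeff \<mu> (chromatic_sym G) \<ge> 0)"

section \<open>The graphs $F_t$\<close>

definition H2 :: "nat ugraph" where
  "H2 = \<lparr>verts = {1..10},
     edges = {{1, 8}, {1, 9}, {2, 7}, {3, 6}, {3, 10}, {4, 5},
              {4, 9}, {5, 9}, {6, 10}, {7, 9}, {7, 10}, {8, 10}}\<rparr>"

definition G2 :: "nat set ugraph" where
  "G2 = line_graph H2"

text \<open>The attaching vertex of \<^const>\<open>G2\<close> is the edge \<open>v\<^sub>3 = {2, 7}\<close> of \<^const>\<open>H2\<close>; the
  distinguished vertex of the complete graph on \<open>{1..t}\<close> is \<open>1\<close>.\<close>

definition F :: "nat \<Rightarrow> (nat set + nat) ugraph" where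
  "F t = add_edge (disjoint_union G2 (complete_graph {1..t})) (Inl {2, 7}) (Inr 1)"

end

(* The bialternant formula a_delta * s_mu = a_(mu + delta) is obtained by induction on the number of variables:
   subtracting multiples of adjacent columns reduces a generalised Vandermonde determinant to a sum over
   interlacing exponents, which is the branching rule for tableaux. In the integral domain of polynomials it shows
   that Schur functions are symmetric, and that the coefficient of s_nu in a symmetric f is
   sum_w sgn(w) [x^(nu + delta - w delta)] f; this alternating coefficient detects zero, so expansions exist.

   In a colouring of F_t with t colours the clique uses every colour exactly once. For nu = (4,4,4,4,1^(t-4)) only
   permutations w that fix 4, ..., t - 1 contribute, and colouring the clique accounts for the factor (t-1) (t-1)!.
   What remains is the coefficient of s_(3,3,3,3) in the chromatic symmetric function of G_2, a finite count.

   F_t is the line graph of H_2 with a star with t edges attached at the pendant vertex 2. *)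
theory Submission
  imports Defs "Jordan_Normal_Form.Determinant"
begin

section \<open>Alternants and tableaux\<close>

text \<open>\<open>schur_coeff\<close> is a definite description, so no coefficient can be read off
  before an expansion is known to exist and to be unique. This is why Schur functions are developed
  at all: one identity, the bialternant formula, yields both symmetry and the extraction of
  coefficients. A coefficient for a partition with n parts is extracted in exactly n variables.
  Schur functions of longer shapes vanish there, so nothing outside these variables interferes. The
  shape is matched to the graph through this number: it has as many parts as the clique has
  vertices. Removing the clique then lowers every exponent by one and turns (4,4,4,4,1^(t-4)) into
  (3,3,3,3), whose size 12 is the number of vertices of G_2. The number of ways to colour the clique
  does not depend on the colour of v_3, so the coefficient of G_2 is only multiplied by a positive
  constant and its negative sign is inherited by all F_t.\<close>

definition alternant :: "nat \<Rightarrow> (nat \<Rightarrow> 'a::comm_ring_1) \<Rightarrow> (nat \<Rightarrow> nat) \<Rightarrow> 'a" where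
  "alternant n x l = det (mat n n (\<lambda>(i, j). x i ^ l j))"

lemma alternant_col:
  "alternant n x l = (\<Sum>p | p permutes {..<n}. of_int (sign p) * (\<Prod>j<n. x (p j) ^ l j))"
proof -
  have "alternant n x l = (\<Sum>p | p permutes {0..<n}. of_int (sign p) *
      (\<Prod>j<n. mat n n (\<lambda>(i, j). x i ^ l j) $$ (p j, j)))"
    unfolding alternant_def by (rule det_col) simp
  also have "\<dots> = (\<Sum>p | p permutes {..<n}. of_int (sign p) * (\<Prod>j<n. x (p j) ^ l j))"
    unfolding atLeast0LessThan
  proof (intro sum.cong prod.cong arg_cong2[where f="(*)"] refl)
    fix p j assume "p \<in> {p. p permutes {..<n}}" "j \<in> {..<n}"
    then have "p j < n" "j < n" using permutes_in_image[of p "{..<n}" j] by auto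
    then show "mat n n (\<lambda>(i, j). x i ^ l j) $$ (p j, j) = x (p j) ^ l j" by simp
  qed
  finally show ?thesis .
qed

text \<open>Here the permutation acts on the exponents, so each summand is one monomial in the
  variables taken in order. The column form puts it on the variables, which lets a product over all
  variables be pulled out in \<open>alternant_Suc\<close>.\<close>

lemma alternant_row:
  "alternant n x l = (\<Sum>p | p permutes {..<n}. of_int (sign p) * (\<Prod>i<n. x i ^ l (p i)))"
proof -
  have "alternant n x l = (\<Sum>p | p permutes {0..<n}. of_int (sign p) *
      (\<Prod>i = 0..<n. mat n n (\<lambda>(i, j). x i ^ l j) $$ (i, p i)))"
    unfolding alternant_def by (rule det_def') simp
  also have "\<dots> = (\<Sum>p | p permutes {..<n}. of_int (sign p) * (\<Prod>i<n. x i ^ l (p i)))"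
    unfolding atLeast0LessThan
  proof (intro sum.cong prod.cong arg_cong2[where f="(*)"] refl)
    fix p i assume "p \<in> {p. p permutes {..<n}}" "i \<in> {..<n}"
    then have "p i < n" "i < n" using permutes_in_image[of p "{..<n}" i] by auto
    then show "mat n n (\<lambda>(i, j). x i ^ l j) $$ (i, p i) = x i ^ l (p i)" by simp
  qed
  finally show ?thesis .
qed

lemma alternant_cong:
  assumes "\<And>i. i < n \<Longrightarrow> x i = y i" "\<And>j. j < n \<Longrightarrow> l j = m j"
  shows "alternant n x l = alternant n y m"
proof -
  have "mat n n (\<lambda>(i, j). x i ^ l j) = mat n n (\<lambda>(i, j). y i ^ m j)"
    by (rule eq_matI) (use assms in auto)
  then show ?thesis by (simp add: alternant_def)
qed

text \<open>This is the geometric sum for \<open>x ^ (b - a) - y ^ (b - a)\<close>, multiplied by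
  \<open>x ^ a\<close> so that the exponent of \<open>x\<close> runs through \<open>a..<b\<close>.
  In \<open>alternant_Suc\<close> these are the choices between two neighbouring exponents.\<close>

lemma power_diff_telescope:
  fixes x y :: "'a::comm_ring_1"
  assumes "a \<le> b"
  shows "x ^ b - y ^ (b - a) * x ^ a = (x - y) * (\<Sum>m = a..<b. x ^ m * y ^ (b - 1 - m))"
  using assms
proof (induction b rule: dec_induct)
  case base
  then show ?case by simp
next
  case (step b)
  have "(\<Sum>m = a..<Suc b. x ^ m * y ^ (Suc b - 1 - m))
      = (\<Sum>m = a..<b. x ^ m * y ^ (Suc b - 1 - m)) + x ^ b"
    using step by simp
  also have "(\<Sum>m = a..<b. x ^ m * y ^ (Suc b - 1 - m)) = y * (\<Sum>m = a..<b. x ^ m * y ^ (b - 1 - m))"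
    unfolding sum_distrib_left
  proof (rule sum.cong)
    fix m assume "m \<in> {a..<b}"
    then have "Suc b - 1 - m = Suc (b - 1 - m)" by auto
    then show "x ^ m * y ^ (Suc b - 1 - m) = y * (x ^ m * y ^ (b - 1 - m))" by simp
  qed simp
  finally have "(x - y) * (\<Sum>m = a..<Suc b. x ^ m * y ^ (Suc b - 1 - m))
      = y * (x ^ b - y ^ (b - a) * x ^ a) + (x - y) * x ^ b"
    unfolding step.IH by (simp add: algebra_simps)
  also have "\<dots> = x ^ Suc b - y ^ (Suc b - a) * x ^ a"
    using step by (simp add: algebra_simps Suc_diff_le)
  finally show ?case by simp
qed

text \<open>The multiple of column \<open>Suc j\<close> subtracted from column \<open>j\<close> is
  chosen to annihilate the last row apart from its last entry. In the other rows the entries of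
  these columns acquire the factor \<open>x i - x n\<close>, and the quotients are geometric sums;
  multiplying them out over the columns gives one smaller alternant per choice of exponents.\<close>

lemma alternant_Suc:
  fixes x :: "nat \<Rightarrow> 'a::comm_ring_1"
  assumes l: "\<And>j. j < n \<Longrightarrow> l (Suc j) < l j"
  shows "alternant (Suc n) x l = (\<Prod>i<n. x i - x n) *
    (\<Sum>m\<in>Pi\<^sub>E {..<n} (\<lambda>j. {l (Suc j)..<l j}).
       (\<Prod>j<n. x n ^ (l j - 1 - m j)) * x n ^ l n * alternant n x m)"
proof -
  define A where "A = mat (Suc n) (Suc n) (\<lambda>(i, j). x i ^ l j)"
  \<comment> \<open>Right multiplication by \<open>U\<close> performs all column operations at once.
    Each column is corrected by the original next column, so \<open>U\<close> is lower triangular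
    with unit diagonal.\<close>
  define U where "U = mat (Suc n) (Suc n) (\<lambda>(i, j). if i = j then 1
      else if i = Suc j then - (x n ^ (l j - l (Suc j))) else 0)"
  define h where "h i j = (\<Sum>m = l (Suc j)..<l j. x i ^ m * x n ^ (l j - 1 - m))" for i j
  define B where "B = mat (Suc n) (Suc n) (\<lambda>(i, j). if j < n then (x i - x n) * h i j else x i ^ l n)"
  define C where "C = mat n n (\<lambda>(i, j). (x i - x n) * h i j)"
  have carr: "A \<in> carrier_mat (Suc n) (Suc n)" "U \<in> carrier_mat (Suc n) (Suc n)"
    "B \<in> carrier_mat (Suc n) (Suc n)" "C \<in> carrier_mat n n"
    by (auto simp: A_def U_def B_def C_def)
  have AU: "A * U = B"
  proof (rule eq_matI)
    fix i j assume "i < dim_row B" "j < dim_col B"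
    then have ij: "i < Suc n" "j < Suc n" by (auto simp: B_def)
    have "(A * U) $$ (i, j) = (\<Sum>k = 0..<Suc n. x i ^ l k * (if k = j then 1
        else if k = Suc j then - (x n ^ (l j - l (Suc j))) else 0))"
      using ij by (simp add: A_def U_def scalar_prod_def)
    also have "\<dots> = (\<Sum>k = 0..<Suc n. (if k = j then x i ^ l k else 0)
        + (if k = Suc j then - (x n ^ (l j - l (Suc j)) * x i ^ l (Suc j)) else 0))"
      by (rule sum.cong) auto
    also have "\<dots> = x i ^ l j + (if j < n then - (x n ^ (l j - l (Suc j)) * x i ^ l (Suc j)) else 0)"
      using ij by (cases "j = n") (auto simp: sum.distrib)
    also have "\<dots> = B $$ (i, j)"
    proof (cases "j < n")
      case True
      then show ?thesis
        using power_diff_telescope[of "l (Suc j)" "l j" "x i" "x n"] l[of j] ij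
        by (simp add: B_def h_def)
    next
      case False
      then have "j = n" using ij by simp
      then show ?thesis using ij by (simp add: B_def)
    qed
    finally show "(A * U) $$ (i, j) = B $$ (i, j)" .
  qed (auto simp: A_def B_def U_def)
  have "det U = prod_list (diag_mat U)"
    by (rule det_lower_triangular[OF _ carr(2)]) (auto simp: U_def)
  also have "\<dots> = 1"
    unfolding prod_list_diag_prod by (rule prod.neutral) (auto simp: U_def)
  finally have "det A = det B"
    using det_mult[OF carr(1,2)] AU by simp
  \<comment> \<open>In row \<open>n\<close> the factor \<open>x i - x n\<close> is zero, so only the
    last cofactor survives; its sign is \<open>(- 1) ^ (n + n)\<close>.\<close>
  also have "det B = (\<Sum>j<Suc n. B $$ (n, j) * cofactor B n j)"
    by (rule laplace_expansion_row[OF carr(3)]) simp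
  also have "\<dots> = x n ^ l n * det C"
  proof -
    have "mat_delete B n n = C"
      by (rule eq_matI) (auto simp: mat_delete_def B_def C_def)
    then have "cofactor B n n = det C"
      by (simp add: cofactor_def flip: mult_2)
    moreover have "(\<Sum>j<n. B $$ (n, j) * cofactor B n j) = 0"
      by (rule sum.neutral) (auto simp: B_def)
    ultimately show ?thesis by (simp add: B_def)
  qed
  also have "det C = (\<Sum>p | p permutes {0..<n}. of_int (sign p) * (\<Prod>j<n. C $$ (p j, j)))"
    by (rule det_col[OF carr(4)])
  also have "\<dots> = (\<Sum>p | p permutes {..<n}. of_int (sign p) *
      ((\<Prod>i<n. x i - x n) * (\<Sum>m\<in>Pi\<^sub>E {..<n} (\<lambda>j. {l (Suc j)..<l j}).
        \<Prod>j<n. x (p j) ^ m j * x n ^ (l j - 1 - m j))))"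
    unfolding atLeast0LessThan
  proof (intro sum.cong arg_cong2[where f="(*)"] refl)
    fix p assume "p \<in> {p. p permutes {..<n}}"
    then have p: "p permutes {..<n}" by simp
    have "(\<Prod>j<n. C $$ (p j, j)) = (\<Prod>j<n. (x (p j) - x n) * h (p j) j)"
    proof (rule prod.cong)
      fix j assume "j \<in> {..<n}"
      then have "p j < n" "j < n" using permutes_in_image[OF p, of j] by auto
      then show "C $$ (p j, j) = (x (p j) - x n) * h (p j) j" by (simp add: C_def)
    qed simp
    also have "\<dots> = (\<Prod>j<n. x (p j) - x n) * (\<Prod>j<n. h (p j) j)"
      by (rule prod.distrib)
    also have "(\<Prod>j<n. x (p j) - x n) = (\<Prod>i<n. x i - x n)"
      using prod.permute[OF p, of "\<lambda>i. x i - x n"] by (simp add: o_def)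
    also have "(\<Prod>j<n. h (p j) j) = (\<Sum>m\<in>Pi\<^sub>E {..<n} (\<lambda>j. {l (Suc j)..<l j}).
        \<Prod>j<n. x (p j) ^ m j * x n ^ (l j - 1 - m j))"
      unfolding h_def by (rule prod_sum_PiE) auto
    finally show "(\<Prod>j<n. C $$ (p j, j)) = (\<Prod>i<n. x i - x n) * (\<Sum>m\<in>Pi\<^sub>E {..<n} (\<lambda>j. {l (Suc j)..<l j}).
        \<Prod>j<n. x (p j) ^ m j * x n ^ (l j - 1 - m j))" .
  qed
  also have "x n ^ l n * \<dots> = (\<Prod>i<n. x i - x n) * (\<Sum>p | p permutes {..<n}.
      \<Sum>m\<in>Pi\<^sub>E {..<n} (\<lambda>j. {l (Suc j)..<l j}).
       (\<Prod>j<n. x n ^ (l j - 1 - m j)) * x n ^ l n * (of_int (sign p) * (\<Prod>j<n. x (p j) ^ m j)))"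
    by (simp add: sum_distrib_left prod.distrib mult_ac)
  also have "\<dots> = (\<Prod>i<n. x i - x n) * (\<Sum>m\<in>Pi\<^sub>E {..<n} (\<lambda>j. {l (Suc j)..<l j}).
       (\<Prod>j<n. x n ^ (l j - 1 - m j)) * x n ^ l n * alternant n x m)"
    by (subst sum.swap) (simp add: alternant_col sum_distrib_left)
  finally show ?thesis by (simp add: alternant_def A_def)
qed

section \<open>Tableaux with bounded entries and the branching rule\<close>

definition cells :: "(nat \<Rightarrow> nat) \<Rightarrow> (nat \<times> nat) set" where
  "cells \<rho> = {(i, j). j < \<rho> i}"

text \<open>The bound \<open>n\<close> makes \<open>tableau_sum\<close> a polynomial in
  \<open>n\<close> variables. Shapes are functions on all rows, so that rows can be shortened or cut
  off without changing the length of a list.\<close>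

definition tableaux :: "nat \<Rightarrow> (nat \<Rightarrow> nat) \<Rightarrow> (nat \<times> nat \<Rightarrow> nat) set" where
  "tableaux n \<rho> = {T \<in> cells \<rho> \<rightarrow>\<^sub>E {1..n}.
     (\<forall>i j j'. (i, j) \<in> cells \<rho> \<and> (i, j') \<in> cells \<rho> \<and> j < j' \<longrightarrow> T (i, j) \<le> T (i, j')) \<and>
     (\<forall>i i' j. (i, j) \<in> cells \<rho> \<and> (i', j) \<in> cells \<rho> \<and> i < i' \<longrightarrow> T (i, j) < T (i', j))}"

lemma tableaux_row:
  "T \<in> tableaux n \<rho> \<Longrightarrow> (i, j) \<in> cells \<rho> \<Longrightarrow> (i, j') \<in> cells \<rho> \<Longrightarrow> j < j' \<Longrightarrow> T (i, j) \<le> T (i, j')"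
  unfolding tableaux_def by blast

lemma tableaux_column:
  "T \<in> tableaux n \<rho> \<Longrightarrow> (i, j) \<in> cells \<rho> \<Longrightarrow> (i', j) \<in> cells \<rho> \<Longrightarrow> i < i' \<Longrightarrow> T (i, j) < T (i', j)"
  unfolding tableaux_def by blast

lemma tableaux_undefined: "T \<in> tableaux n \<rho> \<Longrightarrow> c \<notin> cells \<rho> \<Longrightarrow> T c = undefined"
  unfolding tableaux_def by auto

definition tableau_sum :: "nat \<Rightarrow> (nat \<Rightarrow> 'a::comm_ring_1) \<Rightarrow> (nat \<Rightarrow> nat) \<Rightarrow> 'a" where
  "tableau_sum n x \<rho> = (\<Sum>T\<in>tableaux n \<rho>. \<Prod>c\<in>cells \<rho>. x (T c))"

lemma cells_mono: "(\<And>i. \<sigma> i \<le> \<rho> i) \<Longrightarrow> cells \<sigma> \<subseteq> cells \<rho>"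
  by (auto simp: cells_def intro: less_le_trans)

lemma finite_cells:
  assumes "\<And>i. i \<ge> n \<Longrightarrow> \<rho> i = 0"
  shows "finite (cells \<rho>)"
proof -
  have "(i, j) \<in> Sigma {..<n} (\<lambda>i. {..<\<rho> i})" if "(i, j) \<in> cells \<rho>" for i j
    using assms[of i] that by (cases "i < n") (auto simp: cells_def)
  then have "cells \<rho> \<subseteq> Sigma {..<n} (\<lambda>i. {..<\<rho> i})"
    by (rule subrelI)
  then show ?thesis by (rule finite_subset) auto
qed

lemma finite_tableaux: "finite (cells \<rho>) \<Longrightarrow> finite (tableaux n \<rho>)"
  unfolding tableaux_def by (rule finite_subset[of _ "cells \<rho> \<rightarrow>\<^sub>E {1..n}"]) (auto intro: finite_PiE)

text \<open>Rows are counted from 0 and entries from 1, and columns increase strictly. Hence entries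
  up to \<open>n\<close> occur only in the first \<open>n\<close> rows, and a shape with more rows
  has no tableau with entries up to \<open>n\<close>.\<close>

lemma tableaux_entry_gt_row:
  assumes "T \<in> tableaux n \<rho>" "antimono \<rho>" "(i, j) \<in> cells \<rho>"
  shows "i < T (i, j)"
  using assms(3)
proof (induction i)
  case 0
  then show ?case using assms(1) by (fastforce simp: tableaux_def PiE_def Pi_def)
next
  case (Suc i)
  have "(i, j) \<in> cells \<rho>"
    using Suc.prems antimonoD[OF assms(2), of i "Suc i"] by (auto simp: cells_def)
  moreover from this have "T (i, j) < T (Suc i, j)"
    using assms(1) Suc.prems unfolding tableaux_def by blast
  ultimately show ?case using Suc.IH by simp
qed

text \<open>Members of \<open>Pi\<^sub>E {..<n}\<close> are \<open>undefined\<close> from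
  \<open>n\<close> on; as row lengths they need the value 0 there.\<close>

definition pad :: "nat \<Rightarrow> (nat \<Rightarrow> nat) \<Rightarrow> nat \<Rightarrow> nat" where
  "pad n \<nu> i = (if i < n then \<nu> i else 0)"

text \<open>In a weakly increasing row this is the number of entries up to \<open>n\<close>. The
  disjunct \<open>\<rho> i \<le> j\<close> makes the minimum exist when no entry exceeds
  \<open>n\<close>, and keeps it inside the shape.\<close>

definition inner_row :: "nat \<Rightarrow> (nat \<Rightarrow> nat) \<Rightarrow> (nat \<times> nat \<Rightarrow> nat) \<Rightarrow> nat \<Rightarrow> nat" where
  "inner_row n \<rho> T i = (LEAST j. \<rho> i \<le> j \<or> n < T (i, j))"

lemma inner_row_less:
  assumes "T \<in> tableaux m \<rho>" "(i, j) \<in> cells \<rho>"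
  shows "j < inner_row n \<rho> T i \<longleftrightarrow> T (i, j) \<le> n"
proof
  assume "j < inner_row n \<rho> T i"
  then show "T (i, j) \<le> n" unfolding inner_row_def by (auto dest: not_less_Least)
next
  assume *: "T (i, j) \<le> n"
  let ?k = "inner_row n \<rho> T i"
  have k: "\<rho> i \<le> ?k \<or> n < T (i, ?k)"
    unfolding inner_row_def by (rule LeastI[of _ "\<rho> i"]) simp
  show "j < ?k"
  proof (rule ccontr)
    assume "\<not> j < ?k"
    then have "?k \<le> j" by simp
    moreover have "j < \<rho> i" using assms(2) by (simp add: cells_def)
    ultimately have "n < T (i, ?k)" "(i, ?k) \<in> cells \<rho>" using k by (auto simp: cells_def)
    moreover have "T (i, ?k) \<le> T (i, j)"
      using assms \<open>?k \<le> j\<close> \<open>(i, ?k) \<in> cells \<rho>\<close> unfolding tableaux_def by (cases "?k = j") auto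
    ultimately show False using * by simp
  qed
qed

lemma inner_row_le: "inner_row n \<rho> T i \<le> \<rho> i"
  unfolding inner_row_def by (rule Least_le) simp

text \<open>A cell directly above another one holds an entry below \<open>Suc n\<close>, so the
  small entries of row \<open>i\<close> reach at least as far as row \<open>Suc i\<close>. This is
  the lower half of interlacing.\<close>

lemma inner_row_ge:
  assumes "T \<in> tableaux (Suc n) \<rho>" "antimono \<rho>"
  shows "\<rho> (Suc i) \<le> inner_row n \<rho> T i"
proof (rule ccontr)
  let ?k = "inner_row n \<rho> T i"
  assume "\<not> \<rho> (Suc i) \<le> ?k"
  then have c: "(Suc i, ?k) \<in> cells \<rho>" by (simp add: cells_def)
  then have d: "(i, ?k) \<in> cells \<rho>"
    using antimonoD[OF assms(2), of i "Suc i"] by (auto simp: cells_def)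
  have "T (i, ?k) < T (Suc i, ?k)" "T (Suc i, ?k) \<le> Suc n"
    using assms(1) c d unfolding tableaux_def by (blast, fastforce)
  moreover have "\<not> T (i, ?k) \<le> n" using inner_row_less[OF assms(1) d, of n] by simp
  ultimately show False by simp
qed

lemma pad_inner_row_less:
  assumes "T \<in> tableaux m \<rho>" "antimono \<rho>" "(i, j) \<in> cells \<rho>"
  shows "j < pad n (inner_row n \<rho> T) i \<longleftrightarrow> T (i, j) \<le> n"
  using inner_row_less[OF assms(1,3), of n] tableaux_entry_gt_row[OF assms] by (auto simp: pad_def)

lemma tableau_restrict:
  assumes "T \<in> tableaux (Suc n) \<rho>" "antimono \<rho>"
  shows "restrict T (cells (pad n (inner_row n \<rho> T))) \<in> tableaux n (pad n (inner_row n \<rho> T))"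
proof -
  let ?\<nu> = "pad n (inner_row n \<rho> T)"
  have sub: "cells ?\<nu> \<subseteq> cells \<rho>"
    using inner_row_le[of n \<rho> T] by (intro cells_mono) (simp add: pad_def)
  have "T c \<in> {1..n}" if "c \<in> cells ?\<nu>" for c
  proof -
    obtain i j where [simp]: "c = (i, j)" by (cases c)
    have "T (i, j) \<le> n"
      using pad_inner_row_less[OF assms, of i j n] that sub by (auto simp: cells_def)
    moreover have "T c \<in> {1..Suc n}" using assms(1) that sub by (auto simp: tableaux_def)
    ultimately show ?thesis by simp
  qed
  then have "restrict T (cells ?\<nu>) \<in> cells ?\<nu> \<rightarrow>\<^sub>E {1..n}" by simp
  then show ?thesis
    using tableaux_row[OF assms(1)] tableaux_column[OF assms(1)] sub
    unfolding tableaux_def by (simp add: subset_iff)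
qed

text \<open>Inverse of removing the entries \<open>Suc n\<close>. Interlacing guarantees that the
  cells filled with \<open>Suc n\<close> lie in different columns, so columns stay strict.\<close>

lemma tableau_extend:
  assumes T: "T \<in> tableaux n (pad n \<nu>)" and "antimono \<rho>" and z: "\<And>i. i \<ge> Suc n \<Longrightarrow> \<rho> i = 0"
    and \<nu>: "\<nu> \<in> Pi\<^sub>E {..<n} (\<lambda>i. {\<rho> (Suc i)..\<rho> i})"
  defines "E \<equiv> restrict (\<lambda>c. if c \<in> cells (pad n \<nu>) then T c else Suc n) (cells \<rho>)"
  shows "E \<in> tableaux (Suc n) \<rho>" "restrict (inner_row n \<rho> E) {..<n} = \<nu>"
    "restrict E (cells (pad n (inner_row n \<rho> E))) = T"
proof -
  have ran: "T c \<in> {1..n}" if "c \<in> cells (pad n \<nu>)" for c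
    using T that by (auto simp: tableaux_def)
  have bounds: "\<rho> (Suc i) \<le> \<nu> i" "\<nu> i \<le> \<rho> i" if "i < n" for i
    using \<nu> that by (fastforce simp: PiE_def Pi_def)+
  have sub: "cells (pad n \<nu>) \<subseteq> cells \<rho>"
    using bounds(2) by (intro cells_mono) (simp add: pad_def)
  show E: "E \<in> tableaux (Suc n) \<rho>"
    unfolding tableaux_def
  proof (intro CollectI conjI allI impI)
    show "E \<in> cells \<rho> \<rightarrow>\<^sub>E {1..Suc n}"
      using ran by (fastforce simp: E_def)
  next
    fix i j j' :: nat assume "(i, j) \<in> cells \<rho> \<and> (i, j') \<in> cells \<rho> \<and> j < j'"
    then have *: "(i, j) \<in> cells \<rho>" "(i, j') \<in> cells \<rho>" "j < j'" by auto
    show "E (i, j) \<le> E (i, j')"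
    proof (cases "(i, j') \<in> cells (pad n \<nu>)")
      case True
      then have "(i, j) \<in> cells (pad n \<nu>)" using * by (auto simp: cells_def)
      then show ?thesis using True * T by (auto simp: E_def tableaux_def)
    next
      case False
      then show ?thesis using * ran[of "(i, j)"] by (auto simp: E_def)
    qed
  next
    fix i i' j :: nat assume "(i, j) \<in> cells \<rho> \<and> (i', j) \<in> cells \<rho> \<and> i < i'"
    then have *: "(i, j) \<in> cells \<rho>" "(i', j) \<in> cells \<rho>" "i < i'" by auto
    have "i < n" using * z[of i'] by (cases "i' \<le> n") (auto simp: cells_def)
    \<comment> \<open>Row \<open>i\<close> of the inner shape is at least as long as row
      \<open>Suc i\<close> of the outer one, so a cell with another cell below it belongs to the
      inner shape.\<close>
    have "\<rho> i' \<le> \<rho> (Suc i)" using \<open>antimono \<rho>\<close> * by (auto intro: antimonoD)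
    then have 1: "(i, j) \<in> cells (pad n \<nu>)"
      using bounds(1)[OF \<open>i < n\<close>] * \<open>i < n\<close> by (auto simp: cells_def pad_def)
    show "E (i, j) < E (i', j)"
    proof (cases "(i', j) \<in> cells (pad n \<nu>)")
      case True
      then show ?thesis using 1 * T by (auto simp: E_def tableaux_def)
    next
      case False
      then show ?thesis using 1 * ran[of "(i, j)"] by (auto simp: E_def)
    qed
  qed
  have iff: "(j < inner_row n \<rho> E i) = (j < \<nu> i)" if "i < n" for i j
  proof (cases "(i, j) \<in> cells \<rho>")
    case True
    then have "j < inner_row n \<rho> E i \<longleftrightarrow> E (i, j) \<le> n" using inner_row_less[OF E] by blast
    also have "\<dots> \<longleftrightarrow> (i, j) \<in> cells (pad n \<nu>)"
      using True ran[of "(i, j)"] by (auto simp: E_def)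
    finally show ?thesis using that by (simp add: cells_def pad_def)
  next
    case False
    then show ?thesis using inner_row_le[of n \<rho> E i] bounds(2)[OF that] by (auto simp: cells_def)
  qed
  have eq: "inner_row n \<rho> E i = \<nu> i" if "i < n" for i
  proof (rule antisym)
    show "inner_row n \<rho> E i \<le> \<nu> i" using iff[OF that, of "\<nu> i"] by simp
    show "\<nu> i \<le> inner_row n \<rho> E i" using iff[OF that, of "inner_row n \<rho> E i"] by simp
  qed
  then show "restrict (inner_row n \<rho> E) {..<n} = \<nu>"
    using \<nu> by (auto simp: restrict_def PiE_def extensional_def fun_eq_iff)
  have pad_eq: "pad n (inner_row n \<rho> E) = pad n \<nu>" using eq by (auto simp: pad_def)
  show "restrict E (cells (pad n (inner_row n \<rho> E))) = T"
    unfolding pad_eq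
  proof
    fix c show "restrict E (cells (pad n \<nu>)) c = T c"
      using tableaux_undefined[OF T, of c] sub by (cases "c \<in> cells (pad n \<nu>)") (auto simp: E_def)
  qed
qed

text \<open>Deleting the entries \<open>Suc n\<close> leaves a tableau whose row lengths interlace
  with \<open>\<rho>\<close>, and row \<open>i\<close> loses \<open>\<rho> i - \<nu> i\<close>
  cells. Row \<open>n\<close> can only contain \<open>Suc n\<close> and disappears altogether, which
  gives the separate factor.\<close>

lemma tableau_sum_Suc:
  fixes x :: "nat \<Rightarrow> 'a::comm_ring_1"
  assumes anti: "antimono \<rho>" and z: "\<And>i. i \<ge> Suc n \<Longrightarrow> \<rho> i = 0"
  shows "tableau_sum (Suc n) x \<rho> = (\<Sum>\<nu>\<in>Pi\<^sub>E {..<n} (\<lambda>i. {\<rho> (Suc i)..\<rho> i}).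
    (\<Prod>i<n. x (Suc n) ^ (\<rho> i - \<nu> i)) * x (Suc n) ^ \<rho> n * tableau_sum n x (pad n \<nu>))"
proof -
  let ?N = "Pi\<^sub>E {..<n} (\<lambda>i. {\<rho> (Suc i)..\<rho> i})"
  let ?w = "\<lambda>\<nu>. (\<Prod>i<n. x (Suc n) ^ (\<rho> i - \<nu> i)) * x (Suc n) ^ \<rho> n"
  have fin: "finite (cells \<rho>)" by (rule finite_cells[OF z])
  have pad_restrict: "pad n (restrict \<nu> {..<n}) = pad n \<nu>" for \<nu>
    by (auto simp: pad_def)
  have "tableau_sum (Suc n) x \<rho> = (\<Sum>(\<nu>, T)\<in>(SIGMA \<nu>:?N. tableaux n (pad n \<nu>)).
      ?w \<nu> * (\<Prod>c\<in>cells (pad n \<nu>). x (T c)))"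
    unfolding tableau_sum_def
  proof (rule sum.reindex_bij_witness[where
        j = "\<lambda>T. (restrict (inner_row n \<rho> T) {..<n}, restrict T (cells (pad n (inner_row n \<rho> T))))" and
        i = "\<lambda>(\<nu>, T). restrict (\<lambda>c. if c \<in> cells (pad n \<nu>) then T c else Suc n) (cells \<rho>)"])
    fix T assume T: "T \<in> tableaux (Suc n) \<rho>"
    let ?\<nu> = "pad n (inner_row n \<rho> T)"
    have big: "T (i, j) = Suc n" if "(i, j) \<in> cells \<rho>" "(i, j) \<notin> cells ?\<nu>" for i j
    proof -
      have "n < T (i, j)" using pad_inner_row_less[OF T anti that(1), of n] that(2) by (simp add: cells_def)
      moreover have "T (i, j) \<in> {1..Suc n}" using T that(1) unfolding tableaux_def by blast
      ultimately show ?thesis by simp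
    qed
    have sub: "cells ?\<nu> \<subseteq> cells \<rho>"
      using inner_row_le[of n \<rho> T] by (intro cells_mono) (simp add: pad_def)
    show "(case (restrict (inner_row n \<rho> T) {..<n}, restrict T (cells ?\<nu>)) of (\<nu>, T) \<Rightarrow>
        restrict (\<lambda>c. if c \<in> cells (pad n \<nu>) then T c else Suc n) (cells \<rho>)) = T"
      unfolding prod.case pad_restrict using big tableaux_undefined[OF T] by (auto simp: fun_eq_iff)
    show "(restrict (inner_row n \<rho> T) {..<n}, restrict T (cells ?\<nu>)) \<in> (SIGMA \<nu>:?N. tableaux n (pad n \<nu>))"
      using tableau_restrict[OF T anti] inner_row_le[of n \<rho> T] inner_row_ge[OF T anti]
      by (auto simp: pad_restrict)
    have "(\<Prod>c\<in>cells \<rho>. x (T c)) = (\<Prod>c\<in>cells \<rho> - cells ?\<nu>. x (T c)) * (\<Prod>c\<in>cells ?\<nu>. x (T c))"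
      by (rule prod.subset_diff[OF sub fin])
    also have "(\<Prod>c\<in>cells \<rho> - cells ?\<nu>. x (T c)) = (\<Prod>c\<in>cells \<rho> - cells ?\<nu>. x (Suc n))"
      by (rule prod.cong) (use big in auto)
    also have "cells \<rho> - cells ?\<nu> = (SIGMA i:{..n}. {?\<nu> i..<\<rho> i})"
    proof -
      have "(i, j) \<in> cells \<rho> - cells ?\<nu> \<longleftrightarrow> (i, j) \<in> (SIGMA i:{..n}. {?\<nu> i..<\<rho> i})" for i j
        using z[of i] by (cases "i \<le> n") (auto simp: cells_def)
      then show ?thesis by (simp add: set_eq_iff)
    qed
    also have "(\<Prod>c\<in>(SIGMA i:{..n}. {?\<nu> i..<\<rho> i}). x (Suc n)) = (\<Prod>i\<le>n. \<Prod>j\<in>{?\<nu> i..<\<rho> i}. x (Suc n))"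
      by (subst prod.Sigma) auto
    also have "\<dots> = ?w (inner_row n \<rho> T)"
      unfolding lessThan_Suc_atMost[symmetric] by (simp add: pad_def)
    finally show "(case (restrict (inner_row n \<rho> T) {..<n}, restrict T (cells ?\<nu>)) of (\<nu>, T) \<Rightarrow>
        ?w \<nu> * (\<Prod>c\<in>cells (pad n \<nu>). x (T c))) = (\<Prod>c\<in>cells \<rho>. x (T c))"
      by (simp add: pad_restrict)
  next
    fix b assume "b \<in> (SIGMA \<nu>:?N. tableaux n (pad n \<nu>))"
    then obtain \<nu> T where b: "b = (\<nu>, T)" "\<nu> \<in> ?N" "T \<in> tableaux n (pad n \<nu>)" by auto
    note ext = tableau_extend[OF b(3) anti z b(2)]
    show "(case b of (\<nu>, T) \<Rightarrow> restrict (\<lambda>c. if c \<in> cells (pad n \<nu>) then T c else Suc n) (cells \<rho>))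
        \<in> tableaux (Suc n) \<rho>"
      using ext(1) by (simp add: b)
    show "(restrict (inner_row n \<rho> (case b of (\<nu>, T) \<Rightarrow> restrict (\<lambda>c. if c \<in> cells (pad n \<nu>) then T c else Suc n) (cells \<rho>))) {..<n},
        restrict (case b of (\<nu>, T) \<Rightarrow> restrict (\<lambda>c. if c \<in> cells (pad n \<nu>) then T c else Suc n) (cells \<rho>))
          (cells (pad n (inner_row n \<rho> (case b of (\<nu>, T) \<Rightarrow> restrict (\<lambda>c. if c \<in> cells (pad n \<nu>) then T c else Suc n) (cells \<rho>)))))) = b"
      using ext(2,3) by (simp add: b)
  qed
  also have "\<dots> = (\<Sum>\<nu>\<in>?N. \<Sum>T\<in>tableaux n (pad n \<nu>). ?w \<nu> * (\<Prod>c\<in>cells (pad n \<nu>). x (T c)))"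
  proof (rule sum.Sigma[symmetric])
    show "finite ?N" by (intro finite_PiE) auto
    show "\<forall>\<nu>\<in>?N. finite (tableaux n (pad n \<nu>))"
      by (intro ballI finite_tableaux finite_cells[of n]) (simp add: pad_def)
  qed
  finally show ?thesis by (simp add: tableau_sum_def sum_distrib_left)
qed

section \<open>The bialternant formula\<close>

lemma vandermonde_Suc:
  fixes x :: "nat \<Rightarrow> 'a::comm_ring_1"
  shows "alternant (Suc n) x (\<lambda>j. n - j) = (\<Prod>i<n. x i - x n) * alternant n x (\<lambda>j. n - Suc j)"
proof -
  \<comment> \<open>For consecutive exponents every interval contains a single number, so the sum in
    \<open>alternant_Suc\<close> has one term.\<close>
  have PiE: "Pi\<^sub>E {..<n} (\<lambda>j. {n - Suc j..<n - j}) = {restrict (\<lambda>j. n - Suc j) {..<n}}"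
  proof -
    have "Pi\<^sub>E {..<n} (\<lambda>j. {n - Suc j..<n - j}) = Pi\<^sub>E {..<n} (\<lambda>j. {n - Suc j})"
      by (rule PiE_cong) auto
    also have "\<dots> = {restrict (\<lambda>j. n - Suc j) {..<n}}"
      by (auto simp: PiE_def Pi_def extensional_def restrict_def fun_eq_iff)
    finally show ?thesis .
  qed
  have "alternant (Suc n) x (\<lambda>j. n - j) = (\<Prod>i<n. x i - x n) *
     (\<Prod>j<n. x n ^ (n - j - 1 - restrict (\<lambda>j. n - Suc j) {..<n} j)) * x n ^ (n - n)
       * alternant n x (restrict (\<lambda>j. n - Suc j) {..<n})"
    by (subst alternant_Suc) (auto simp: PiE mult_ac)
  also have "(\<Prod>j<n. x n ^ (n - j - 1 - restrict (\<lambda>j. n - Suc j) {..<n} j)) = 1"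
    by (rule prod.neutral) auto
  also have "alternant n x (restrict (\<lambda>j. n - Suc j) {..<n}) = alternant n x (\<lambda>j. n - Suc j)"
    by (rule alternant_cong) auto
  finally show ?thesis by simp
qed

text \<open>Both sides satisfy the same recursion. With \<open>l j = \<rho> j + (n - j)\<close>,
  adding the smaller staircase \<open>n - Suc j\<close> carries the closed interlacing interval from
  \<open>\<rho> (Suc j)\<close> to \<open>\<rho> j\<close> onto the half-open interval from
  \<open>l (Suc j)\<close> to \<open>l j\<close>. The index \<open>Suc i\<close> appears because
  alternants count variables from 0 and tableau entries start at 1.\<close>

theorem bialternant:
  fixes x :: "nat \<Rightarrow> 'a::comm_ring_1"
  assumes "antimono \<rho>" "\<And>i. i \<ge> n \<Longrightarrow> \<rho> i = 0"
  shows "alternant n (\<lambda>i. x (Suc i)) (\<lambda>j. n - Suc j) * tableau_sum n x \<rho>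
    = alternant n (\<lambda>i. x (Suc i)) (\<lambda>j. \<rho> j + (n - Suc j))"
  using assms
proof (induction n arbitrary: \<rho>)
  case 0
  then have "cells \<rho> = {}" by (auto simp: cells_def)
  then show ?case by (simp add: tableau_sum_def tableaux_def alternant_def)
next
  case (Suc n)
  let ?y = "\<lambda>i. x (Suc i)"
  let ?l = "\<lambda>j. \<rho> j + (n - j)"
  let ?D = "\<Prod>i<n. ?y i - ?y n"
  let ?N = "Pi\<^sub>E {..<n} (\<lambda>i. {\<rho> (Suc i)..\<rho> i})"
  have dec: "\<rho> (Suc j) \<le> \<rho> j" for j using Suc.prems(1) by (auto intro: antimonoD)
  have IH: "alternant n ?y (\<lambda>j. n - Suc j) * tableau_sum n x (pad n \<nu>)
      = alternant n ?y (\<lambda>j. \<nu> j + (n - Suc j))" if "\<nu> \<in> ?N" for \<nu>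
  proof -
    have b: "\<rho> (Suc i) \<le> \<nu> i \<and> \<nu> i \<le> \<rho> i" if "i < n" for i
      using \<open>\<nu> \<in> ?N\<close> that by (fastforce simp: PiE_def Pi_def)
    have "pad n \<nu> (Suc i) \<le> pad n \<nu> i" for i
      using b[of i] b[of "Suc i"] by (auto simp: pad_def)
    then have "antimono (pad n \<nu>)"
      by (auto simp: antimono_iff_le_Suc)
    then have "alternant n ?y (\<lambda>j. n - Suc j) * tableau_sum n x (pad n \<nu>)
        = alternant n ?y (\<lambda>j. pad n \<nu> j + (n - Suc j))"
      by (rule Suc.IH) (simp add: pad_def)
    also have "\<dots> = alternant n ?y (\<lambda>j. \<nu> j + (n - Suc j))"
      by (rule alternant_cong) (auto simp: pad_def)
    finally show ?thesis .
  qed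
  have "alternant (Suc n) ?y (\<lambda>j. n - j) * tableau_sum (Suc n) x \<rho>
    = ?D * (\<Sum>\<nu>\<in>?N. (\<Prod>i<n. ?y n ^ (\<rho> i - \<nu> i)) * ?y n ^ \<rho> n
        * (alternant n ?y (\<lambda>j. n - Suc j) * tableau_sum n x (pad n \<nu>)))"
    using vandermonde_Suc[of n ?y] Suc.prems
    by (subst tableau_sum_Suc) (auto simp: sum_distrib_left mult_ac)
  also have "\<dots> = ?D * (\<Sum>\<nu>\<in>?N. (\<Prod>i<n. ?y n ^ (\<rho> i - \<nu> i)) * ?y n ^ \<rho> n
        * alternant n ?y (\<lambda>j. \<nu> j + (n - Suc j)))"
    using IH by simp
  also have "(\<Sum>\<nu>\<in>?N. (\<Prod>i<n. ?y n ^ (\<rho> i - \<nu> i)) * ?y n ^ \<rho> n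
        * alternant n ?y (\<lambda>j. \<nu> j + (n - Suc j)))
    = (\<Sum>m\<in>Pi\<^sub>E {..<n} (\<lambda>j. {?l (Suc j)..<?l j}).
       (\<Prod>j<n. ?y n ^ (?l j - 1 - m j)) * ?y n ^ ?l n * alternant n ?y m)"
  proof (rule sum.reindex_bij_witness[where
        j = "\<lambda>\<nu>. restrict (\<lambda>j. \<nu> j + (n - Suc j)) {..<n}" and
        i = "\<lambda>m. restrict (\<lambda>j. m j - (n - Suc j)) {..<n}"])
    fix \<nu> assume \<nu>: "\<nu> \<in> ?N"
    have b: "\<rho> (Suc i) \<le> \<nu> i \<and> \<nu> i \<le> \<rho> i" if "i < n" for i
      using \<nu> that by (fastforce simp: PiE_def Pi_def)
    show "restrict (\<lambda>j. restrict (\<lambda>j. \<nu> j + (n - Suc j)) {..<n} j - (n - Suc j)) {..<n} = \<nu>"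
      using \<nu> by (auto simp: restrict_def fun_eq_iff PiE_def extensional_def)
    show "restrict (\<lambda>j. \<nu> j + (n - Suc j)) {..<n} \<in> Pi\<^sub>E {..<n} (\<lambda>j. {?l (Suc j)..<?l j})"
    proof (rule restrict_PiE_iff[THEN iffD2], rule ballI)
      fix j assume "j \<in> {..<n}"
      then show "\<nu> j + (n - Suc j) \<in> {?l (Suc j)..<?l j}" using b[of j] by auto
    qed
    have "alternant n ?y (restrict (\<lambda>j. \<nu> j + (n - Suc j)) {..<n}) = alternant n ?y (\<lambda>j. \<nu> j + (n - Suc j))"
      by (rule alternant_cong) auto
    moreover have "(\<Prod>j<n. ?y n ^ (?l j - 1 - restrict (\<lambda>j. \<nu> j + (n - Suc j)) {..<n} j))
        = (\<Prod>i<n. ?y n ^ (\<rho> i - \<nu> i))"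
    proof (rule prod.cong)
      fix j assume "j \<in> {..<n}"
      then have "?l j - 1 - restrict (\<lambda>j. \<nu> j + (n - Suc j)) {..<n} j = \<rho> j - \<nu> j"
        using b[of j] by auto
      then show "?y n ^ (?l j - 1 - restrict (\<lambda>j. \<nu> j + (n - Suc j)) {..<n} j) = ?y n ^ (\<rho> j - \<nu> j)"
        by (rule arg_cong)
    qed simp
    ultimately show "(\<Prod>j<n. ?y n ^ (?l j - 1 - restrict (\<lambda>j. \<nu> j + (n - Suc j)) {..<n} j)) * ?y n ^ ?l n
        * alternant n ?y (restrict (\<lambda>j. \<nu> j + (n - Suc j)) {..<n})
       = (\<Prod>i<n. ?y n ^ (\<rho> i - \<nu> i)) * ?y n ^ \<rho> n * alternant n ?y (\<lambda>j. \<nu> j + (n - Suc j))"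
      by simp
  next
    fix m assume m: "m \<in> Pi\<^sub>E {..<n} (\<lambda>j. {?l (Suc j)..<?l j})"
    have b: "\<rho> (Suc j) + (n - Suc j) \<le> m j \<and> m j < \<rho> j + (n - j)" if "j < n" for j
      using m that by (fastforce simp: PiE_def Pi_def)
    show "restrict (\<lambda>j. restrict (\<lambda>j. m j - (n - Suc j)) {..<n} j + (n - Suc j)) {..<n} = m"
    proof
      fix j show "restrict (\<lambda>j. restrict (\<lambda>j. m j - (n - Suc j)) {..<n} j + (n - Suc j)) {..<n} j = m j"
        using b[of j] m by (auto simp: PiE_def extensional_def)
    qed
    show "restrict (\<lambda>j. m j - (n - Suc j)) {..<n} \<in> ?N"
    proof (rule restrict_PiE_iff[THEN iffD2], rule ballI)
      fix j assume "j \<in> {..<n}"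
      then show "m j - (n - Suc j) \<in> {\<rho> (Suc j)..\<rho> j}" using b[of j] by auto
    qed
  qed
  also have "?D * \<dots> = alternant (Suc n) ?y ?l"
  proof (rule alternant_Suc[symmetric])
    fix j assume "j < n"
    then show "?l (Suc j) < ?l j" using dec[of j] by auto
  qed
  finally show ?case by simp
qed

hide_const (open) Polynomial.content

abbreviation "lookup \<equiv> Poly_Mapping.lookup"
abbreviation "keys \<equiv> Poly_Mapping.keys"
abbreviation "single \<equiv> Poly_Mapping.single"

section \<open>Schur functions as polynomials\<close>

text \<open>Positions are counted from 0, as in lists and permutations of \<open>{..<n}\<close>, but
  index 0 is never a colour; hence the shift by one.\<close>

definition expo :: "nat \<Rightarrow> (nat \<Rightarrow> nat) \<Rightarrow> (nat \<Rightarrow>\<^sub>0 nat)" where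
  "expo n a = (\<Sum>i<n. single (Suc i) (a i))"

lemma lookup_expo: "lookup (expo n a) k = (if 1 \<le> k \<and> k \<le> n then a (k - 1) else 0)"
proof -
  have "lookup (expo n a) k = (\<Sum>i<n. if i = k - 1 \<and> 1 \<le> k then a i else 0)"
    unfolding expo_def lookup_sum by (rule sum.cong) (auto simp: lookup_single when_def)
  also have "\<dots> = (\<Sum>i<n. if i = k - 1 then (if 1 \<le> k then a i else 0) else 0)"
    by (rule sum.cong) auto
  also have "\<dots> = (if 1 \<le> k \<and> k \<le> n then a (k - 1) else 0)"
    by (auto simp: sum.delta')
  finally show ?thesis .
qed

lemma expo_eq_iff: "expo n a = expo n b \<longleftrightarrow> (\<forall>i<n. a i = b i)"
proof
  assume eq: "expo n a = expo n b"
  show "\<forall>i<n. a i = b i"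
  proof (intro allI impI)
    fix i assume "i < n"
    with arg_cong[OF eq, of "\<lambda>m. lookup m (Suc i)"] show "a i = b i" by (simp add: lookup_expo)
  qed
next
  assume "\<forall>i<n. a i = b i"
  then show "expo n a = expo n b" by (simp add: expo_def)
qed

lemma expo_cong: "(\<And>i. i < n \<Longrightarrow> a i = b i) \<Longrightarrow> expo n a = expo n b"
  by (simp add: expo_eq_iff)

lemma expo_add: "expo n a + expo n b = expo n (\<lambda>i. a i + b i)"
  by (simp add: expo_def single_add sum.distrib)

lemma keys_expo: "keys (expo n a) = Suc ` {i. i < n \<and> a i \<noteq> 0}"
proof -
  have "k \<in> keys (expo n a) \<longleftrightarrow> k \<in> Suc ` {i. i < n \<and> a i \<noteq> 0}" for k
    by (cases k) (auto simp: in_keys_iff lookup_expo)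
  then show ?thesis by blast
qed

lemma sum_keys_expo:
  "(\<Sum>k\<in>keys (expo n a). h (lookup (expo n a) k)) = (\<Sum>i | i < n \<and> a i \<noteq> 0. h (a i))"
  unfolding keys_expo by (subst sum.reindex) (auto simp: lookup_expo)

lemma lookup_content:
  assumes "finite A"
  shows "lookup (content A f) k = card {a \<in> A. f a = k}"
proof -
  have "lookup (content A f) k = (\<Sum>a\<in>A. if f a = k then 1 else 0)"
    unfolding Defs.content_def lookup_sum by (rule sum.cong) (auto simp: lookup_single when_def)
  then show ?thesis using assms by (simp add: sum.If_cases Int_def)
qed

lemma keys_content: "finite A \<Longrightarrow> keys (content A f) = f ` A"
  by (auto simp: in_keys_iff lookup_content)

lemma sum_lookup_content:
  assumes "finite A"
  shows "(\<Sum>k\<in>keys (content A f). lookup (content A f) k) = card A"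
proof -
  have "card A = (\<Sum>k\<in>f ` A. \<Sum>a | a \<in> A \<and> f a = k. 1)"
    using sum.image_gen[OF assms, of "\<lambda>_. 1::nat" f] by simp
  then show ?thesis using assms by (simp add: keys_content lookup_content)
qed

definition shift_perm :: "(nat \<Rightarrow> nat) \<Rightarrow> nat \<Rightarrow> nat" where
  "shift_perm p k = (if k = 0 then 0 else Suc (p (k - 1)))"

lemma bij_shift_perm:
  assumes "bij p"
  shows "bij (shift_perm p)"
proof (rule o_bij)
  have comp: "shift_perm q \<circ> shift_perm r = shift_perm (q \<circ> r)" for q r
    by (auto simp: shift_perm_def)
  have id: "shift_perm id = id" by (auto simp: shift_perm_def)
  show "shift_perm (inv_into UNIV p) \<circ> shift_perm p = id" "shift_perm p \<circ> shift_perm (inv_into UNIV p) = id"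
    using assms by (simp_all add: comp id bij_is_inj surj_iff[THEN iffD1, OF bij_is_surj])
qed

lemma content_shift_perm:
  assumes p: "p permutes {..<n}" and A: "finite A"
  shows "content A (\<lambda>c. shift_perm p (f c)) = expo n a \<longleftrightarrow> content A f = expo n (a \<circ> p)"
proof -
  have bij: "bij (shift_perm p)" by (rule bij_shift_perm[OF permutes_bij[OF p]])
  have 1: "lookup (content A (\<lambda>c. shift_perm p (f c))) (shift_perm p k) = lookup (content A f) k" for k
    using bij_is_inj[OF bij] by (simp add: lookup_content[OF A] inj_eq)
  have 2: "lookup (expo n a) (shift_perm p k) = lookup (expo n (a \<circ> p)) k" for k
    using permutes_in_image[OF p, of "k - 1"] by (cases k) (auto simp: lookup_expo shift_perm_def)
  \<comment> \<open>As \<open>shift_perm p\<close> is onto, it suffices to compare coefficients at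
    its values, where both sides are known.\<close>
  have "content A (\<lambda>c. shift_perm p (f c)) = expo n a \<longleftrightarrow>
      (\<forall>k. lookup (content A (\<lambda>c. shift_perm p (f c))) (shift_perm p k) = lookup (expo n a) (shift_perm p k))"
    using bij_is_surj[OF bij] by (metis (no_types) poly_mapping_eqI surjD)
  also have "\<dots> \<longleftrightarrow> content A f = expo n (a \<circ> p)"
    unfolding 1 2 by (auto intro: poly_mapping_eqI)
  finally show ?thesis .
qed

lemma expo_of_keys:
  assumes "keys \<alpha> \<subseteq> {1..n}"
  shows "\<alpha> = expo n (\<lambda>i. lookup \<alpha> (Suc i))"
proof (rule poly_mapping_eqI)
  fix k
  show "lookup \<alpha> k = lookup (expo n (\<lambda>i. lookup \<alpha> (Suc i))) k"
    using assms by (cases "k \<in> {1..n}") (auto simp: lookup_expo in_keys_iff)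
qed

section \<open>Tableau polynomials and Schur functions\<close>

definition var :: "nat \<Rightarrow> (nat \<Rightarrow>\<^sub>0 nat) \<Rightarrow>\<^sub>0 int" where
  "var i = single (single i 1) 1"

lemma var_power: "var i ^ k = single (single i k) 1"
proof (induction k)
  case 0
  then show ?case by (simp add: single_one)
next
  case (Suc k)
  then show ?case by (simp add: var_def mult_single flip: single_add)
qed

lemma prod_single:
  "(\<Prod>a\<in>A. single (g a) (1::int)) = single (\<Sum>a\<in>A. (g a :: nat \<Rightarrow>\<^sub>0 nat)) 1"
  by (induction A rule: infinite_finite_induct) (simp_all add: single_one mult_single)

lemma prod_var_power: "(\<Prod>i<n. var (Suc i) ^ a i) = single (expo n a) 1"
  by (simp add: var_power prod_single expo_def)

lemma prod_var: "(\<Prod>c\<in>A. var (f c)) = single (content A f) 1"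
  by (simp add: var_def prod_single Defs.content_def)

lemma alternant_var:
  "alternant n (\<lambda>i. var (Suc i)) l =
    (\<Sum>w | w permutes {..<n}. single (expo n (l \<circ> w)) (sign w))"
proof -
  have "of_int k * single a (1::int) = single a k" for k and a :: "nat \<Rightarrow>\<^sub>0 nat"
    by (simp add: mult_single flip: single_of_int)
  then show ?thesis by (simp add: alternant_row prod_var_power o_def)
qed

text \<open>The recursion splits off differences of distinct variables, and the polynomial ring has
  no zero divisors. This is what later allows cancellation.\<close>

lemma vandermonde_nonzero: "alternant n (\<lambda>i. var (Suc i)) (\<lambda>j. n - Suc j) \<noteq> 0"
proof (induction n)
  case 0
  then show ?case by (simp add: alternant_def)
next
  case (Suc n)
  have "var (Suc i) - var (Suc n) \<noteq> 0" if "i < n" for i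
  proof -
    have "(single (Suc i) 1 :: nat \<Rightarrow>\<^sub>0 nat) \<noteq> single (Suc n) 1"
      using that by (metis lookup_single_eq lookup_single_not_eq nat.inject less_irrefl one_neq_zero)
    then show ?thesis
      by (metis var_def lookup_single_eq lookup_single_not_eq one_neq_zero right_minus_eq)
  qed
  then show ?case using Suc by (simp add: vandermonde_Suc)
qed

definition part_row :: "nat list \<Rightarrow> nat \<Rightarrow> nat" where
  "part_row \<mu> i = (if i < length \<mu> then \<mu> ! i else 0)"

lemma diagram_eq_cells: "diagram \<mu> = cells (part_row \<mu>)"
  by (auto simp: diagram_def cells_def part_row_def split: if_splits)

lemma finite_diagram: "finite (diagram \<mu>)"
  unfolding diagram_eq_cells by (rule finite_cells[of "length \<mu>"]) (simp add: part_row_def)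

lemma card_diagram: "card (diagram \<mu>) = sum_list \<mu>"
proof -
  have "diagram \<mu> = (SIGMA i:{..<length \<mu>}. {..<\<mu> ! i})" by (auto simp: diagram_def)
  then show ?thesis by (simp add: sum_list_sum_nth atLeast0LessThan)
qed

lemma antimono_row:
  assumes "is_partition \<mu>"
  shows "antimono (part_row \<mu>)"
proof (rule antimonoI)
  fix i j :: nat assume "i \<le> j"
  then show "part_row \<mu> j \<le> part_row \<mu> i"
    using assms by (cases "i = j") (auto simp: is_partition_def part_row_def sorted_wrt_iff_nth_less)
qed

lemma lookup_tableau_sum:
  assumes "finite (cells \<rho>)"
  shows "lookup (tableau_sum n var \<rho>) \<alpha> = int (card {T \<in> tableaux n \<rho>. content (cells \<rho>) T = \<alpha>})"
proof -
  have "lookup (tableau_sum n var \<rho>) \<alpha> = (\<Sum>T\<in>tableaux n \<rho>. if content (cells \<rho>) T = \<alpha> then 1 else 0)"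
    unfolding tableau_sum_def prod_var lookup_sum by (rule sum.cong) (auto simp: lookup_single when_def)
  then show ?thesis using finite_tableaux[OF assms] by (simp add: sum.If_cases Int_def)
qed

text \<open>The content records which entries occur, so its support already bounds them. This is how
  coefficients of the infinite series \<open>schur\<close> are found in a polynomial.\<close>

lemma ssyt_content:
  assumes "keys \<alpha> \<subseteq> {1..n}"
  shows "{T \<in> ssyt \<mu>. content (diagram \<mu>) T = \<alpha>}
    = {T \<in> tableaux n (part_row \<mu>). content (cells (part_row \<mu>)) T = \<alpha>}"
proof -
  have "T \<in> diagram \<mu> \<rightarrow>\<^sub>E {1..} \<longleftrightarrow> T \<in> diagram \<mu> \<rightarrow>\<^sub>E {1..n}" if "content (diagram \<mu>) T = \<alpha>" for T
  proof -
    have "T ` diagram \<mu> \<subseteq> {1..n}"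
      using assms that keys_content[OF finite_diagram, of \<mu> T] by simp
    then show ?thesis by (auto simp: PiE_def Pi_def)
  qed
  then show ?thesis
    unfolding ssyt_def tableaux_def diagram_eq_cells[symmetric] by blast
qed

lemma schur_eq_lookup:
  assumes "keys \<alpha> \<subseteq> {1..n}"
  shows "schur \<mu> \<alpha> = lookup (tableau_sum n var (part_row \<mu>)) \<alpha>"
  using finite_diagram[of \<mu>] ssyt_content[OF assms, of \<mu>]
  by (simp add: schur_def lookup_tableau_sum diagram_eq_cells)

lemma schur_expo: "schur \<mu> (expo n a) = lookup (tableau_sum n var (part_row \<mu>)) (expo n a)"
  by (rule schur_eq_lookup) (auto simp: keys_expo)

text \<open>Row \<open>n\<close> is nonempty because a partition has no zero parts, and its first
  entry would have to exceed \<open>n\<close>.\<close>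

lemma tableau_sum_too_long:
  assumes "is_partition \<mu>" "n < length \<mu>"
  shows "tableau_sum n x (part_row \<mu>) = 0"
proof -
  have c: "(n, 0) \<in> cells (part_row \<mu>)"
    using assms by (auto simp: cells_def part_row_def is_partition_def) (metis gr0I nth_mem)
  have False if "T \<in> tableaux n (part_row \<mu>)" for T
  proof -
    have "n < T (n, 0)" by (rule tableaux_entry_gt_row[OF that antimono_row[OF assms(1)] c])
    moreover have "T (n, 0) \<in> {1..n}" using that c unfolding tableaux_def by blast
    ultimately show False by simp
  qed
  then have "tableaux n (part_row \<mu>) = {}" by blast
  then show ?thesis by (simp add: tableau_sum_def)
qed

lemma schur_nonzero:
  assumes "schur \<mu> \<alpha> \<noteq> 0"
  shows "0 \<notin> keys \<alpha>" "(\<Sum>k\<in>keys \<alpha>. lookup \<alpha> k) = sum_list \<mu>"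
proof -
  have "{T \<in> ssyt \<mu>. content (diagram \<mu>) T = \<alpha>} \<noteq> {}"
    using assms unfolding schur_def by (metis card.empty of_nat_0)
  then obtain T where T: "T \<in> ssyt \<mu>" "content (diagram \<mu>) T = \<alpha>" by blast
  then show "(\<Sum>k\<in>keys \<alpha>. lookup \<alpha> k) = sum_list \<mu>"
    using sum_lookup_content[OF finite_diagram, of \<mu> T] by (simp add: card_diagram)
  have "keys \<alpha> = T ` diagram \<mu>" using T keys_content[OF finite_diagram] by blast
  moreover have "T ` diagram \<mu> \<subseteq> {1..}" using T(1) by (auto simp: ssyt_def)
  ultimately show "0 \<notin> keys \<alpha>" by auto
qed

text \<open>Every exponent vector that avoids index 0 has the form \<open>expo n a\<close> for some
  \<open>n\<close>, so permuting finitely many positions covers all relevant vectors.\<close>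

definition symmetric_series :: "power_series \<Rightarrow> bool" where
  "symmetric_series f \<longleftrightarrow> (\<forall>n a p. p permutes {..<n} \<longrightarrow> f (expo n (a \<circ> p)) = f (expo n a))"

lemma alternant_permute:
  assumes "p permutes {..<n}"
  shows "alternant n (\<lambda>i. x (p i)) l = of_int (sign p) * alternant n x l"
proof -
  have p: "p permutes {0..<n}" using assms by (simp add: atLeast0LessThan)
  have "mat n n (\<lambda>(i, j). mat n n (\<lambda>(i, j). x i ^ l j) $$ (p i, j)) = mat n n (\<lambda>(i, j). x (p i) ^ l j)"
    by (rule eq_matI) (use permutes_in_image[OF p] in auto)
  then show ?thesis
    using det_permute_rows[OF _ p, of "mat n n (\<lambda>(i, j). x i ^ l j)"] by (simp add: alternant_def)
qed

text \<open>Permuting the variables multiplies both alternants of the bialternant formula by the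
  sign, so their quotient does not change. For a shape with more than \<open>n\<close> rows both
  polynomials are zero.\<close>

lemma schur_symmetric:
  assumes \<mu>: "is_partition \<mu>"
  shows "symmetric_series (schur \<mu>)"
  unfolding symmetric_series_def
proof (intro allI impI)
  fix n :: nat and a p :: "nat \<Rightarrow> nat" assume p: "p permutes {..<n}"
  let ?\<rho> = "part_row \<mu>"
  let ?y = "\<lambda>k. var (shift_perm p k)"
  have fin: "finite (cells ?\<rho>)" using finite_diagram[of \<mu>] by (simp add: diagram_eq_cells)
  have "tableau_sum n ?y ?\<rho> = tableau_sum n var ?\<rho>"
  proof (cases "length \<mu> \<le> n")
    case False
    then show ?thesis by (simp add: tableau_sum_too_long[OF \<mu>])
  next
    case True
    then have z: "i \<ge> n \<Longrightarrow> ?\<rho> i = 0" for i by (simp add: part_row_def)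
    let ?s = "of_int (sign p) :: (nat \<Rightarrow>\<^sub>0 nat) \<Rightarrow>\<^sub>0 int"
    let ?V = "alternant n (\<lambda>i. var (Suc i)) (\<lambda>j. n - Suc j)"
    have y: "(\<lambda>i. ?y (Suc i)) = (\<lambda>i. var (Suc (p i)))" by (simp add: shift_perm_def)
    have "?s * ?V * tableau_sum n ?y ?\<rho> = ?s * alternant n (\<lambda>i. var (Suc i)) (\<lambda>j. ?\<rho> j + (n - Suc j))"
      using bialternant[OF antimono_row[OF \<mu>] z, where n=n and x="?y"]
        alternant_permute[OF p, of "\<lambda>i. var (Suc i)"] unfolding y by simp
    also have "\<dots> = ?s * ?V * tableau_sum n var ?\<rho>"
      using bialternant[OF antimono_row[OF \<mu>] z, where n=n and x=var] by (simp add: mult.assoc)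
    finally show ?thesis using vandermonde_nonzero[of n] by (simp add: sign_def split: if_splits)
  qed
  moreover have "lookup (tableau_sum n ?y ?\<rho>) (expo n a)
      = int (card {T \<in> tableaux n ?\<rho>. content (cells ?\<rho>) (\<lambda>c. shift_perm p (T c)) = expo n a})"
  proof -
    have "lookup (tableau_sum n ?y ?\<rho>) (expo n a) = (\<Sum>T\<in>tableaux n ?\<rho>.
        if content (cells ?\<rho>) (\<lambda>c. shift_perm p (T c)) = expo n a then 1 else 0)"
      unfolding tableau_sum_def prod_var lookup_sum by (rule sum.cong) (auto simp: lookup_single when_def)
    then show ?thesis using finite_tableaux[OF fin] by (simp add: sum.If_cases Int_def)
  qed
  ultimately show "schur \<mu> (expo n (a \<circ> p)) = schur \<mu> (expo n a)"
    by (simp add: schur_expo lookup_tableau_sum[OF fin] content_shift_perm[OF p fin])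
qed

section \<open>Schur expansions\<close>

text \<open>The coefficient of \<open>x\<^bsup>l + \<delta>\<^esup>\<close> in the product of \<open>f(x\<^sub>1, \<dots>, x\<^sub>n)\<close> with the Vandermonde
  determinant, where \<open>\<delta> = (n - 1, \<dots>, 0)\<close>.\<close>

definition alternating_coeff :: "nat \<Rightarrow> (nat \<Rightarrow> nat) \<Rightarrow> power_series \<Rightarrow> int" where
  "alternating_coeff n l f = (\<Sum>w | w permutes {..<n}.
     sign w * (if \<forall>i<n. i \<le> l i + w i then f (expo n (\<lambda>i. l i + w i - i)) else 0))"

lemma alternating_coeff_sum:
  "alternating_coeff n l (\<lambda>\<alpha>. \<Sum>\<mu>\<in>A. c \<mu> * g \<mu> \<alpha>) = (\<Sum>\<mu>\<in>A. c \<mu> * alternating_coeff n l (g \<mu>))"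
proof -
  have distrib: "s * (if C then \<Sum>\<mu>\<in>A. c \<mu> * h \<mu> else 0) = (\<Sum>\<mu>\<in>A. c \<mu> * (s * (if C then h \<mu> else 0)))"
    for s C and h :: "'a \<Rightarrow> int"
    by (simp add: sum_distrib_left mult_ac)
  have "alternating_coeff n l (\<lambda>\<alpha>. \<Sum>\<mu>\<in>A. c \<mu> * g \<mu> \<alpha>) = (\<Sum>w | w permutes {..<n}. \<Sum>\<mu>\<in>A.
     c \<mu> * (sign w * (if \<forall>i<n. i \<le> l i + w i then g \<mu> (expo n (\<lambda>i. l i + w i - i)) else 0)))"
    unfolding alternating_coeff_def
  proof (intro sum.cong refl)
    fix w
    show "sign w * (if \<forall>i<n. i \<le> l i + w i then \<Sum>\<mu>\<in>A. c \<mu> * g \<mu> (expo n (\<lambda>i. l i + w i - i)) else 0)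
      = (\<Sum>\<mu>\<in>A. c \<mu> * (sign w * (if \<forall>i<n. i \<le> l i + w i then g \<mu> (expo n (\<lambda>i. l i + w i - i)) else 0)))"
      by (rule distrib)
  qed
  also have "\<dots> = (\<Sum>\<mu>\<in>A. c \<mu> * alternating_coeff n l (g \<mu>))"
    unfolding alternating_coeff_def sum_distrib_left by (rule sum.swap)
  finally show ?thesis .
qed

lemma alternating_coeff_diff:
  "alternating_coeff n l (\<lambda>\<alpha>. f \<alpha> - g \<alpha>) = alternating_coeff n l f - alternating_coeff n l g"
  unfolding alternating_coeff_def sum_subtractf[symmetric]
  by (intro sum.cong) (auto simp: algebra_simps)

lemma expo_add_eq_iff:
  "expo n a + \<beta> = expo n b \<longleftrightarrow> (\<forall>i<n. a i \<le> b i) \<and> \<beta> = expo n (\<lambda>i. b i - a i)"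
proof
  assume eq: "expo n a + \<beta> = expo n b"
  have *: "lookup (expo n a) k + lookup \<beta> k = lookup (expo n b) k" for k
    using arg_cong[OF eq, of "\<lambda>m. lookup m k"] by (simp add: lookup_add)
  have "a i \<le> b i" if "i < n" for i
    using *[of "Suc i"] that by (simp add: lookup_expo)
  moreover have "\<beta> = expo n (\<lambda>i. b i - a i)"
  proof (rule poly_mapping_eqI)
    fix k show "lookup \<beta> k = lookup (expo n (\<lambda>i. b i - a i)) k"
      using *[of k] by (auto simp: lookup_expo split: if_splits)
  qed
  ultimately show "(\<forall>i<n. a i \<le> b i) \<and> \<beta> = expo n (\<lambda>i. b i - a i)" by blast
next
  assume "(\<forall>i<n. a i \<le> b i) \<and> \<beta> = expo n (\<lambda>i. b i - a i)"
  then show "expo n a + \<beta> = expo n b" by (simp add: expo_add expo_eq_iff)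
qed

lemma permutes_strict_mono_id:
  assumes p: "p permutes {..<n::nat}" and mono: "\<And>i j. i < j \<Longrightarrow> j < n \<Longrightarrow> p i < p j"
  shows "p = id"
proof (rule permutes_natset_ge[OF p], rule ballI)
  fix i assume "i \<in> {..<n}"
  then have "i < n" by simp
  then show "i \<le> p i"
  proof (induction i)
    case (Suc i)
    then show ?case using mono[of i "Suc i"] by simp
  qed simp
qed

lemma part_row_inject:
  assumes "is_partition \<nu>" "length \<mu> \<le> length \<nu>" "\<forall>i<length \<nu>. part_row \<mu> i = part_row \<nu> i"
  shows "\<mu> = \<nu>"
proof -
  have "length \<mu> = length \<nu>"
  proof (rule ccontr)
    assume "length \<mu> \<noteq> length \<nu>"
    then have "length \<mu> < length \<nu>" using assms(2) by simp
    then have "\<nu> ! length \<mu> = 0" "\<nu> ! length \<mu> \<in> set \<nu>"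
      using assms(3) by (auto simp: part_row_def)
    then show False using assms(1) by (simp add: is_partition_def)
  qed
  then show ?thesis using assms(3) by (auto simp: part_row_def intro: nth_equalityI)
qed

text \<open>The left side is the coefficient at \<open>\<nu> + \<delta>\<close> of the Vandermonde
  determinant times the Schur polynomial, that is, of the alternant with exponents
  \<open>\<mu> + \<delta>\<close>. Both vectors decrease strictly, so no permutation other than the
  identity can match them. A shape longer than \<open>\<nu>\<close> contributes nothing in these
  variables.\<close>

theorem alternating_coeff_schur:
  assumes \<nu>: "is_partition \<nu>" and \<mu>: "is_partition \<mu>"
  shows "alternating_coeff (length \<nu>) (part_row \<nu>) (schur \<mu>) = (if \<mu> = \<nu> then 1 else 0)"
proof (cases "length \<mu> \<le> length \<nu>")
  case False
  then show ?thesis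
    by (auto simp: alternating_coeff_def schur_expo tableau_sum_too_long[OF \<mu>] intro!: sum.neutral)
next
  case True
  define n where "n = length \<nu>"
  define l where "l = part_row \<nu>"
  define \<gamma> where "\<gamma> = expo n (\<lambda>i. l i + (n - Suc i))"
  let ?\<rho> = "part_row \<mu>"
  let ?P = "{w. w permutes {..<n}}"
  have z: "i \<ge> n \<Longrightarrow> ?\<rho> i = 0" for i using True by (simp add: part_row_def n_def)
  have fin: "finite (cells ?\<rho>)" using finite_diagram[of \<mu>] by (simp add: diagram_eq_cells)
  have finP: "finite ?P" by (simp add: finite_permutations)
  \<comment> \<open>This coefficient is computed twice: term by term, which produces the alternating
    coefficient, and through \<open>bialternant\<close>.\<close>
  have "lookup (alternant n (\<lambda>i. var (Suc i)) (\<lambda>j. n - Suc j) * tableau_sum n var ?\<rho>) \<gamma>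
      = (\<Sum>w\<in>?P. \<Sum>T\<in>tableaux n ?\<rho>.
          sign w * (if expo n ((\<lambda>j. n - Suc j) \<circ> w) + content (cells ?\<rho>) T = \<gamma> then 1 else 0))"
    unfolding alternant_var tableau_sum_def prod_var sum_product mult_single lookup_sum
    by (intro sum.cong) (auto simp: lookup_single when_def)
  also have "\<dots> = (\<Sum>w\<in>?P. sign w *
      int (card {T \<in> tableaux n ?\<rho>. expo n ((\<lambda>j. n - Suc j) \<circ> w) + content (cells ?\<rho>) T = \<gamma>}))"
    using finite_tableaux[OF fin, of n] by (simp add: sum.If_cases Int_def flip: sum_distrib_left)
  also have "\<dots> = alternating_coeff n l (schur \<mu>)"
    unfolding alternating_coeff_def
  proof (intro sum.cong refl arg_cong2[where f="(*)"])
    fix w assume "w \<in> ?P"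
    then have w: "w i < n" if "i < n" for i using permutes_in_image[of w "{..<n}" i] that by simp
    \<comment> \<open>As \<open>\<delta>\<close> at \<open>i\<close> is \<open>n - Suc i\<close>,
      subtracting its value at \<open>w i\<close> from \<open>l i + (n - Suc i)\<close> leaves
      \<open>l i + w i - i\<close>. The condition says that this truncated subtraction is a genuine
      one.\<close>
    have 1: "(\<forall>i<n. n - Suc (w i) \<le> l i + (n - Suc i)) \<longleftrightarrow> (\<forall>i<n. i \<le> l i + w i)"
    proof (intro all_cong)
      fix i assume "i < n"
      then show "n - Suc (w i) \<le> l i + (n - Suc i) \<longleftrightarrow> i \<le> l i + w i" using w[of i] by auto
    qed
    have 2: "expo n (\<lambda>i. l i + (n - Suc i) - (n - Suc (w i))) = expo n (\<lambda>i. l i + w i - i)"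
      if "\<forall>i<n. i \<le> l i + w i"
    proof (rule expo_cong)
      fix i assume "i < n"
      then show "l i + (n - Suc i) - (n - Suc (w i)) = l i + w i - i"
        using w[of i] that by auto
    qed
    let ?C = "\<forall>i<n. i \<le> l i + w i"
    let ?e = "expo n (\<lambda>i. l i + w i - i)"
    have 3: "expo n ((\<lambda>j. n - Suc j) \<circ> w) + \<beta> = \<gamma> \<longleftrightarrow> ?C \<and> \<beta> = ?e" for \<beta>
      unfolding \<gamma>_def expo_add_eq_iff o_def 1
      by (rule conj_cong[OF refl]) (drule 2, simp only:)
    have 4: "int (card {T \<in> A. C \<and> P T}) = (if C then int (card {T \<in> A. P T}) else 0)"
      for A :: "(nat \<times> nat \<Rightarrow> nat) set" and C P
      by simp
    show "int (card {T \<in> tableaux n ?\<rho>. expo n ((\<lambda>j. n - Suc j) \<circ> w) + content (cells ?\<rho>) T = \<gamma>})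
      = (if ?C then schur \<mu> ?e else 0)"
      unfolding 3 schur_expo lookup_tableau_sum[OF fin] by (rule 4)
  qed
  also have "lookup (alternant n (\<lambda>i. var (Suc i)) (\<lambda>j. n - Suc j) * tableau_sum n var ?\<rho>) \<gamma>
     = lookup (alternant n (\<lambda>i. var (Suc i)) (\<lambda>j. ?\<rho> j + (n - Suc j))) \<gamma>"
    using bialternant[OF antimono_row[OF \<mu>] z, where n=n and x=var] by simp
  also have "\<dots> = (\<Sum>w\<in>?P. if expo n ((\<lambda>j. ?\<rho> j + (n - Suc j)) \<circ> w) = \<gamma> then sign w else 0)"
    unfolding alternant_var lookup_sum by (intro sum.cong) (auto simp: lookup_single when_def)
  also have "\<dots> = (\<Sum>w\<in>?P. if w = id then (if \<mu> = \<nu> then 1 else 0) else 0)"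
  proof (intro sum.cong refl)
    fix w assume "w \<in> ?P"
    then have p: "w permutes {..<n}" by simp
    have w: "w i < n" if "i < n" for i using permutes_in_image[OF p, of i] that by simp
    have "w = id \<and> \<mu> = \<nu>" if "expo n ((\<lambda>j. ?\<rho> j + (n - Suc j)) \<circ> w) = \<gamma>"
    proof -
      have eq: "?\<rho> (w i) + (n - Suc (w i)) = l i + (n - Suc i)" if "i < n" for i
        using \<open>expo n _ = \<gamma>\<close> that by (simp add: \<gamma>_def expo_eq_iff)
      \<comment> \<open>Equal values of two strictly decreasing sequences force \<open>w\<close> to
        preserve the order.\<close>
      have "w i < w j" if "i < j" "j < n" for i j
      proof (rule ccontr)
        assume "\<not> w i < w j"
        moreover have "w i \<noteq> w j" using permutes_inj[OF p] that by (auto dest: injD)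
        ultimately have "w j < w i" by simp
        then have "?\<rho> (w i) + (n - Suc (w i)) < ?\<rho> (w j) + (n - Suc (w j))"
          using antimonoD[OF antimono_row[OF \<mu>], of "w j" "w i"] w[of i] w[of j] that by simp
        moreover have "l j + (n - Suc j) < l i + (n - Suc i)"
          using antimonoD[OF antimono_row[OF \<nu>], of i j] that by (simp add: l_def)
        ultimately show False using eq[of i] eq[of j] that by simp
      qed
      then have "w = id" by (rule permutes_strict_mono_id[OF p])
      moreover from this have "\<mu> = \<nu>"
      proof -
        have "?\<rho> i = l i" if "i < n" for i
          using eq[OF that] \<open>w = id\<close> by (simp only: id_apply add_right_cancel)
        then show ?thesis using part_row_inject[OF \<nu> True] by (simp add: l_def n_def)
      qed
      ultimately show ?thesis by simp
    qed
    moreover have "expo n ((\<lambda>j. ?\<rho> j + (n - Suc j)) \<circ> w) = \<gamma>" if "w = id" "\<mu> = \<nu>"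
      using that by (simp add: \<gamma>_def l_def)
    ultimately show "(if expo n ((\<lambda>j. ?\<rho> j + (n - Suc j)) \<circ> w) = \<gamma> then sign w else 0)
        = (if w = id then (if \<mu> = \<nu> then 1 else 0) else 0)"
      by (auto simp: sign_id)
  qed
  also have "\<dots> = (if \<mu> = \<nu> then 1 else 0)"
    using finP permutes_id[of "{..<n}"] by simp
  finally show ?thesis by (simp add: n_def l_def)
qed

text \<open>Linearity and \<open>alternating_coeff_schur\<close> single out one term of the
  expansion. The right side mentions only \<open>f\<close>, so uniqueness of the expansion is
  immediate.\<close>

lemma schur_expansion_coeff:
  assumes "is_schur_expansion f c" "is_partition \<nu>"
  shows "c \<nu> = alternating_coeff (length \<nu>) (part_row \<nu>) f"
proof -
  have fin: "finite {\<mu>. c \<mu> \<noteq> 0}" and part: "\<And>\<mu>. c \<mu> \<noteq> 0 \<Longrightarrow> is_partition \<mu>"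
    and f: "f = (\<lambda>\<alpha>. \<Sum>\<mu> | c \<mu> \<noteq> 0. c \<mu> * schur \<mu> \<alpha>)"
    using assms(1) by (auto simp: is_schur_expansion_def)
  have "alternating_coeff (length \<nu>) (part_row \<nu>) f
      = (\<Sum>\<mu> | c \<mu> \<noteq> 0. c \<mu> * (if \<mu> = \<nu> then 1 else 0))"
    unfolding f alternating_coeff_sum using part
    by (intro sum.cong) (auto simp: alternating_coeff_schur[OF assms(2)])
  also have "\<dots> = (\<Sum>\<mu> | c \<mu> \<noteq> 0. if \<mu> = \<nu> then c \<mu> else 0)"
    by (intro sum.cong) auto
  also have "\<dots> = c \<nu>" using fin by simp
  finally show ?thesis by simp
qed

lemma schur_expansion_unique:
  assumes "is_schur_expansion f c" "is_schur_expansion f d"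
  shows "c = d"
proof
  fix \<nu>
  have "c \<nu> = 0" "d \<nu> = 0" if "\<not> is_partition \<nu>"
    using assms that unfolding is_schur_expansion_def by blast+
  then show "c \<nu> = d \<nu>"
    using schur_expansion_coeff[OF assms(1), of \<nu>] schur_expansion_coeff[OF assms(2), of \<nu>]
    by (cases "is_partition \<nu>") simp_all
qed

lemma schur_coeff_eq:
  assumes "is_schur_expansion f c" "is_partition \<nu>"
  shows "schur_coeff \<nu> f = alternating_coeff (length \<nu>) (part_row \<nu>) f"
proof -
  have "(THE c. is_schur_expansion f c) = c"
    by (rule the_equality[where P="is_schur_expansion f", OF assms(1)]) (rule schur_expansion_unique[OF _ assms(1)])
  then show ?thesis using schur_expansion_coeff[OF assms] by (simp add: schur_coeff_def)
qed

section \<open>Existence of Schur expansions\<close>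

lemma decreasing_split_zeros:
  "sorted_wrt (\<ge>) (ys :: nat list) \<Longrightarrow> ys = filter (\<lambda>v. v \<noteq> 0) ys @ replicate (length (filter (\<lambda>v. v = 0) ys)) 0"
proof (induction ys)
  case (Cons y ys)
  show ?case
  proof (cases "y = 0")
    case True
    then have "\<forall>v\<in>set ys. v = 0" using Cons.prems by auto
    then have "filter (\<lambda>v. v \<noteq> 0) ys = []" "filter (\<lambda>v. v = 0) ys = ys" by auto
    then show ?thesis using Cons True by auto
  next
    case False
    then show ?thesis using Cons by auto
  qed
qed simp

text \<open>The nonzero exponents of \<open>\<alpha>\<close> in decreasing order form
  \<open>\<nu>\<close>; the zeros come last after sorting and drop out of \<open>expo\<close>. The
  clause about \<open>h\<close> says that the multiset of nonzero exponents is kept. It is used with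
  the identity, giving the degree, and with powers of a fixed base.\<close>

lemma sort_exponent:
  assumes "0 \<notin> keys \<alpha>"
  obtains \<nu> where "is_partition \<nu>" "\<And>g. symmetric_series g \<Longrightarrow> g (expo (length \<nu>) (part_row \<nu>)) = g \<alpha>"
    "\<And>h :: nat \<Rightarrow> nat. (\<Sum>k\<in>keys \<alpha>. h (lookup \<alpha> k)) = sum_list (map h \<nu>)"
proof -
  obtain n where "keys \<alpha> \<subseteq> {..n}" using finite_nat_set_iff_bounded_le[of "keys \<alpha>"] by auto
  then have "keys \<alpha> \<subseteq> {1..n}" using assms by (auto simp: Suc_le_eq intro: gr0I)
  then have \<alpha>: "\<alpha> = expo n (\<lambda>i. lookup \<alpha> (Suc i))" by (rule expo_of_keys)
  define xs where "xs = map (\<lambda>i. lookup \<alpha> (Suc i)) [0..<n]"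
  define ys where "ys = rev (sort xs)"
  define \<nu> where "\<nu> = filter (\<lambda>v. v \<noteq> 0) ys"
  have len: "length xs = n" "length ys = n" by (simp_all add: xs_def ys_def)
  have \<alpha>xs: "\<alpha> = expo n (\<lambda>i. xs ! i)"
    by (subst \<alpha>) (rule expo_cong, simp add: xs_def)
  have sorted: "sorted_wrt (\<ge>) ys" by (simp add: ys_def sorted_wrt_rev)
  have split: "ys = \<nu> @ replicate (length (filter (\<lambda>v. v = 0) ys)) 0"
    unfolding \<nu>_def by (rule decreasing_split_zeros[OF sorted])
  have row: "part_row \<nu> i = ys ! i" if "i < n" for i
  proof (cases "i < length \<nu>")
    case True
    then show ?thesis by (subst split) (simp add: part_row_def nth_append)
  next
    case False
    moreover have "length ys = length \<nu> + length (filter (\<lambda>v. v = 0) ys)"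
      by (subst split) simp
    ultimately show ?thesis using that len by (subst split) (simp add: part_row_def nth_append)
  qed
  have "length \<nu> \<le> n" using length_filter_le[of "\<lambda>v. v \<noteq> 0" ys] len unfolding \<nu>_def by linarith
  then have \<nu>ys: "expo (length \<nu>) (part_row \<nu>) = expo n (\<lambda>i. ys ! i)"
    by (intro poly_mapping_eqI) (auto simp: lookup_expo row[symmetric], auto simp: part_row_def)
  have "mset ys = mset xs" by (simp add: ys_def)
  then obtain p where p: "p permutes {..<n}" "permute_list p xs = ys"
    using mset_eq_permutation len by metis
  show ?thesis
  proof (rule that)
    show "is_partition \<nu>"
      using sorted by (simp add: is_partition_def \<nu>_def sorted_wrt_filter)
  next
    fix g assume g: "symmetric_series g"
    have "g (expo (length \<nu>) (part_row \<nu>)) = g (expo n ((\<lambda>i. xs ! i) \<circ> p))"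
      unfolding \<nu>ys using p len
      by (intro arg_cong[where f=g] expo_cong) (auto simp: permute_list_nth)
    also have "\<dots> = g \<alpha>" using g p(1) unfolding symmetric_series_def \<alpha>xs[symmetric]
      by (metis \<alpha>xs)
    finally show "g (expo (length \<nu>) (part_row \<nu>)) = g \<alpha>" .
  next
    fix h :: "nat \<Rightarrow> nat"
    have "(\<Sum>k\<in>keys \<alpha>. h (lookup \<alpha> k)) = (\<Sum>i | i < n \<and> xs ! i \<noteq> 0. h (xs ! i))"
      unfolding \<alpha>xs by (rule sum_keys_expo)
    also have "\<dots> = (\<Sum>i<n. if xs ! i \<noteq> 0 then h (xs ! i) else 0)"
      by (subst sum.inter_filter[symmetric]) auto
    also have "\<dots> = sum_list (map (\<lambda>v. if v \<noteq> 0 then h v else 0) xs)"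
      by (simp add: sum_list_sum_nth len atLeast0LessThan)
    also have "\<dots> = sum_list (map (\<lambda>v. if v \<noteq> 0 then h v else 0) ys)"
    proof -
      have "sum_list (map k zs) = (\<Sum>v\<in>#mset zs. k v)" for k :: "nat \<Rightarrow> nat" and zs
        by (metis mset_map sum_mset_sum_list)
      then show ?thesis using \<open>mset ys = mset xs\<close> by simp
    qed
    also have "\<dots> = sum_list (map h \<nu>)"
      by (simp add: \<nu>_def sum_list_map_filter')
    finally show "(\<Sum>k\<in>keys \<alpha>. h (lookup \<alpha> k)) = sum_list (map h \<nu>)" .
  qed
qed

text \<open>Fixing the degree leaves finitely many partitions, which gives both a finite expansion
  and a maximal partition in the support.\<close>

definition homogeneous_series :: "nat \<Rightarrow> power_series \<Rightarrow> bool" where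
  "homogeneous_series d f \<longleftrightarrow> (\<forall>\<alpha>. f \<alpha> \<noteq> 0 \<longrightarrow> 0 \<notin> keys \<alpha> \<and> (\<Sum>k\<in>keys \<alpha>. lookup \<alpha> k) = d)"

lemma length_le_sum_list: "0 \<notin> set xs \<Longrightarrow> length xs \<le> sum_list (xs :: nat list)"
  by (induction xs) auto

lemma finite_partitions: "finite {\<nu>. is_partition \<nu> \<and> sum_list \<nu> = d}"
proof (rule finite_subset)
  show "{\<nu>. is_partition \<nu> \<and> sum_list \<nu> = d} \<subseteq> {\<nu>. set \<nu> \<subseteq> {..d} \<and> length \<nu> \<le> d}"
    using length_le_sum_list member_le_sum_list by (fastforce simp: is_partition_def)
  show "finite {\<nu>. set \<nu> \<subseteq> {..d} \<and> length \<nu> \<le> d}"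
    by (rule finite_lists_length_le) simp
qed

text \<open>Let \<open>m\<close> be the first position moved by \<open>w\<close>. Smaller positions
  are fixed, so \<open>m < w m\<close> and the exponent at \<open>m\<close> grows by at least one.
  As \<open>l\<close> decreases, the old terms from \<open>m\<close> on add up to at most
  \<open>n * B ^ l m\<close>, less than \<open>B ^ Suc (l m)\<close>. The new terms beyond
  \<open>m\<close> are discarded; positivity of \<open>l\<close> keeps those up to \<open>m\<close>
  among the nonzero exponents.\<close>

lemma power_sum_increases:
  fixes l a :: "nat \<Rightarrow> nat"
  assumes w: "w permutes {..<n}" "w \<noteq> id" and anti: "antimono l" and pos: "\<And>i. i < n \<Longrightarrow> 0 < l i"
    and le: "\<forall>i<n. i \<le> l i + w i" and B: "n < B"
  shows "(\<Sum>i<n. B ^ l i) < (\<Sum>i | i < n \<and> l i + w i - i \<noteq> 0. B ^ (l i + w i - i))"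
proof -
  define m where "m = (LEAST i. w i \<noteq> i)"
  have wm: "w m \<noteq> m" unfolding m_def
    by (rule LeastI_ex) (use w(2) in \<open>auto simp: fun_eq_iff\<close>)
  have fixed: "w i = i" if "i < m" for i using that not_less_Least[of i "\<lambda>i. w i \<noteq> i"] by (auto simp: m_def)
  have "m < n" using wm w(1) by (metis lessThan_iff permutes_not_in)
  have "m < w m"
  proof (rule ccontr)
    assume "\<not> m < w m"
    then have "w m < m" using wm by simp
    then have "w (w m) = w m" by (rule fixed)
    then show False using permutes_inj[OF w(1)] wm by (auto dest: injD)
  qed
  have "(\<Sum>i<n. B ^ l i) = (\<Sum>i<m. B ^ l i) + (\<Sum>i=m..<n. B ^ l i)"
    using \<open>m < n\<close> by (metis atLeast0LessThan less_imp_le_nat sum.atLeastLessThan_concat zero_le)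
  also have "(\<Sum>i=m..<n. B ^ l i) \<le> (\<Sum>i=m..<n. B ^ l m)"
    using B antimonoD[OF anti] by (intro sum_mono power_increasing) auto
  also have "(\<Sum>i=m..<n. B ^ l m) = (n - m) * B ^ l m" by simp
  also have "\<dots> < B * B ^ l m" using B by (intro mult_strict_right_mono) auto
  also have "\<dots> = B ^ Suc (l m)" by simp
  also have "\<dots> \<le> B ^ (l m + w m - m)"
    using \<open>m < w m\<close> B by (intro power_increasing) auto
  also have "(\<Sum>i<m. B ^ l i) = (\<Sum>i<m. B ^ (l i + w i - i))"
    by (rule sum.cong) (auto simp: fixed)
  also have "(\<Sum>i<m. B ^ (l i + w i - i)) + B ^ (l m + w m - m) = (\<Sum>i\<le>m. B ^ (l i + w i - i))"
    by (simp flip: lessThan_Suc_atMost)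
  also have "\<dots> \<le> (\<Sum>i | i < n \<and> l i + w i - i \<noteq> 0. B ^ (l i + w i - i))"
  proof (rule sum_mono2)
    show "{..m} \<subseteq> {i. i < n \<and> l i + w i - i \<noteq> 0}"
    proof
      fix i assume "i \<in> {..m}"
      then have "i < n" "i \<le> w i" using \<open>m < n\<close> \<open>m < w m\<close> fixed[of i] by (auto simp: le_less)
      then show "i \<in> {i. i < n \<and> l i + w i - i \<noteq> 0}" using pos[of i] by simp
    qed
  qed auto
  finally show ?thesis by simp
qed

text \<open>A permutation \<open>w \<noteq> id\<close> replaces \<open>\<nu>\<close> by a vector that is lexicographically larger, hence with a larger
  value of \<open>\<Sum>i. B ^ \<nu>\<^sub>i\<close> when \<open>B\<close> is big; so a maximal \<open>\<nu>\<close> in the support of \<open>g\<close> contributes only one term.\<close>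

lemma symmetric_series_zero:
  assumes sym: "symmetric_series g" and hom: "homogeneous_series d g"
    and alt: "\<And>\<nu>. is_partition \<nu> \<Longrightarrow> alternating_coeff (length \<nu>) (part_row \<nu>) g = 0"
  shows "g \<alpha> = 0"
proof (rule ccontr)
  assume nz: "g \<alpha> \<noteq> 0"
  define P where "P = {\<nu>. is_partition \<nu> \<and> sum_list \<nu> = d \<and> g (expo (length \<nu>) (part_row \<nu>)) \<noteq> 0}"
  \<comment> \<open>The base must exceed the number of parts, which is at most the degree
    \<open>d\<close>.\<close>
  define \<phi> :: "nat list \<Rightarrow> nat" where "\<phi> \<nu> = sum_list (map (\<lambda>v. (d + 2) ^ v) \<nu>)" for \<nu>
  have fin: "finite P" by (rule finite_subset[OF _ finite_partitions[of d]]) (auto simp: P_def)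
  have member: "\<exists>\<nu>\<in>P. \<phi> \<nu> = (\<Sum>k\<in>keys \<beta>. (d + 2) ^ lookup \<beta> k)" if "g \<beta> \<noteq> 0" for \<beta>
  proof -
    have \<beta>: "0 \<notin> keys \<beta>" "(\<Sum>k\<in>keys \<beta>. lookup \<beta> k) = d"
      using hom that by (auto simp: homogeneous_series_def)
    obtain \<nu> where \<nu>: "is_partition \<nu>" "g (expo (length \<nu>) (part_row \<nu>)) = g \<beta>"
      "\<And>h :: nat \<Rightarrow> nat. (\<Sum>k\<in>keys \<beta>. h (lookup \<beta> k)) = sum_list (map h \<nu>)"
      using sort_exponent[OF \<beta>(1)] sym by metis
    have "sum_list \<nu> = d" using \<nu>(3)[of "\<lambda>v. v"] \<beta>(2) by simp
    then have "\<nu> \<in> P" using \<nu> that by (simp add: P_def)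
    then show ?thesis using \<nu>(3) by (auto simp: \<phi>_def)
  qed
  then have "P \<noteq> {}" using nz by blast
  then have "Max (\<phi> ` P) \<in> \<phi> ` P" using fin by (intro Max_in) auto
  then obtain \<nu> where \<nu>: "\<nu> \<in> P" and "\<phi> \<nu> = Max (\<phi> ` P)" by auto
  then have max: "\<phi> \<nu>' \<le> \<phi> \<nu>" if "\<nu>' \<in> P" for \<nu>' using fin that by simp
  have part: "is_partition \<nu>" and d: "sum_list \<nu> = d" and g\<nu>: "g (expo (length \<nu>) (part_row \<nu>)) \<noteq> 0"
    using \<nu> by (auto simp: P_def)
  let ?n = "length \<nu>" and ?l = "part_row \<nu>"
  let ?t = "\<lambda>w. sign w * (if \<forall>i<?n. i \<le> ?l i + w i then g (expo ?n (\<lambda>i. ?l i + w i - i)) else 0)"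
  have "?t w = (if w = id then g (expo ?n ?l) else 0)" if w: "w permutes {..<?n}" for w
  proof (cases "w = id")
    case True
    then show ?thesis by (simp add: sign_id)
  next
    case False
    have "g (expo ?n (\<lambda>i. ?l i + w i - i)) = 0" if le: "\<forall>i<?n. i \<le> ?l i + w i"
    proof (rule ccontr)
      assume "g (expo ?n (\<lambda>i. ?l i + w i - i)) \<noteq> 0"
      from member[OF this] obtain \<nu>' where "\<nu>' \<in> P" "\<phi> \<nu>' = (\<Sum>i | i < ?n \<and> ?l i + w i - i \<noteq> 0. (d + 2) ^ (?l i + w i - i))"
        unfolding sum_keys_expo[of "\<lambda>v. (d + 2) ^ v" ?n "\<lambda>i. ?l i + w i - i"] by blast
      moreover have "(\<Sum>i<?n. (d + 2) ^ ?l i) < (\<Sum>i | i < ?n \<and> ?l i + w i - i \<noteq> 0. (d + 2) ^ (?l i + w i - i))"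
      proof (rule power_sum_increases[OF w False antimono_row[OF part] _ le])
        fix i assume "i < ?n"
        then have "\<nu> ! i \<in> set \<nu>" by simp
        then have "\<nu> ! i \<noteq> 0" using part by (metis is_partition_def)
        then show "0 < ?l i" using \<open>i < ?n\<close> by (simp add: part_row_def)
      next
        show "?n < d + 2" using length_le_sum_list[of \<nu>] part d by (simp add: is_partition_def)
      qed
      moreover have "(\<Sum>i<?n. (d + 2) ^ ?l i) = \<phi> \<nu>"
        by (simp add: \<phi>_def sum_list_sum_nth atLeast0LessThan part_row_def)
      ultimately show False using max[of \<nu>'] by simp
    qed
    then show ?thesis using False by simp
  qed
  then have "alternating_coeff ?n ?l g = (\<Sum>w | w permutes {..<?n}. if w = id then g (expo ?n ?l) else 0)"
    unfolding alternating_coeff_def by (intro sum.cong) auto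
  also have "\<dots> = g (expo ?n ?l)"
    using finite_permutations[of "{..<?n}"] permutes_id[of "{..<?n}"] by simp
  finally show False using alt[OF part] g\<nu> by simp
qed

text \<open>Since \<open>w\<close> is a permutation, the shifts \<open>w i - i\<close> add up to
  zero, so every exponent vector in the sum has the total of \<open>l\<close>.\<close>

lemma alternating_coeff_homogeneous:
  assumes "homogeneous_series d g" "(\<Sum>i<n. l i) \<noteq> d"
  shows "alternating_coeff n l g = 0"
  unfolding alternating_coeff_def
proof (intro sum.neutral ballI)
  fix w assume "w \<in> {w. w permutes {..<n}}"
  then have w: "w permutes {..<n}" by simp
  have "g (expo n (\<lambda>i. l i + w i - i)) = 0" if le: "\<forall>i<n. i \<le> l i + w i"
  proof (rule ccontr)
    assume "g (expo n (\<lambda>i. l i + w i - i)) \<noteq> 0"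
    then have "d = (\<Sum>i | i < n \<and> l i + w i - i \<noteq> 0. l i + w i - i)"
      using assms(1) sum_keys_expo[of "\<lambda>v. v" n "\<lambda>i. l i + w i - i"]
      unfolding homogeneous_series_def by metis
    also have "\<dots> = (\<Sum>i<n. l i + w i - i)"
      by (rule sum.mono_neutral_left) auto
    finally have "d + (\<Sum>i<n. i) = (\<Sum>i<n. l i + w i - i + i)" by (simp add: sum.distrib)
    also have "\<dots> = (\<Sum>i<n. l i + w i)" using le by (intro sum.cong) auto
    also have "\<dots> = (\<Sum>i<n. l i) + (\<Sum>i<n. i)"
      using sum.permute[OF w, of "\<lambda>i. i"] by (simp add: sum.distrib)
    finally show False using assms(2) by simp
  qed
  then show "sign w * (if \<forall>i<n. i \<le> l i + w i then g (expo n (\<lambda>i. l i + w i - i)) else 0) = 0"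
    by simp
qed

text \<open>The coefficients are forced by \<open>schur_expansion_coeff\<close> and are therefore
  taken as the definition of \<open>c\<close>. The remainder \<open>g\<close> is symmetric and
  homogeneous with all alternating coefficients zero, so it vanishes.\<close>

theorem schur_expansion_exists:
  assumes sym: "symmetric_series f" and hom: "homogeneous_series d f"
  obtains c where "is_schur_expansion f c"
proof -
  define c where "c \<mu> = (if is_partition \<mu> \<and> sum_list \<mu> = d
    then alternating_coeff (length \<mu>) (part_row \<mu>) f else 0)" for \<mu>
  have supp: "is_partition \<mu>" "sum_list \<mu> = d" if "c \<mu> \<noteq> 0" for \<mu>
    using that by (auto simp: c_def split: if_splits)
  have fin: "finite {\<mu>. c \<mu> \<noteq> 0}"
    by (rule finite_subset[OF _ finite_partitions[of d]]) (auto simp: supp)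
  define g where "g \<alpha> = f \<alpha> - (\<Sum>\<mu> | c \<mu> \<noteq> 0. c \<mu> * schur \<mu> \<alpha>)" for \<alpha>
  have symg: "symmetric_series g"
    unfolding symmetric_series_def
  proof (intro allI impI)
    fix n :: nat and a p :: "nat \<Rightarrow> nat" assume p: "p permutes {..<n}"
    have "schur \<mu> (expo n (a \<circ> p)) = schur \<mu> (expo n a)" if "c \<mu> \<noteq> 0" for \<mu>
      using schur_symmetric[OF supp(1)[OF that]] p unfolding symmetric_series_def by blast
    moreover have "f (expo n (a \<circ> p)) = f (expo n a)"
      using sym p unfolding symmetric_series_def by blast
    ultimately show "g (expo n (a \<circ> p)) = g (expo n a)"
      by (simp add: g_def)
  qed
  have homg: "homogeneous_series d g"
    unfolding homogeneous_series_def
  proof (intro allI impI)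
    fix \<alpha> assume "g \<alpha> \<noteq> 0"
    then have "f \<alpha> \<noteq> 0 \<or> (\<exists>\<mu>. c \<mu> \<noteq> 0 \<and> schur \<mu> \<alpha> \<noteq> 0)"
      unfolding g_def by (metis (mono_tags, lifting) diff_zero mem_Collect_eq mult_zero_right sum.neutral)
    then show "0 \<notin> keys \<alpha> \<and> (\<Sum>k\<in>keys \<alpha>. lookup \<alpha> k) = d"
      using hom schur_nonzero supp(2) unfolding homogeneous_series_def by metis
  qed
  have "alternating_coeff (length \<nu>) (part_row \<nu>) g = 0" if \<nu>: "is_partition \<nu>" for \<nu>
  proof (cases "sum_list \<nu> = d")
    case False
    then show ?thesis
      by (intro alternating_coeff_homogeneous[OF homg])
        (simp add: sum_list_sum_nth atLeast0LessThan part_row_def)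
  next
    case True
    have "alternating_coeff (length \<nu>) (part_row \<nu>) g = alternating_coeff (length \<nu>) (part_row \<nu>) f
        - (\<Sum>\<mu> | c \<mu> \<noteq> 0. c \<mu> * alternating_coeff (length \<nu>) (part_row \<nu>) (schur \<mu>))"
      unfolding g_def alternating_coeff_diff alternating_coeff_sum ..
    also have "(\<Sum>\<mu> | c \<mu> \<noteq> 0. c \<mu> * alternating_coeff (length \<nu>) (part_row \<nu>) (schur \<mu>))
        = (\<Sum>\<mu> | c \<mu> \<noteq> 0. if \<mu> = \<nu> then c \<mu> else 0)"
      by (intro sum.cong) (auto simp: alternating_coeff_schur[OF \<nu> supp(1)])
    also have "\<dots> = c \<nu>" using fin by simp
    also have "c \<nu> = alternating_coeff (length \<nu>) (part_row \<nu>) f"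
      using \<nu> True by (simp add: c_def)
    finally show ?thesis by simp
  qed
  then have "g \<alpha> = 0" for \<alpha> by (rule symmetric_series_zero[OF symg homg])
  then have "is_schur_expansion f c"
    using fin supp(1) by (auto simp: is_schur_expansion_def g_def fun_eq_iff)
  then show ?thesis by (rule that)
qed

section \<open>Attaching a clique\<close>

lemma chromatic_homogeneous:
  assumes "finite (verts G)"
  shows "homogeneous_series (card (verts G)) (chromatic_sym G)"
  unfolding homogeneous_series_def
proof (intro allI impI)
  fix \<alpha> assume "chromatic_sym G \<alpha> \<noteq> 0"
  then have "{\<kappa> \<in> proper_colorings G. content (verts G) \<kappa> = \<alpha>} \<noteq> {}"
    unfolding chromatic_sym_def by (metis card.empty of_nat_0)
  then obtain \<kappa> where \<kappa>: "\<kappa> \<in> proper_colorings G" "content (verts G) \<kappa> = \<alpha>" by blast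
  have "keys \<alpha> = \<kappa> ` verts G" using keys_content[OF assms, of \<kappa>] \<kappa>(2) by simp
  then have "0 \<notin> keys \<alpha>" using \<kappa>(1) by (auto simp: proper_colorings_def PiE_def Pi_def)
  then show "0 \<notin> keys \<alpha> \<and> (\<Sum>k\<in>keys \<alpha>. lookup \<alpha> k) = card (verts G)"
    using sum_lookup_content[OF assms, of \<kappa>] \<kappa>(2) by simp
qed

lemma content_cong: "(\<And>a. a \<in> A \<Longrightarrow> f a = g a) \<Longrightarrow> content A f = content A g"
  by (simp add: Defs.content_def)

lemma chromatic_symmetric:
  assumes fin: "finite (verts G)"
  shows "symmetric_series (chromatic_sym G)"
  unfolding symmetric_series_def
proof (intro allI impI)
  fix n :: nat and a p :: "nat \<Rightarrow> nat" assume p: "p permutes {..<n}"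
  let ?V = "verts G"
  define q where "q = inv_into UNIV p"
  have q: "q permutes {..<n}" unfolding q_def by (rule permutes_inv[OF p])
  have qp: "shift_perm q (shift_perm p k) = k" "shift_perm p (shift_perm q k) = k" for k
    using permutes_inverses[OF p] by (cases k; simp add: shift_perm_def q_def)+
  have proper: "restrict (\<lambda>v. shift_perm r (\<kappa> v)) ?V \<in> proper_colorings G"
    if "\<kappa> \<in> proper_colorings G" and r: "inj (shift_perm r)" for \<kappa> r
    using that(1) inj_eq[OF r]
    by (auto simp: proper_colorings_def PiE_def Pi_def shift_perm_def Suc_le_eq)
  have inj: "inj (shift_perm p)" "inj (shift_perm q)"
    using bij_shift_perm permutes_bij p q bij_is_inj by blast+
  have cont: "content ?V (restrict f ?V) = content ?V f" for f :: "'a \<Rightarrow> nat"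
    by (rule content_cong) simp
  have "bij_betw (\<lambda>\<kappa>. restrict (\<lambda>v. shift_perm p (\<kappa> v)) ?V)
     {\<kappa> \<in> proper_colorings G. content ?V \<kappa> = expo n (a \<circ> p)} {\<kappa> \<in> proper_colorings G. content ?V \<kappa> = expo n a}"
  proof (rule bij_betw_byWitness[where f'="\<lambda>\<kappa>. restrict (\<lambda>v. shift_perm q (\<kappa> v)) ?V"])
    have ext: "\<kappa> v = undefined" if "\<kappa> \<in> proper_colorings G" "v \<notin> ?V" for \<kappa> v
      using that by (auto simp: proper_colorings_def)
    show "\<forall>\<kappa>\<in>{\<kappa> \<in> proper_colorings G. content ?V \<kappa> = expo n (a \<circ> p)}.
        restrict (\<lambda>v. shift_perm q (restrict (\<lambda>v. shift_perm p (\<kappa> v)) ?V v)) ?V = \<kappa>"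
      by (auto simp: qp ext fun_eq_iff)
    show "\<forall>\<kappa>\<in>{\<kappa> \<in> proper_colorings G. content ?V \<kappa> = expo n a}.
        restrict (\<lambda>v. shift_perm p (restrict (\<lambda>v. shift_perm q (\<kappa> v)) ?V v)) ?V = \<kappa>"
      by (auto simp: qp ext fun_eq_iff)
    show "(\<lambda>\<kappa>. restrict (\<lambda>v. shift_perm p (\<kappa> v)) ?V) ` {\<kappa> \<in> proper_colorings G. content ?V \<kappa> = expo n (a \<circ> p)}
        \<subseteq> {\<kappa> \<in> proper_colorings G. content ?V \<kappa> = expo n a}"
      using proper inj(1) content_shift_perm[OF p fin] by (auto simp: cont)
    have "a \<circ> p \<circ> q = a" using permutes_inverses(1)[OF p] by (auto simp: q_def)
    then show "(\<lambda>\<kappa>. restrict (\<lambda>v. shift_perm q (\<kappa> v)) ?V) ` {\<kappa> \<in> proper_colorings G. content ?V \<kappa> = expo n a}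
        \<subseteq> {\<kappa> \<in> proper_colorings G. content ?V \<kappa> = expo n (a \<circ> p)}"
      using proper inj(2) content_shift_perm[OF q fin, of _ "a \<circ> p"] by (auto simp: cont)
  qed
  then show "chromatic_sym G (expo n (a \<circ> p)) = chromatic_sym G (expo n a)"
    unfolding chromatic_sym_def by (simp add: bij_betw_same_card)
qed

text \<open>Existence of an expansion is what gives the definite description in
  \<open>schur_coeff\<close> a meaning here.\<close>

lemma schur_coeff_chromatic:
  assumes "finite (verts G)" "is_partition \<nu>"
  shows "schur_coeff \<nu> (chromatic_sym G) = alternating_coeff (length \<nu>) (part_row \<nu>) (chromatic_sym G)"
proof -
  obtain c where "is_schur_expansion (chromatic_sym G) c"
    using schur_expansion_exists[OF chromatic_symmetric chromatic_homogeneous] assms(1) by blast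
  then show ?thesis using assms(2) by (rule schur_coeff_eq)
qed

text \<open>The construction behind \<open>F\<close> for an arbitrary graph: the effect of the
  clique on colourings is the same for every \<open>G\<close> and every attaching vertex.\<close>

definition attach_clique :: "'a ugraph \<Rightarrow> 'a \<Rightarrow> nat \<Rightarrow> ('a + nat) ugraph" where
  "attach_clique G v t = add_edge (disjoint_union G (complete_graph {1..t})) (Inl v) (Inr 1)"

lemma verts_attach_clique: "verts (attach_clique G v t) = verts G <+> {1..t}"
  by (simp add: attach_clique_def add_edge_def disjoint_union_def complete_graph_def)

lemma edge_attach_clique:
  "{Inl x, Inl y} \<in> edges (attach_clique G v t) \<longleftrightarrow> {x, y} \<in> edges G"
  "{Inr i, Inr j} \<in> edges (attach_clique G v t) \<longleftrightarrow> i \<in> {1..t} \<and> j \<in> {1..t} \<and> i \<noteq> j"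
  "{Inl x, Inr j} \<in> edges (attach_clique G v t) \<longleftrightarrow> x = v \<and> j = 1"
  "{Inr j, Inl x} \<in> edges (attach_clique G v t) \<longleftrightarrow> x = v \<and> j = 1"
proof -
  have 1: "Inl ` e = {Inl x, Inl y} \<longleftrightarrow> e = {x, y}" for e and x y :: 'a
    using inj_image_eq_iff[OF inj_Inl, of e "{x, y}"] by simp
  have 2: "Inr ` e = {Inr x, Inr y} \<longleftrightarrow> e = {x, y}" for e and x y :: nat
    using inj_image_eq_iff[OF inj_Inr, of e "{x, y}"] by simp
  have edges: "edges (attach_clique G v t) = insert {Inl v, Inr 1} ((image Inl) ` edges G \<union>
      (image Inr) ` {{i, j} | i j. i \<in> {1..t} \<and> j \<in> {1..t} \<and> i \<noteq> j})"
    by (simp add: attach_clique_def add_edge_def disjoint_union_def complete_graph_def)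
  show "{Inl x, Inl y} \<in> edges (attach_clique G v t) \<longleftrightarrow> {x, y} \<in> edges G"
    unfolding edges by (auto simp: 1 doubleton_eq_iff image_iff eq_commute[of "{Inl x, Inl y}"])
  show "{Inr i, Inr j} \<in> edges (attach_clique G v t) \<longleftrightarrow> i \<in> {1..t} \<and> j \<in> {1..t} \<and> i \<noteq> j"
    unfolding edges by (auto simp: 2 doubleton_eq_iff image_iff eq_commute[of "{Inr i, Inr j}"])
  show "{Inl x, Inr j} \<in> edges (attach_clique G v t) \<longleftrightarrow> x = v \<and> j = 1"
    unfolding edges by (auto simp: doubleton_eq_iff)
  then show "{Inr j, Inl x} \<in> edges (attach_clique G v t) \<longleftrightarrow> x = v \<and> j = 1"
    by (simp add: insert_commute)
qed

lemma proper_attach_clique: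
  assumes "v \<in> verts G" "1 \<le> t"
  shows "\<kappa> \<in> proper_colorings (attach_clique G v t) \<longleftrightarrow>
    \<kappa> \<in> (verts G <+> {1..t}) \<rightarrow>\<^sub>E {1..} \<and>
    restrict (\<lambda>x. \<kappa> (Inl x)) (verts G) \<in> proper_colorings G \<and>
    inj_on (\<lambda>i. \<kappa> (Inr i)) {1..t} \<and> \<kappa> (Inl v) \<noteq> \<kappa> (Inr 1)"
proof
  assume *: "\<kappa> \<in> proper_colorings (attach_clique G v t)"
  then have ran: "\<kappa> \<in> (verts G <+> {1..t}) \<rightarrow>\<^sub>E {1..}"
    and pr: "\<And>x y. x \<in> verts G <+> {1..t} \<Longrightarrow> y \<in> verts G <+> {1..t} \<Longrightarrow>
      {x, y} \<in> edges (attach_clique G v t) \<Longrightarrow> \<kappa> x \<noteq> \<kappa> y"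
    by (auto simp: proper_colorings_def verts_attach_clique)
  have "restrict (\<lambda>x. \<kappa> (Inl x)) (verts G) \<in> proper_colorings G"
    using ran pr[OF InlI InlI] by (auto simp: proper_colorings_def edge_attach_clique Suc_le_eq)
  moreover have "inj_on (\<lambda>i. \<kappa> (Inr i)) {1..t}"
  proof (rule inj_onI, rule ccontr)
    fix i j assume "i \<in> {1..t}" "j \<in> {1..t}" "\<kappa> (Inr i) = \<kappa> (Inr j)" "i \<noteq> j"
    then show False using pr[OF InrI InrI, of i j] by (auto simp: edge_attach_clique)
  qed
  moreover have "\<kappa> (Inl v) \<noteq> \<kappa> (Inr 1)"
    using pr[OF InlI InrI, of v 1] assms by (simp add: edge_attach_clique)
  ultimately show "\<kappa> \<in> (verts G <+> {1..t}) \<rightarrow>\<^sub>E {1..} \<and>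
    restrict (\<lambda>x. \<kappa> (Inl x)) (verts G) \<in> proper_colorings G \<and>
    inj_on (\<lambda>i. \<kappa> (Inr i)) {1..t} \<and> \<kappa> (Inl v) \<noteq> \<kappa> (Inr 1)" using ran by blast
next
  assume "\<kappa> \<in> (verts G <+> {1..t}) \<rightarrow>\<^sub>E {1..} \<and>
    restrict (\<lambda>x. \<kappa> (Inl x)) (verts G) \<in> proper_colorings G \<and>
    inj_on (\<lambda>i. \<kappa> (Inr i)) {1..t} \<and> \<kappa> (Inl v) \<noteq> \<kappa> (Inr 1)"
  then have ran: "\<kappa> \<in> (verts G <+> {1..t}) \<rightarrow>\<^sub>E {1..}"
    and G: "\<And>x y. x \<in> verts G \<Longrightarrow> y \<in> verts G \<Longrightarrow> {x, y} \<in> edges G \<Longrightarrow> \<kappa> (Inl x) \<noteq> \<kappa> (Inl y)"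
    and K: "inj_on (\<lambda>i. \<kappa> (Inr i)) {1..t}" and v: "\<kappa> (Inl v) \<noteq> \<kappa> (Inr 1)"
    by (auto simp: proper_colorings_def)
  have "\<kappa> x \<noteq> \<kappa> y" if "x \<in> verts G <+> {1..t}" "y \<in> verts G <+> {1..t}"
    "{x, y} \<in> edges (attach_clique G v t)" for x y
  proof (cases x)
    case x: (Inl u)
    show ?thesis
    proof (cases y)
      case (Inl u')
      then show ?thesis using that G[of u u'] by (auto simp: x edge_attach_clique)
    next
      case (Inr i)
      then show ?thesis using that v by (simp add: x edge_attach_clique)
    qed
  next
    case x: (Inr i)
    show ?thesis
    proof (cases y)
      case (Inl u)
      then show ?thesis using that v by (simp add: x edge_attach_clique)
    next
      case (Inr j)
      then show ?thesis using that inj_on_contraD[OF K, of i j] by (auto simp: x edge_attach_clique)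
    qed
  qed
  then show "\<kappa> \<in> proper_colorings (attach_clique G v t)"
    using ran by (auto simp: proper_colorings_def verts_attach_clique)
qed

text \<open>A permutation of \<open>insert a S\<close> is a transposition of \<open>a\<close> with
  its image, composed with a permutation of \<open>S\<close>. Forbidding one image leaves
  \<open>card S\<close> choices for the first factor and does not affect the second.\<close>

lemma card_permutes_avoiding:
  assumes "finite S" "a \<notin> S" "c \<in> insert a S"
  shows "card {p. p permutes insert a S \<and> p a \<noteq> c} = card S * fact (card S)"
proof -
  define f where "f x = Transposition.transpose a (fst x) \<circ> snd x" for x :: "'a \<times> ('a \<Rightarrow> 'a)"
  let ?D = "insert a S \<times> {p. p permutes S}"
  have img: "{p. p permutes insert a S} = f ` ?D"
    unfolding Permutations.permutes_insert by (rule image_cong) (auto simp: f_def)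
  have val: "f x a = fst x" if "x \<in> ?D" for x
    using that assms(2) by (auto simp: f_def permutes_not_in)
  have "{p. p permutes insert a S \<and> p a \<noteq> c} = {q \<in> f ` ?D. q a \<noteq> c}"
    unfolding img[symmetric] by blast
  also have "\<dots> = f ` {x \<in> ?D. fst x \<noteq> c}"
    using val by auto
  also have "{x \<in> ?D. fst x \<noteq> c} = (insert a S - {c}) \<times> {p. p permutes S}"
    by auto
  finally have eq: "{p. p permutes insert a S \<and> p a \<noteq> c} = f ` ((insert a S - {c}) \<times> {p. p permutes S})" .
  have "inj_on f ?D"
  proof (rule inj_onI)
    fix x y assume *: "x \<in> ?D" "y \<in> ?D" "f x = f y"
    then have 1: "fst x = fst y" using val[of x] val[of y] by simp
    have "Transposition.transpose a (fst x) (f x z) = snd x z" for z by (simp add: f_def)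
    moreover have "Transposition.transpose a (fst y) (f y z) = snd y z" for z by (simp add: f_def)
    ultimately have "snd x = snd y" using 1 *(3) by (simp add: fun_eq_iff)
    then show "x = y" using 1 by (simp add: prod_eq_iff)
  qed
  then have "inj_on f ((insert a S - {c}) \<times> {p. p permutes S})"
    by (rule inj_on_subset) auto
  then have "card {p. p permutes insert a S \<and> p a \<noteq> c} = card ((insert a S - {c}) \<times> {p. p permutes S})"
    unfolding eq by (rule card_image)
  also have "\<dots> = card S * fact (card S)"
    using assms card_permutations[OF refl assms(1)] by (simp add: card_cartesian_product)
  finally show ?thesis .
qed

lemma content_Plus:
  assumes "finite A" "finite B"
  shows "content (A <+> B) f = content A (\<lambda>x. f (Inl x)) + content B (\<lambda>y. f (Inr y))"
  unfolding Defs.content_def by (subst sum.Plus[OF assms]) (simp add: o_def)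

lemma content_permutes:
  assumes "p permutes {1..t}"
  shows "content {1..t} p = expo t (\<lambda>_. 1)"
proof -
  have "content {1..t} p = (\<Sum>i\<in>{1..t}. single i 1)"
    unfolding Defs.content_def using sum.permute[OF assms, of "\<lambda>i. single i (1::nat)"] by (simp add: o_def)
  also have "\<dots> = expo t (\<lambda>_. 1)"
    unfolding expo_def by (rule sum.reindex_bij_witness[where i=Suc and j="\<lambda>i. i - 1"]) auto
  finally show ?thesis .
qed

lemma keys_expo_subset: "keys (expo t a) \<subseteq> {1..t}"
  by (auto simp: keys_expo)

lemma coloring_entries:
  assumes "finite V" "content V \<kappa> = expo t a" "x \<in> V"
  shows "\<kappa> x \<in> {1..t}"
  using keys_content[OF assms(1), of \<kappa>] keys_expo_subset[of t a] assms(2,3) by auto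

text \<open>The clique has \<open>t\<close> vertices with distinct colours, and the content allows
  only \<open>t\<close> colours. Outside \<open>{1..t}\<close> the map is the identity because
  \<open>permutes\<close> demands it.\<close>

lemma clique_permutes:
  assumes fin: "finite (verts G)" and v: "v \<in> verts G" "1 \<le> t"
    and \<kappa>: "\<kappa> \<in> proper_colorings (attach_clique G v t)"
    and cont: "content (verts (attach_clique G v t)) \<kappa> = expo t a"
  shows "(\<lambda>i. if i \<in> {1..t} then \<kappa> (Inr i) else i) permutes {1..t}"
proof (rule bij_imp_permutes)
  let ?p = "\<lambda>i. if i \<in> {1..t} then \<kappa> (Inr i) else i"
  have finV: "finite (verts (attach_clique G v t))" using fin by (simp add: verts_attach_clique)
  have img: "?p ` {1..t} \<subseteq> {1..t}"
  proof (rule image_subsetI)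
    fix i assume i: "i \<in> {1..t}"
    then have "Inr i \<in> verts (attach_clique G v t)" by (auto simp: verts_attach_clique)
    then show "?p i \<in> {1..t}" using coloring_entries[OF finV cont] i by simp
  qed
  have "inj_on (\<lambda>i. \<kappa> (Inr i)) {1..t}"
    using \<kappa> unfolding proper_attach_clique[OF v] by blast
  then have inj: "inj_on ?p {1..t}" by (rule inj_on_cong[THEN iffD2, rotated]) simp
  show "bij_betw ?p {1..t} {1..t}"
    unfolding bij_betw_def using inj endo_inj_surj[OF finite_atLeastAtMost img inj] by (rule conjI)
qed auto

text \<open>Every one of the \<open>t\<close> colours already occurs on the clique.\<close>

lemma chromatic_attach_clique_pos:
  assumes "finite (verts G)" "v \<in> verts G" "1 \<le> t"
    and nz: "chromatic_sym (attach_clique G v t) (expo t a) \<noteq> 0" and "i < t"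
  shows "0 < a i"
proof -
  have finV: "finite (verts (attach_clique G v t))" using assms(1) by (simp add: verts_attach_clique)
  have "{\<kappa> \<in> proper_colorings (attach_clique G v t). content (verts (attach_clique G v t)) \<kappa> = expo t a} \<noteq> {}"
    using nz unfolding chromatic_sym_def by (metis card.empty of_nat_0)
  then obtain \<kappa> where \<kappa>: "\<kappa> \<in> proper_colorings (attach_clique G v t)"
    "content (verts (attach_clique G v t)) \<kappa> = expo t a" by blast
  have "Suc i \<in> {1..t}" using \<open>i < t\<close> by simp
  then have "Suc i \<in> (\<lambda>i. if i \<in> {1..t} then \<kappa> (Inr i) else i) ` {1..t}"
    using permutes_image[OF clique_permutes[OF assms(1-3) \<kappa>]] by simp
  then obtain j where j: "j \<in> {1..t}" "\<kappa> (Inr j) = Suc i" by auto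
  then have "Inr j \<in> verts (attach_clique G v t)" by (auto simp: verts_attach_clique)
  then have "Suc i \<in> \<kappa> ` verts (attach_clique G v t)" using j(2) by (metis image_eqI)
  then have "Suc i \<in> keys (expo t a)" using keys_content[OF finV, of \<kappa>] \<kappa>(2) by simp
  then show ?thesis by (auto simp: keys_expo)
qed

text \<open>A colouring splits into a colouring of \<open>G\<close>, with one vertex less in each
  class, and a permutation of the colours on the clique. The only link is that the colour of clique
  vertex 1 differs from that of \<open>v\<close>; whatever the latter is,
  \<open>(t - 1) * fact (t - 1)\<close> permutations comply.\<close>

lemma chromatic_attach_clique:
  assumes fin: "finite (verts G)" and v: "v \<in> verts G" "1 \<le> t"
  shows "chromatic_sym (attach_clique G v t) (expo t (\<lambda>i. b i + 1))
    = (int t - 1) * fact (t - 1) * chromatic_sym G (expo t b)"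
proof -
  let ?V = "verts G" and ?A = "attach_clique G v t" and ?W = "verts G <+> {1..t}"
  define S where "S = {\<kappa> \<in> proper_colorings ?A. content ?W \<kappa> = expo t (\<lambda>i. b i + 1)}"
  define S0 where "S0 = {\<kappa> \<in> proper_colorings G. content ?V \<kappa> = expo t b}"
  define Q where "Q c = {p. p permutes {1..t} \<and> p 1 \<noteq> c}" for c :: nat
  define split where "split \<kappa> = (restrict (\<lambda>x. \<kappa> (Inl x)) ?V, \<lambda>i. if i \<in> {1..t} then \<kappa> (Inr i) else i)"
    for \<kappa> :: "'a + nat \<Rightarrow> nat"
  define glue where "glue x = restrict (case_sum (fst x) (snd x)) ?W" for x :: "('a \<Rightarrow> nat) \<times> (nat \<Rightarrow> nat)"
  have finW: "finite ?W" using fin by simp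
  have cont: "content ?W \<kappa> = content ?V (\<lambda>x. \<kappa> (Inl x)) + content {1..t} (\<lambda>i. \<kappa> (Inr i))" for \<kappa> :: "'a + nat \<Rightarrow> nat"
    using content_Plus[OF fin, of "{1..t}"] by simp
  have add1: "expo t b + expo t (\<lambda>_. 1) = expo t (\<lambda>i. b i + 1)" by (simp add: expo_add)
  have "bij_betw split S (SIGMA \<kappa>0:S0. Q (\<kappa>0 v))"
  proof (rule bij_betw_byWitness[where f'=glue])
    show "\<forall>\<kappa>\<in>S. glue (split \<kappa>) = \<kappa>"
    proof
      fix \<kappa> assume "\<kappa> \<in> S"
      then have "\<kappa> \<in> ?W \<rightarrow>\<^sub>E {1..}" by (simp add: S_def proper_attach_clique[OF v])
      then have ext: "\<kappa> x = undefined" if "x \<notin> ?W" for x using that by auto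
      show "glue (split \<kappa>) = \<kappa>"
      proof
        fix x show "glue (split \<kappa>) x = \<kappa> x"
          using ext[of x] by (cases x) (auto simp: glue_def split_def)
      qed
    qed
    show "split ` S \<subseteq> (SIGMA \<kappa>0:S0. Q (\<kappa>0 v))"
    proof (rule image_subsetI)
      fix \<kappa> assume "\<kappa> \<in> S"
      then have \<kappa>: "\<kappa> \<in> proper_colorings ?A" "content ?W \<kappa> = expo t (\<lambda>i. b i + 1)" by (simp_all add: S_def)
      let ?p = "\<lambda>i. if i \<in> {1..t} then \<kappa> (Inr i) else i"
      have "content (verts ?A) \<kappa> = expo t (\<lambda>i. b i + 1)" using \<kappa>(2) by (simp only: verts_attach_clique)
      then have p: "?p permutes {1..t}" by (rule clique_permutes[OF fin v \<kappa>(1)])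
      have "content {1..t} (\<lambda>i. \<kappa> (Inr i)) = content {1..t} ?p"
        by (rule content_cong) simp
      then have "content {1..t} (\<lambda>i. \<kappa> (Inr i)) = expo t (\<lambda>_. 1)"
        using content_permutes[OF p] by simp
      then have "content ?V (\<lambda>x. \<kappa> (Inl x)) = expo t b"
        using \<kappa>(2) unfolding cont add1[symmetric] by simp
      moreover have "content ?V (restrict (\<lambda>x. \<kappa> (Inl x)) ?V) = content ?V (\<lambda>x. \<kappa> (Inl x))"
        by (rule content_cong) simp
      ultimately show "split \<kappa> \<in> (SIGMA \<kappa>0:S0. Q (\<kappa>0 v))"
        using p \<kappa>(1) v by (simp add: split_def S0_def Q_def proper_attach_clique[OF v])
    qed
    have glueS: "split (glue x) = x \<and> glue x \<in> S" if "x \<in> (SIGMA \<kappa>0:S0. Q (\<kappa>0 v))" for x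
    proof -
      obtain \<kappa>0 p where x: "x = (\<kappa>0, p)" by (cases x)
      have \<kappa>0: "\<kappa>0 \<in> proper_colorings G" "content ?V \<kappa>0 = expo t b"
        and p: "p permutes {1..t}" "p 1 \<noteq> \<kappa>0 v"
        using that by (auto simp: x S0_def Q_def)
      have ext: "\<kappa>0 \<in> ?V \<rightarrow>\<^sub>E {1..}" using \<kappa>0(1) by (simp add: proper_colorings_def)
      have gl: "glue x (Inl y) = \<kappa>0 y" "glue x (Inr i) = p i" if "y \<in> ?V" "i \<in> {1..t}" for y i
        using that by (auto simp: glue_def x)
      have r: "restrict (\<lambda>y. glue x (Inl y)) ?V = \<kappa>0"
        using ext gl(1) v(2) by (auto simp: fun_eq_iff PiE_def extensional_def)
      moreover have "(\<lambda>i. if i \<in> {1..t} then glue x (Inr i) else i) = p"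
        using gl(2)[OF v(1)] p(1) by (auto simp: fun_eq_iff permutes_not_in)
      ultimately have "split (glue x) = (\<kappa>0, p)" by (simp add: split_def)
      then have 1: "split (glue x) = x" by (simp only: x)
      have "content ?V (\<lambda>y. glue x (Inl y)) = content ?V \<kappa>0"
        using gl(1) v(2) by (intro content_cong) auto
      moreover have "content {1..t} (\<lambda>i. glue x (Inr i)) = content {1..t} p"
        using gl(2)[OF v(1)] by (rule content_cong)
      ultimately have 2: "content ?W (glue x) = expo t (\<lambda>i. b i + 1)"
        using \<kappa>0(2) content_permutes[OF p(1)] add1 unfolding cont by simp
      have "inj_on (\<lambda>i. glue x (Inr i)) {1..t}"
        using gl(2)[OF v(1)] permutes_inj[OF p(1)] by (auto simp: inj_on_def inj_def)
      moreover have "glue x \<in> ?W \<rightarrow>\<^sub>E {1..}"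
      proof -
        have "glue x z \<in> {1..}" if "z \<in> ?W" for z
        proof (cases z)
          case (Inl y)
          then show ?thesis using that ext by (auto simp: glue_def x)
        next
          case (Inr i)
          then have "i \<in> {1..t}" using that by auto
          then have "p i \<in> {1..t}" using permutes_in_image[OF p(1)] by blast
          then show ?thesis using that Inr by (simp add: glue_def x)
        qed
        then show ?thesis by (auto simp: glue_def)
      qed
      moreover have "glue x (Inl v) \<noteq> glue x (Inr 1)"
        using gl(1)[OF v(1), of 1] gl(2)[OF v(1), of 1] p(2) v(2) by simp
      ultimately have "glue x \<in> proper_colorings ?A"
        using r \<kappa>0(1) by (simp add: proper_attach_clique[OF v])
      then show ?thesis using 1 2 by (simp add: S_def)
    qed
    then show "\<forall>x\<in>SIGMA \<kappa>0:S0. Q (\<kappa>0 v). split (glue x) = x" "glue ` (SIGMA \<kappa>0:S0. Q (\<kappa>0 v)) \<subseteq> S"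
      by blast+
  qed
  then have "card S = card (SIGMA \<kappa>0:S0. Q (\<kappa>0 v))" by (rule bij_betw_same_card)
  also have "\<dots> = (\<Sum>\<kappa>0\<in>S0. card (Q (\<kappa>0 v)))"
  proof (rule card_SigmaI)
    have "S0 \<subseteq> ?V \<rightarrow>\<^sub>E {1..t}"
      using coloring_entries[OF fin] by (auto simp: S0_def proper_colorings_def PiE_def Pi_def)
    then show "finite S0" using finite_PiE[OF fin, of "\<lambda>_. {1..t}"] by (auto intro: finite_subset)
    show "\<forall>\<kappa>0\<in>S0. finite (Q (\<kappa>0 v))"
      using finite_permutations[of "{1..t}"] by (auto simp: Q_def)
  qed
  also have "\<dots> = (\<Sum>\<kappa>0\<in>S0. (t - 1) * fact (t - 1))"
  proof (rule sum.cong)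
    fix \<kappa>0 assume "\<kappa>0 \<in> S0"
    then have c: "\<kappa>0 v \<in> {1..t}" using coloring_entries[OF fin _ v(1)] by (simp add: S0_def)
    have ins: "{1..t} = insert 1 {2..t}" using v(2) by auto
    show "card (Q (\<kappa>0 v)) = (t - 1) * fact (t - 1)"
      using card_permutes_avoiding[of "{2..t}" 1 "\<kappa>0 v"] c unfolding Q_def ins by simp
  qed simp
  finally have "int (card S) = int ((t - 1) * fact (t - 1) * card S0)" by simp
  also have "\<dots> = (int t - 1) * fact (t - 1) * int (card S0)" using v(2) by (simp add: of_nat_diff)
  finally show ?thesis
    by (simp add: chromatic_sym_def S_def S0_def verts_attach_clique)
qed

section \<open>Reduction of the alternating coefficient to fewer variables\<close>

lemma permutes_fixes_tail:
  fixes w :: "nat \<Rightarrow> nat"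
  assumes w: "w permutes {..<t}" and ge: "\<And>i. n \<le> i \<Longrightarrow> i < t \<Longrightarrow> i \<le> w i"
  shows "w permutes {..<n}"
proof -
  have "\<forall>x\<in>{..<t} - {..<n}. w x = x"
  proof (rule ccontr)
    assume "\<not> (\<forall>x\<in>{..<t} - {..<n}. w x = x)"
    define D where "D = {i. n \<le> i \<and> i < t \<and> w i \<noteq> i}"
    have D: "finite D" "D \<noteq> {}" using \<open>\<not> _\<close> by (auto simp: D_def)
    define m where "m = Max D"
    have m: "n \<le> m" "m < t" "w m \<noteq> m" using Max_in[OF D] by (auto simp: m_def D_def)
    \<comment> \<open>The largest moved position goes to a larger one, which is fixed by maximality;
      injectivity forbids this.\<close>
    have "m < w m" using ge[OF m(1,2)] m(3) by simp
    moreover have "w m < t" using permutes_in_image[OF w, of m] m(2) by simp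
    moreover have "w m \<notin> D" using Max_ge[OF D(1), of "w m"] \<open>m < w m\<close> unfolding m_def[symmetric] by auto
    ultimately have "w (w m) = w m" using m(1) unfolding D_def by auto
    then show False using permutes_inj[OF w] m(3) by (auto dest: injD)
  qed
  then show ?thesis using permutes_superset[OF w] by blast
qed

text \<open>Where \<open>l i = 1\<close>, a nonzero term needs a positive exponent
  \<open>1 + w i - i\<close>, hence \<open>i \<le> w i\<close>. A permutation with this property
  throughout the tail fixes it pointwise, so the sum shrinks to permutations of the first
  \<open>n\<close> positions, and \<open>shift\<close> then applies to every term.\<close>

lemma alternating_coeff_hook_tail:
  assumes "n \<le> t" and tail: "\<And>i. n \<le> i \<Longrightarrow> i < t \<Longrightarrow> l i = 1"
    and pos: "\<And>i. i < n \<Longrightarrow> 1 \<le> l i"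
    and supp: "\<And>a i. f (expo t a) \<noteq> 0 \<Longrightarrow> i < t \<Longrightarrow> 0 < a i"
    and shift: "\<And>b. f (expo t (\<lambda>i. b i + 1)) = k * g (expo t b)"
  shows "alternating_coeff t l f = k * alternating_coeff n (\<lambda>i. l i - 1) g"
proof -
  let ?T = "\<lambda>w. if \<forall>i<t. i \<le> l i + w i then f (expo t (\<lambda>i. l i + w i - i)) else 0"
  let ?U = "\<lambda>w. if \<forall>i<n. i \<le> l i - 1 + w i then g (expo n (\<lambda>i. l i - 1 + w i - i)) else 0"
  have zero: "\<forall>i<t. i < l i + w i" if "?T w \<noteq> 0" for w
    using that supp[of "\<lambda>i. l i + w i - i"] by (auto split: if_splits)
  have "alternating_coeff t l f = (\<Sum>w | w permutes {..<n}. sign w * ?T w)"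
    unfolding alternating_coeff_def
  proof (rule sum.mono_neutral_right)
    show "finite {w. w permutes {..<t}}" by (simp add: finite_permutations)
    show "{w. w permutes {..<n}} \<subseteq> {w. w permutes {..<t}}"
      using \<open>n \<le> t\<close> by (auto intro: permutes_subset)
    show "\<forall>w\<in>{w. w permutes {..<t}} - {w. w permutes {..<n}}. sign w * ?T w = 0"
    proof (rule ballI, rule ccontr)
      fix w assume w: "w \<in> {w. w permutes {..<t}} - {w. w permutes {..<n}}" and "sign w * ?T w \<noteq> 0"
      then have *: "i < l i + w i" if "i < t" for i using zero[of w] that by auto
      have "w permutes {..<n}"
      proof (rule permutes_fixes_tail)
        show "w permutes {..<t}" using w by simp
        show "i \<le> w i" if "n \<le> i" "i < t" for i using *[OF that(2)] tail[OF that] by simp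
      qed
      then show False using w by simp
    qed
  qed
  also have "\<dots> = (\<Sum>w | w permutes {..<n}. sign w * (k * ?U w))"
  proof (intro sum.cong refl arg_cong2[where f="(*)"])
    fix w assume "w \<in> {w. w permutes {..<n}}"
    then have w: "w i = i" if "n \<le> i" for i using that by (auto simp: permutes_not_in)
    show "?T w = k * ?U w"
    proof (cases "\<forall>i<n. i \<le> l i - 1 + w i")
      case True
      \<comment> \<open>Each exponent is lowered by one. In the tail it was exactly one, so
        \<open>b\<close> vanishes there and \<open>n\<close> variables remain.\<close>
      define b where "b i = (if i < n then l i - 1 + w i - i else 0)" for i
      have bi: "l i + w i - i = b i + 1" "i \<le> l i + w i" if "i < t" for i
        using spec[OF True, of i] that pos[of i] tail[of i] w[of i] by (cases "i < n"; simp add: b_def)+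
      have "?T w = f (expo t (\<lambda>i. b i + 1))"
        using bi by (auto intro!: arg_cong[where f=f] expo_cong)
      also have "\<dots> = k * g (expo t b)" by (rule shift)
      also have "expo t b = expo n (\<lambda>i. l i - 1 + w i - i)"
        using \<open>n \<le> t\<close> by (intro poly_mapping_eqI) (auto simp: lookup_expo b_def)
      finally show ?thesis using True by simp
    next
      case False
      \<comment> \<open>When the reduced exponent would be negative, the original one is at most
        zero, so \<open>f\<close> contributes nothing either.\<close>
      then obtain i where i: "i < n" "l i - 1 + w i < i" by auto
      have T: "?T w = 0"
      proof (rule ccontr)
        assume "?T w \<noteq> 0"
        then have "i < l i + w i" using zero[of w] i(1) \<open>n \<le> t\<close> by auto
        then show False using i pos[OF i(1)] by simp
      qed
      show ?thesis unfolding T if_not_P[OF False] by simp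
    qed
  qed
  also have "\<dots> = k * alternating_coeff n (\<lambda>i. l i - 1) g"
    unfolding alternating_coeff_def sum_distrib_left by (intro sum.cong refl mult.left_commute)
  finally show ?thesis .
qed

section \<open>Line graphs\<close>

lemma edge_line_graph:
  "{x, y} \<in> edges (line_graph H) \<longleftrightarrow> x \<in> edges H \<and> y \<in> edges H \<and> x \<noteq> y \<and> x \<inter> y \<noteq> {}"
  by (auto simp: line_graph_def doubleton_eq_iff Int_commute)

lemma F_eq: "F t = attach_clique G2 {2, 7} t"
  by (simp add: F_def attach_clique_def)

lemma H2_simple: "simple_graph H2"
  by (simp add: simple_graph_def H2_def)

lemma finite_verts_G2: "finite (verts G2)"
  by (simp add: G2_def line_graph_def H2_def)

section \<open>The graphs F_t: simplicity, order and connectedness\<close>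

lemma simple_line_graph:
  assumes "finite (edges H)"
  shows "simple_graph (line_graph H)"
  using assms by (auto simp: simple_graph_def line_graph_def card_2_iff)

lemma simple_attach_clique:
  assumes "simple_graph G" "v \<in> verts G" "1 \<le> t"
  shows "simple_graph (attach_clique G v t)"
proof -
  have "e \<subseteq> verts G <+> {1..t} \<and> card e = 2" if "e \<in> edges (attach_clique G v t)" for e
  proof -
    have "e = {Inl v, Inr 1} \<or> (\<exists>f\<in>edges G. e = Inl ` f) \<or>
        (\<exists>i j. i \<in> {1..t} \<and> j \<in> {1..t} \<and> i \<noteq> j \<and> e = Inr ` {i, j})"
      using that unfolding attach_clique_def add_edge_def disjoint_union_def complete_graph_def
      by (simp, blast)
    then consider "e = {Inl v, Inr 1}" | f where "f \<in> edges G" "e = Inl ` f"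
      | i j where "e = {Inr i, Inr j}" "i \<in> {1..t}" "j \<in> {1..t}" "i \<noteq> j"
      by auto
    then show ?thesis
    proof cases
      case 2
      then show ?thesis using assms(1) by (auto simp: simple_graph_def card_image)
    qed (use assms in auto)
  qed
  then show ?thesis using assms(1) by (simp add: simple_graph_def verts_attach_clique)
qed

lemma simple_F: "1 \<le> t \<Longrightarrow> simple_graph (F t)"
  unfolding F_eq
  by (rule simple_attach_clique) (simp_all add: G2_def simple_line_graph H2_def, simp add: line_graph_def)

lemma card_verts_F: "card (verts (F t)) = card (verts G2) + t"
  using finite_verts_G2 by (simp add: F_eq verts_attach_clique card_Plus)

lemma graph_iso_card: "graph_iso G H \<Longrightarrow> card (verts G) = card (verts H)"
  unfolding graph_iso_def using bij_betw_same_card by blast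

lemma F_not_iso: "s \<noteq> t \<Longrightarrow> \<not> graph_iso (F s) (F t)"
  using graph_iso_card[of "F s" "F t"] by (auto simp: card_verts_F)

lemma connected_graphI:
  assumes "r \<in> verts G" "\<And>u. u \<in> verts G \<Longrightarrow> (r, u) \<in> {(a, b). {a, b} \<in> edges G}\<^sup>*"
  shows "connected_graph G"
proof -
  have "sym {(a, b). {a, b} \<in> edges G}" by (auto simp: sym_def insert_commute)
  then have "sym ({(a, b). {a, b} \<in> edges G}\<^sup>*)" by (rule sym_rtrancl)
  then show ?thesis
    using assms unfolding connected_graph_def by (auto dest: symD intro: rtrancl_trans)
qed

lemma connected_attach_clique:
  assumes "connected_graph G" "v \<in> verts G" "1 \<le> t"
  shows "connected_graph (attach_clique G v t)"
proof (rule connected_graphI[of "Inl v"])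
  show "Inl v \<in> verts (attach_clique G v t)" using assms by (auto simp: verts_attach_clique)
  let ?R = "{(a, b). {a, b} \<in> edges (attach_clique G v t)}"
  have lift: "(Inl v, Inl x) \<in> ?R\<^sup>*" if "(v, x) \<in> {(a, b). {a, b} \<in> edges G}\<^sup>*" for x
    using that
  proof (induction rule: rtrancl_induct)
    case (step y z)
    then have "(Inl y, Inl z) \<in> ?R" by (simp add: edge_attach_clique)
    then show ?case using step.IH by (rule rtrancl_into_rtrancl[rotated])
  qed simp
  fix u assume u: "u \<in> verts (attach_clique G v t)"
  show "(Inl v, u) \<in> ?R\<^sup>*"
  proof (cases u)
    case (Inl x)
    then show ?thesis using u lift assms by (auto simp: verts_attach_clique connected_graph_def)
  next
    case (Inr i)
    have 1: "(Inl v, Inr 1) \<in> ?R" by (simp add: edge_attach_clique)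
    show ?thesis
    proof (cases "i = 1")
      case True
      then show ?thesis using 1 Inr by blast
    next
      case False
      then have "(Inr 1, Inr i) \<in> ?R" using u Inr assms(3) by (auto simp: verts_attach_clique edge_attach_clique)
      then show ?thesis using 1 Inr by (meson r_into_rtrancl rtrancl_into_rtrancl)
    qed
  qed
qed

lemma connected_G2: "connected_graph G2"
proof (rule connected_graphI[of "{7, 9}"])
  show "{7, 9} \<in> verts G2" by (simp add: G2_def line_graph_def H2_def)
  let ?R = "{(a, b). {a, b} \<in> edges G2}"
  have R: "(x, y) \<in> ?R \<longleftrightarrow> x \<in> edges H2 \<and> y \<in> edges H2 \<and> x \<noteq> y \<and> x \<inter> y \<noteq> {}" for x y
    by (simp add: G2_def edge_line_graph)
  have step: "(a, c) \<in> ?R\<^sup>*" if "(a, b) \<in> ?R\<^sup>*" "(b, c) \<in> ?R" for a b c using that by (rule rtrancl_into_rtrancl)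
  \<comment> \<open>A spanning tree of the line graph, rooted at the edge that joins the two centres
    9 and 10 through 7.\<close>
  have e: "({7, 9}, {7, 10}) \<in> ?R" "({7, 9}, {2, 7}) \<in> ?R" "({7, 9}, {1, 9}) \<in> ?R" "({7, 9}, {4, 9}) \<in> ?R"
    "({7, 9}, {5, 9}) \<in> ?R" "({4, 9}, {4, 5}) \<in> ?R" "({1, 9}, {1, 8}) \<in> ?R"
    "({7, 10}, {3, 10}) \<in> ?R" "({7, 10}, {6, 10}) \<in> ?R" "({7, 10}, {8, 10}) \<in> ?R" "({3, 10}, {3, 6}) \<in> ?R"
    unfolding R by (simp_all add: H2_def doubleton_eq_iff)
  fix u assume "u \<in> verts G2"
  then have "u \<in> {{1, 8}, {1, 9}, {2, 7}, {3, 6}, {3, 10}, {4, 5},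
              {4, 9}, {5, 9}, {6, 10}, {7, 9}, {7, 10}, {8, 10}}"
    by (simp add: G2_def line_graph_def H2_def)
  then show "({7, 9}, u) \<in> ?R\<^sup>*"
    using e[THEN r_into_rtrancl] step[OF e(4)[THEN r_into_rtrancl] e(6)] step[OF e(3)[THEN r_into_rtrancl] e(7)]
      step[OF e(1)[THEN r_into_rtrancl] e(8)] step[OF e(1)[THEN r_into_rtrancl] e(9)]
      step[OF e(1)[THEN r_into_rtrancl] e(10)] step[OF step[OF e(1)[THEN r_into_rtrancl] e(8)] e(11)]
    by (elim insertE emptyE) (simp_all only: rtrancl.rtrancl_refl)
qed

lemma connected_F: "1 \<le> t \<Longrightarrow> connected_graph (F t)"
  unfolding F_eq by (rule connected_attach_clique[OF connected_G2]) (simp_all add: G2_def line_graph_def H2_def)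

text \<open>The centre of the star is 11. Clique vertex 1 becomes the edge from 11 to 2, and clique
  vertex \<open>i > 1\<close> the edge from 11 to \<open>10 + i\<close>, so the new leaves start at
  12.\<close>

definition root_graph :: "nat \<Rightarrow> nat ugraph" where
  "root_graph t = \<lparr>verts = {1..10 + t},
     edges = edges H2 \<union> (\<lambda>i. {11, if i = 1 then 2 else 10 + i}) ` {1..t}\<rparr>"

lemma H2_edge_subset: "e \<in> edges H2 \<Longrightarrow> e \<subseteq> {1..10}"
  by (auto simp: H2_def)

lemma simple_root_graph: "1 \<le> t \<Longrightarrow> simple_graph (root_graph t)"
proof -
  assume t: "1 \<le> t"
  have "e \<subseteq> {1..10 + t} \<and> card e = 2" if "e \<in> edges H2" for e
    using that H2_simple by (force simp: simple_graph_def H2_def)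
  moreover have "{11, if i = 1 then 2 else 10 + i} \<subseteq> {1..10 + t} \<and> card {11, if i = 1 then 2 else 10 + i} = 2"
    if "i \<in> {1..t}" for i
    using that by auto
  ultimately show ?thesis by (auto simp: simple_graph_def root_graph_def)
qed

lemma line_graph_F:
  assumes t: "1 \<le> t"
  shows "is_line_graph (F t)"
  unfolding is_line_graph_def
proof (intro exI conjI)
  show "simple_graph (root_graph t)" by (rule simple_root_graph[OF t])
  let ?s = "\<lambda>i. {11, if i = 1 then 2 else 10 + i} :: nat set"
  let ?f = "case_sum id ?s"
  have VF: "verts (F t) = edges H2 <+> {1..t}"
    by (simp add: F_eq verts_attach_clique G2_def line_graph_def)
  have VL: "verts (line_graph (root_graph t)) = edges H2 \<union> ?s ` {1..t}"
    by (simp add: line_graph_def root_graph_def)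
  have EL: "edges (root_graph t) = edges H2 \<union> ?s ` {1..t}" by (simp add: root_graph_def)
  have no11: "k \<notin> e" if "e \<in> edges H2" "11 \<le> k" for e k
    using H2_edge_subset[OF that(1)] that(2) by auto
  have sinj: "?s i = ?s j \<longleftrightarrow> i = j" if "i \<in> {1..t}" "j \<in> {1..t}" for i j
    using that by (auto simp: doubleton_eq_iff split: if_splits)
  \<comment> \<open>Vertex 2 lies on no other edge of \<open>H2\<close> than \<open>{2, 7}\<close>,
    and the other leaves of the star are new vertices.\<close>
  have meet: "e \<inter> ?s i \<noteq> {} \<longleftrightarrow> e = {2, 7} \<and> i = 1" if "e \<in> edges H2" "i \<in> {1..t}" for e i
  proof (cases "i = 1")
    case True
    then show ?thesis using that(1) by (auto simp: H2_def)
  next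
    case False
    then show ?thesis using no11[OF that(1), of "10 + i"] no11[OF that(1), of 11] that(2) by auto
  qed
  have disj: "?s i \<noteq> e" if "e \<in> edges H2" for e i using no11[OF that, of 11] by auto
  show "graph_iso (F t) (line_graph (root_graph t))"
    unfolding graph_iso_def
  proof (intro exI conjI ballI)
    show "bij_betw ?f (verts (F t)) (verts (line_graph (root_graph t)))"
      unfolding bij_betw_def
    proof
      show "inj_on ?f (verts (F t))"
      proof (rule inj_onI)
        fix x y assume xy: "x \<in> verts (F t)" "y \<in> verts (F t)" "?f x = ?f y"
        show "x = y"
        proof (cases x; cases y)
          fix a b assume "x = Inl a" "y = Inl b" then show ?thesis using xy by simp
        next
          fix a j assume "x = Inl a" "y = Inr j"
          then show ?thesis using xy disj[of a j] by (simp add: VF) blast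
        next
          fix i b assume "x = Inr i" "y = Inl b"
          then show ?thesis using xy disj[of b i] by (simp add: VF) blast
        next
          fix i j assume ij: "x = Inr i" "y = Inr j"
          then have "i \<in> {1..t}" "j \<in> {1..t}" using xy(1,2) unfolding VF by auto
          then show ?thesis using xy(3) sinj[of i j] unfolding ij by simp
        qed
      qed
      show "?f ` verts (F t) = verts (line_graph (root_graph t))"
        unfolding VF VL Plus_def image_Un image_image by simp
    qed
    fix x y assume xy: "x \<in> verts (F t)" "y \<in> verts (F t)"
    show "{x, y} \<in> edges (F t) \<longleftrightarrow> {?f x, ?f y} \<in> edges (line_graph (root_graph t))"
    proof (cases x; cases y)
      fix a b assume ab: "x = Inl a" "y = Inl b"
      then have "a \<in> edges H2" "b \<in> edges H2" using xy unfolding VF by auto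
      then show ?thesis unfolding ab F_eq by (simp add: edge_attach_clique G2_def edge_line_graph EL)
    next
      fix a j assume aj: "x = Inl a" "y = Inr j"
      then have "a \<in> edges H2" "j \<in> {1..t}" using xy unfolding VF by auto
      then show ?thesis unfolding aj F_eq edge_attach_clique edge_line_graph EL
        using meet[of a j] disj[of a j] by (simp only: sum.case id_apply) blast
    next
      fix i b assume ib: "x = Inr i" "y = Inl b"
      then have "b \<in> edges H2" "i \<in> {1..t}" using xy unfolding VF by auto
      then show ?thesis unfolding ib F_eq edge_attach_clique edge_line_graph EL
        using meet[of b i] disj[of b i] by (simp only: sum.case id_apply) blast
    next
      fix i j assume ij: "x = Inr i" "y = Inr j"
      then have "i \<in> {1..t}" "j \<in> {1..t}" using xy unfolding VF by auto
      moreover from this have "?s i \<noteq> ?s j \<longleftrightarrow> i \<noteq> j" using sinj by blast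
      ultimately show ?thesis unfolding ij F_eq edge_attach_clique edge_line_graph EL
        by (simp only: sum.case) blast
    qed
  qed
qed

section \<open>Isomorphism invariance and claw-freeness\<close>

lemma graph_iso_trans:
  assumes "graph_iso G H" "graph_iso H K"
  shows "graph_iso G K"
proof -
  obtain f g where f: "bij_betw f (verts G) (verts H)"
      "\<forall>u\<in>verts G. \<forall>v\<in>verts G. {u, v} \<in> edges G \<longleftrightarrow> {f u, f v} \<in> edges H"
    and g: "bij_betw g (verts H) (verts K)"
      "\<forall>u\<in>verts H. \<forall>v\<in>verts H. {u, v} \<in> edges H \<longleftrightarrow> {g u, g v} \<in> edges K"
    using assms unfolding graph_iso_def by blast
  have "f u \<in> verts H" if "u \<in> verts G" for u using f(1) that by (auto simp: bij_betw_def)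
  then have "\<forall>u\<in>verts G. \<forall>v\<in>verts G. {u, v} \<in> edges G \<longleftrightarrow> {(g \<circ> f) u, (g \<circ> f) v} \<in> edges K"
    using f(2) g(2) by simp
  then show ?thesis
    unfolding graph_iso_def using bij_betw_trans[OF f(1) g(1)] by blast
qed

lemma graph_iso_sym:
  assumes "graph_iso G H"
  shows "graph_iso H G"
proof -
  obtain f where f: "bij_betw f (verts G) (verts H)"
      "\<forall>u\<in>verts G. \<forall>v\<in>verts G. {u, v} \<in> edges G \<longleftrightarrow> {f u, f v} \<in> edges H"
    using assms unfolding graph_iso_def by blast
  let ?g = "inv_into (verts G) f"
  have g: "?g u \<in> verts G" "f (?g u) = u" if "u \<in> verts H" for u
    using that f(1) by (auto simp: bij_betw_def inv_into_into f_inv_into_f)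
  have "\<forall>u\<in>verts H. \<forall>v\<in>verts H. {u, v} \<in> edges H \<longleftrightarrow> {?g u, ?g v} \<in> edges G"
    using f(2) g by simp
  then show ?thesis
    unfolding graph_iso_def using bij_betw_inv_into[OF f(1)] by blast
qed

text \<open>The three leaves of an induced claw would be pairwise disjoint edges of the root graph, all meeting
  the two-element centre.\<close>

lemma line_graph_claw_free:
  assumes "is_line_graph G"
  shows "claw_free G"
  unfolding claw_free_def
proof
  assume "\<exists>S\<subseteq>verts G. graph_iso (induced_subgraph G S) claw"
  then obtain S where S: "S \<subseteq> verts G" "graph_iso claw (induced_subgraph G S)"
    using graph_iso_sym by blast
  obtain H :: "nat ugraph" where H: "simple_graph H" "graph_iso G (line_graph H)"
    using assms by (auto simp: is_line_graph_def)
  obtain g where g: "bij_betw g (verts claw) S"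
    "\<forall>u\<in>verts claw. \<forall>v\<in>verts claw. {u, v} \<in> edges claw \<longleftrightarrow> {g u, g v} \<in> {e \<in> edges G. e \<subseteq> S}"
    using S(2) by (auto simp: graph_iso_def induced_subgraph_def)
  obtain f where f: "bij_betw f (verts G) (verts (line_graph H))"
    "\<forall>u\<in>verts G. \<forall>v\<in>verts G. {u, v} \<in> edges G \<longleftrightarrow> {f u, f v} \<in> edges (line_graph H)"
    using H(2) by (auto simp: graph_iso_def)
  define h where "h i = f (g i)" for i
  have gS: "g i \<in> S" if "i \<in> verts claw" for i using g(1) that by (auto simp: bij_betw_def)
  have adj: "{i, j} \<in> edges claw \<longleftrightarrow> h i \<in> edges H \<and> h j \<in> edges H \<and> h i \<noteq> h j \<and> h i \<inter> h j \<noteq> {}"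
    if "i \<in> verts claw" "j \<in> verts claw" for i j
  proof -
    have "{i, j} \<in> edges claw \<longleftrightarrow> {g i, g j} \<in> edges G" using g(2) that gS by simp
    also have "\<dots> \<longleftrightarrow> {f (g i), f (g j)} \<in> edges (line_graph H)" using f(2) gS that S(1) by blast
    finally show ?thesis by (simp add: h_def edge_line_graph)
  qed
  have mem: "h i \<in> edges H" if "i \<in> verts claw" for i
    using f(1) gS[OF that] S(1) by (auto simp: h_def bij_betw_def line_graph_def)
  have neq: "h i \<noteq> h j" if "i \<in> verts claw" "j \<in> verts claw" "i \<noteq> j" for i j
  proof -
    have "g i \<noteq> g j" using g(1) that by (auto simp: bij_betw_def inj_on_def)
    moreover have "inj_on f (verts G)" using f(1) by (simp add: bij_betw_def)
    ultimately show ?thesis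
      unfolding h_def using gS[OF that(1)] gS[OF that(2)] S(1) by (blast dest: inj_onD)
  qed
  have V: "0 \<in> verts claw" "1 \<in> verts claw" "2 \<in> verts claw" "3 \<in> verts claw" by (simp_all add: claw_def)
  have "card (h 0) = 2" using H(1) mem[OF V(1)] by (simp add: simple_graph_def)
  then obtain a b where ab: "h 0 = {a, b}" by (auto simp: card_2_iff)
  have hit: "h 0 \<inter> h i \<noteq> {}" if "i \<in> {1, 2, 3}" for i
    using adj[OF V(1), of i] that V by (auto simp: claw_def)
  have meet: "a \<in> h i \<or> b \<in> h i" if "i \<in> {1, 2, 3}" for i
    using hit[OF that] unfolding ab by auto
  have disj: "h i \<inter> h j = {}" if "i \<in> {1, 2, 3}" "j \<in> {1, 2, 3}" "i \<noteq> j" for i j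
  proof -
    have ij: "i \<in> verts claw" "j \<in> verts claw" using that V by auto
    have "{i, j} \<notin> edges claw" using that by (auto simp: claw_def doubleton_eq_iff)
    then show ?thesis using adj[OF ij] mem ij neq[OF ij that(3)] by blast
  qed
  have "h 1 \<inter> h 2 = {}" "h 1 \<inter> h 3 = {}" "h 2 \<inter> h 3 = {}" by (rule disj; simp)+
  moreover have "a \<in> h 1 \<or> b \<in> h 1" "a \<in> h 2 \<or> b \<in> h 2" "a \<in> h 3 \<or> b \<in> h 3" by (rule meet; simp)+
  ultimately show False by blast
qed

lemma chromatic_sym_iso:
  assumes "graph_iso G H"
  shows "chromatic_sym G = chromatic_sym H"
proof
  fix \<alpha>
  obtain f where f: "bij_betw f (verts G) (verts H)"
      "\<forall>u\<in>verts G. \<forall>v\<in>verts G. {u, v} \<in> edges G \<longleftrightarrow> {f u, f v} \<in> edges H"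
    using assms unfolding graph_iso_def by blast
  let ?g = "inv_into (verts G) f"
  have fV: "f u \<in> verts H" "?g (f u) = u" if "u \<in> verts G" for u
    using f(1) that by (auto simp: bij_betw_def)
  have g: "?g u \<in> verts G" "f (?g u) = u" if "u \<in> verts H" for u
    using that f(1) by (auto simp: bij_betw_def inv_into_into f_inv_into_f)
  have cont: "content (verts G) (restrict (\<lambda>u. \<kappa> (f u)) (verts G)) = content (verts H) \<kappa>" for \<kappa>
    unfolding Defs.content_def
    using sum.reindex_bij_betw[OF f(1), of "\<lambda>u. single (\<kappa> u) (1::nat)"] by simp
  have cont': "content (verts H) (restrict (\<lambda>u. \<kappa> (?g u)) (verts H)) = content (verts G) \<kappa>" for \<kappa>
    unfolding Defs.content_def
    using sum.reindex_bij_betw[OF bij_betw_inv_into[OF f(1)], of "\<lambda>u. single (\<kappa> u) (1::nat)"] by simp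
  have edge: "{?g u, ?g v} \<in> edges G \<longleftrightarrow> {u, v} \<in> edges H" if "u \<in> verts H" "v \<in> verts H" for u v
    using f(2) g that by simp
  have "bij_betw (\<lambda>\<kappa>. restrict (\<lambda>u. \<kappa> (f u)) (verts G))
    {\<kappa> \<in> proper_colorings H. content (verts H) \<kappa> = \<alpha>} {\<kappa> \<in> proper_colorings G. content (verts G) \<kappa> = \<alpha>}"
  proof (rule bij_betw_byWitness[where f'="\<lambda>\<kappa>. restrict (\<lambda>u. \<kappa> (?g u)) (verts H)"])
    have ext: "\<kappa> v = undefined" if "\<kappa> \<in> proper_colorings K" "v \<notin> verts K" for \<kappa> v and K :: "'c ugraph"
      using that by (auto simp: proper_colorings_def)
    show "\<forall>\<kappa>\<in>{\<kappa> \<in> proper_colorings H. content (verts H) \<kappa> = \<alpha>}.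
        restrict (\<lambda>u. restrict (\<lambda>u. \<kappa> (f u)) (verts G) (?g u)) (verts H) = \<kappa>"
      using g by (auto simp: fun_eq_iff ext)
    show "\<forall>\<kappa>\<in>{\<kappa> \<in> proper_colorings G. content (verts G) \<kappa> = \<alpha>}.
        restrict (\<lambda>u. restrict (\<lambda>u. \<kappa> (?g u)) (verts H) (f u)) (verts G) = \<kappa>"
      using fV by (auto simp: fun_eq_iff ext)
    have "restrict (\<lambda>u. \<kappa> (f u)) (verts G) \<in> proper_colorings G" if "\<kappa> \<in> proper_colorings H" for \<kappa>
      using that fV(1) f(2) unfolding proper_colorings_def by (simp add: PiE_def Pi_def)
    then show "(\<lambda>\<kappa>. restrict (\<lambda>u. \<kappa> (f u)) (verts G)) ` {\<kappa> \<in> proper_colorings H. content (verts H) \<kappa> = \<alpha>}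
        \<subseteq> {\<kappa> \<in> proper_colorings G. content (verts G) \<kappa> = \<alpha>}"
      using cont by auto
    have "restrict (\<lambda>u. \<kappa> (?g u)) (verts H) \<in> proper_colorings H" if "\<kappa> \<in> proper_colorings G" for \<kappa>
      using that g(1) edge unfolding proper_colorings_def by (simp add: PiE_def Pi_def)
    then show "(\<lambda>\<kappa>. restrict (\<lambda>u. \<kappa> (?g u)) (verts H)) ` {\<kappa> \<in> proper_colorings G. content (verts G) \<kappa> = \<alpha>}
        \<subseteq> {\<kappa> \<in> proper_colorings H. content (verts H) \<kappa> = \<alpha>}"
      using cont' by auto
  qed
  then show "chromatic_sym G \<alpha> = chromatic_sym H \<alpha>"
    unfolding chromatic_sym_def by (simp add: bij_betw_same_card)
qed

text \<open>The conjecture is refuted for graphs on natural numbers, whereas \<open>F t\<close>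
  lives on a sum type; a copy is needed.\<close>

lemma iso_to_nat_graph:
  assumes "simple_graph G"
  obtains H :: "nat ugraph" where "simple_graph H" "graph_iso G H"
proof -
  have fin: "finite (verts G)" and edge: "\<And>e. e \<in> edges G \<Longrightarrow> e \<subseteq> verts G \<and> card e = 2"
    using assms by (auto simp: simple_graph_def)
  obtain f :: "'a \<Rightarrow> nat" where inj: "inj_on f (verts G)"
    using finite_imp_inj_to_nat_seg[OF fin] by blast
  define H where "H = \<lparr>verts = f ` verts G, edges = (image f) ` edges G\<rparr>"
  have "simple_graph H"
    using fin edge card_image[OF inj_on_subset[OF inj]] by (auto simp: simple_graph_def H_def)
  moreover have "graph_iso G H"
    unfolding graph_iso_def
  proof (intro exI conjI ballI)
    show "bij_betw f (verts G) (verts H)" using inj by (simp add: bij_betw_def H_def)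
    fix u v assume uv: "u \<in> verts G" "v \<in> verts G"
    have "f ` e = {f u, f v} \<longleftrightarrow> e = {u, v}" if "e \<in> edges G" for e
      using inj_on_image_eq_iff[OF inj, of e "{u, v}"] edge[OF that] uv by simp
    then show "{u, v} \<in> edges G \<longleftrightarrow> {f u, f v} \<in> edges H"
      by (auto simp: H_def image_iff)
  qed
  ultimately show ?thesis by (rule that)
qed

section \<open>Counting colourings\<close>

text \<open>\<open>coloring_sum f C kss s cs\<close> sums \<open>f\<close> of the total of the colours over all colourings that extend \<open>cs\<close>,
  the colours chosen so far (latest first) with total \<open>s\<close>. An entry of \<open>kss\<close> gives the positions in the
  current \<open>cs\<close> of the earlier neighbours of the next vertex.\<close>

fun coloring_sum :: "(nat \<Rightarrow> int) \<Rightarrow> nat list \<Rightarrow> nat list list \<Rightarrow> nat \<Rightarrow> nat list \<Rightarrow> int" where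
  "coloring_sum f C [] s cs = f s"
| "coloring_sum f C (ks # kss) s cs = sum_list (map (\<lambda>c. if list_all (\<lambda>k. cs ! k \<noteq> c) ks
     then coloring_sum f C kss (s + c) (c # cs) else 0) C)"

text \<open>The constraint tested by \<open>coloring_sum\<close>, as a predicate on the list of
  colours still to be chosen. The prefix \<open>cs\<close> is reversed, so positions count backwards
  from the current vertex.\<close>

fun compatible :: "nat list list \<Rightarrow> nat list \<Rightarrow> nat list \<Rightarrow> bool" where
  "compatible [] cs ds \<longleftrightarrow> ds = []"
| "compatible (ks # kss) cs [] \<longleftrightarrow> False"
| "compatible (ks # kss) cs (d # ds) \<longleftrightarrow> list_all (\<lambda>k. cs ! k \<noteq> d) ks \<and> compatible kss (d # cs) ds"

lemma compatible_length: "compatible kss cs ds \<Longrightarrow> length ds = length kss"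
  by (induction kss cs ds rule: compatible.induct) auto

lemma finite_compatible: "finite {ds. set ds \<subseteq> set C \<and> compatible kss cs ds}"
  by (rule finite_subset[OF _ finite_lists_length_eq[of "set C" "length kss"]])
     (auto dest: compatible_length)

text \<open>The link between the recursion that is evaluated and a sum over a set, which can be
  matched with the colourings of the graph.\<close>

lemma coloring_sum_eq:
  assumes "distinct C"
  shows "coloring_sum f C kss s cs = (\<Sum>ds | set ds \<subseteq> set C \<and> compatible kss cs ds. f (s + sum_list ds))"
proof (induction kss arbitrary: s cs)
  case Nil
  have "{ds. set ds \<subseteq> set C \<and> compatible [] cs ds} = {[]}" by auto
  then show ?case by simp
next
  case (Cons ks kss)
  let ?S = "\<lambda>c. {ds. set ds \<subseteq> set C \<and> compatible kss (c # cs) ds}"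
  let ?C = "{c \<in> set C. list_all (\<lambda>k. cs ! k \<noteq> c) ks}"
  have "coloring_sum f C (ks # kss) s cs = (\<Sum>c\<in>?C. \<Sum>ds\<in>?S c. f (s + c + sum_list ds))"
    unfolding coloring_sum.simps sum_list_distinct_conv_sum_set[OF assms] Cons.IH
    by (subst sum.inter_filter) simp_all
  also have "\<dots> = (\<Sum>(c, ds)\<in>Sigma ?C ?S. f (s + c + sum_list ds))"
    by (rule sum.Sigma) (auto intro: finite_compatible)
  also have "\<dots> = (\<Sum>ds | set ds \<subseteq> set C \<and> compatible (ks # kss) cs ds. f (s + sum_list ds))"
  proof (rule sum.reindex_bij_witness[where i="\<lambda>ds. (hd ds, tl ds)" and j="\<lambda>(c, ds). c # ds"])
    fix ds assume "ds \<in> {ds. set ds \<subseteq> set C \<and> compatible (ks # kss) cs ds}"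
    then show "(hd ds, tl ds) \<in> Sigma ?C ?S" "(case (hd ds, tl ds) of (c, ds) \<Rightarrow> c # ds) = ds"
      by (cases ds; simp)+
  qed (auto simp: add.assoc)
  finally show ?case .
qed

text \<open>The edges of \<^const>\<open>H2\<close> at the vertices \<open>9\<close> and \<open>10\<close> come first, since each of these two stars must
  use all four colours.\<close>

definition G2_order :: "nat set list" where
  "G2_order = [{7, 9}, {1, 9}, {4, 9}, {5, 9}, {7, 10}, {3, 10}, {6, 10}, {8, 10}, {1, 8}, {2, 7}, {3, 6}, {4, 5}]"

text \<open>Position 0 is the vertex coloured immediately before. For instance
  \<open>{7, 10}\<close>, the fifth vertex, has the single earlier neighbour \<open>{7, 9}\<close>,
  four steps back, hence the entry \<open>[3]\<close>.\<close>

definition G2_earlier :: "nat list list" where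
  "G2_earlier = [[], [0], [0, 1], [0, 1, 2], [3], [0], [0, 1], [0, 1, 2], [0, 6], [4, 8], [3, 4], [7, 8]]"

lemma verts_G2: "verts G2 = set G2_order"
  by (auto simp: G2_def line_graph_def H2_def G2_order_def)

lemma distinct_G2_order: "distinct G2_order"
  by (simp add: G2_order_def doubleton_eq_iff)

text \<open>Each pair of meeting edges is tested once, when the later of the two is coloured.
  Injectivity of \<open>\<phi>\<close> allows the test to be made on encoded colours.\<close>

lemma proper_iff_compatible:
  assumes "inj \<phi>"
  shows "(\<forall>x\<in>verts G2. \<forall>y\<in>verts G2. {x, y} \<in> edges G2 \<longrightarrow> \<kappa> x \<noteq> \<kappa> y)
    \<longleftrightarrow> compatible G2_earlier [] (map (\<lambda>v. \<phi> (\<kappa> v)) G2_order)" (is "?L \<longleftrightarrow> ?R")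
proof -
  have "?L \<longleftrightarrow> (\<forall>x\<in>set G2_order. \<forall>y\<in>set G2_order. x \<noteq> y \<and> x \<inter> y \<noteq> {} \<longrightarrow> \<kappa> x \<noteq> \<kappa> y)"
  proof -
    have "verts G2 = edges H2" by (simp add: G2_def line_graph_def)
    then show ?thesis unfolding verts_G2[symmetric] by (auto simp: G2_def edge_line_graph)
  qed
  also have "\<dots> \<longleftrightarrow> ?R"
    unfolding G2_order_def G2_earlier_def
    by (simp add: inj_eq[OF assms] doubleton_eq_iff eq_commute[of "\<kappa> _" "\<kappa> _"]) blast
  finally show ?thesis .
qed

text \<open>The colour \<open>k\<close> is encoded as \<open>100 ^ k\<close>, so that a total of colours displays the size of each colour class in
  base 100. The weight is the sign of \<open>w\<close> on the encoding of \<open>(3,3,3,3) + \<delta> - w \<delta>\<close>; it is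
  split according to the top digit only to speed up the evaluation.\<close>

definition schur_weight :: "nat \<Rightarrow> int" where
  "schur_weight s =
    (if s < 200000000 then
      if s < 100000000 then (if s \<in> {3050400, 4030500, 2040600} then 1
        else if s \<in> {4040400, 2050500, 3030600} then - 1 else 0)
      else (if s \<in> {104040300, 101050500, 103020600} then 1
        else if s \<in> {103050300, 104020500, 101040600} then - 1 else 0)
     else
      if s < 300000000 then (if s \<in> {202050300, 204020400, 201030600} then 1
        else if s \<in> {204030300, 201050400, 202020600} then - 1 else 0)
      else (if s \<in> {303030300, 301040400, 302020500} then 1
        else if s \<in> {302040300, 303020400, 301030500} then - 1 else 0))"

lemma sum_permutes_4:
  fixes h :: "nat \<Rightarrow> nat \<Rightarrow> nat \<Rightarrow> nat \<Rightarrow> int"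
  shows "(\<Sum>w | w permutes {..<4}. sign w * h (w 0) (w 1) (w 2) (w 3)) =
      h 0 1 2 3 - h 0 1 3 2 - h 0 2 1 3 + h 0 2 3 1 + h 0 3 1 2 - h 0 3 2 1
      - h 1 0 2 3 + h 1 0 3 2 + h 1 2 0 3 - h 1 2 3 0 - h 1 3 0 2 + h 1 3 2 0
      + h 2 0 1 3 - h 2 0 3 1 - h 2 1 0 3 + h 2 1 3 0 + h 2 3 0 1 - h 2 3 1 0
      - h 3 0 1 2 + h 3 0 2 1 + h 3 1 0 2 - h 3 1 2 0 - h 3 2 0 1 + h 3 2 1 0"
proof -
  have "{..<4::nat} = insert 0 (insert 1 (insert 2 (insert 3 {})))" by auto
  then show ?thesis
    by (simp only:) (simp add: sum_over_permutations_insert sign_compose permutation_swap_id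
        permutation_compose sign_swap_id Transposition.transpose_def)
qed

lemma schur_weight_eq:
  "schur_weight s = (\<Sum>w | w permutes {..<4}.
     sign w * (if s = (\<Sum>i<4. (3 + w i - i) * 100 ^ Suc i) then 1 else 0))"
proof -
  define h :: "nat \<Rightarrow> nat \<Rightarrow> nat \<Rightarrow> nat \<Rightarrow> int" where
    "h a b c d = (if s = (3 + a) * 100 + (2 + b) * 10000 + (1 + c) * 1000000 + d * 100000000 then 1 else 0)"
    for a b c d
  have "{..<4::nat} = {0, 1, 2, 3}" by auto
  then have "(\<Sum>i<4. (3 + w i - i) * 100 ^ Suc i)
      = (3 + w 0) * 100 + (2 + w 1) * 10000 + (1 + w 2) * 1000000 + w 3 * 100000000" for w :: "nat \<Rightarrow> nat"
    by simp
  then have "(\<Sum>w | w permutes {..<4}. sign w * (if s = (\<Sum>i<4. (3 + w i - i) * 100 ^ Suc i) then 1 else 0))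
      = (\<Sum>w | w permutes {..<4}. sign w * h (w 0) (w 1) (w 2) (w 3))"
    by (simp only: h_def)
  \<comment> \<open>These are the codes for the 24 permutations, the twelve even ones first. They
    are distinct, so at most one summand is nonzero.\<close>
  also have "\<dots> = schur_weight s"
  proof (cases "s \<in> {303030300, 104040300, 202050300, 204020400, 301040400, 3050400, 302020500, 4030500,
        101050500, 103020600, 201030600, 2040600,
        204030300, 302040300, 103050300, 303020400, 4040400, 201050400, 104020500, 301030500,
        2050500, 202020600, 3030600, 101040600}")
    case True
    then show ?thesis unfolding sum_permutes_4 unfolding h_def schur_weight_def by (elim insertE emptyE; simp)
  next
    case False
    then show ?thesis unfolding sum_permutes_4 unfolding h_def schur_weight_def by simp
  qed
  finally show ?thesis by simp
qed

text \<open>The evaluation is split by the colour of \<open>{7, 9}\<close>, the first vertex of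
  \<open>G2_order\<close>. The weight is not symmetric in the colours, so the four parts need not
  agree.\<close>

lemma coloring_sum_from_100:
  "coloring_sum schur_weight [100, 10000, 1000000, 100000000] (tl G2_earlier) 100 [100] = - 16"
  by (simp add: G2_earlier_def schur_weight_def)

lemma coloring_sum_from_10000:
  "coloring_sum schur_weight [100, 10000, 1000000, 100000000] (tl G2_earlier) 10000 [10000] = - 8"
  by (simp add: G2_earlier_def schur_weight_def)

lemma coloring_sum_from_1000000:
  "coloring_sum schur_weight [100, 10000, 1000000, 100000000] (tl G2_earlier) 1000000 [1000000] = - 8"
  by (simp add: G2_earlier_def schur_weight_def)

lemma coloring_sum_from_100000000:
  "coloring_sum schur_weight [100, 10000, 1000000, 100000000] (tl G2_earlier) 100000000 [100000000] = - 8"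
  by (simp add: G2_earlier_def schur_weight_def)

lemma signed_coloring_sum:
  "coloring_sum schur_weight [100, 10000, 1000000, 100000000] G2_earlier 0 [] = - 40"
proof -
  have first: "G2_earlier = [] # tl G2_earlier" by (simp add: G2_earlier_def)
  have "coloring_sum schur_weight [100, 10000, 1000000, 100000000] G2_earlier 0 [] =
      (\<Sum>c\<leftarrow>[100, 10000, 1000000, 100000000].
        coloring_sum schur_weight [100, 10000, 1000000, 100000000] (tl G2_earlier) c [c])"
    by (subst first) (simp only: coloring_sum.simps(2) list.pred_inject(1) if_True add_0)
  then show ?thesis
    by (simp add: coloring_sum_from_100 coloring_sum_from_10000 coloring_sum_from_1000000
        coloring_sum_from_100000000)
qed

section \<open>Colour class sizes as digits in base 100\<close>

lemma base_100_eq_iff: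
  fixes a b :: "nat \<Rightarrow> nat"
  assumes "\<And>i. i < n \<Longrightarrow> a i < 100" "\<And>i. i < n \<Longrightarrow> b i < 100"
  shows "(\<Sum>i<n. a i * 100 ^ Suc i) = (\<Sum>i<n. b i * 100 ^ Suc i) \<longleftrightarrow> (\<forall>i<n. a i = b i)"
  using assms
proof (induction n arbitrary: a b)
  case (Suc n)
  have split: "(\<Sum>i<Suc n. c i * 100 ^ Suc i) = 100 * (c 0 + (\<Sum>i<n. c (Suc i) * 100 ^ Suc i))" for c :: "nat \<Rightarrow> nat"
    by (simp add: sum.lessThan_Suc_shift sum_distrib_left algebra_simps del: sum.lessThan_Suc)
  have dvd: "100 dvd (\<Sum>i<n. c (Suc i) * 100 ^ Suc i)" for c :: "nat \<Rightarrow> nat"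
    by (rule dvd_sum) simp
  have "(\<Sum>i<Suc n. a i * 100 ^ Suc i) = (\<Sum>i<Suc n. b i * 100 ^ Suc i) \<longleftrightarrow>
      a 0 = b 0 \<and> (\<Sum>i<n. a (Suc i) * 100 ^ Suc i) = (\<Sum>i<n. b (Suc i) * 100 ^ Suc i)"
  proof -
    obtain x y where x: "(\<Sum>i<n. a (Suc i) * 100 ^ Suc i) = 100 * x" and y: "(\<Sum>i<n. b (Suc i) * 100 ^ Suc i) = 100 * y"
      using dvd[of a] dvd[of b] by (auto simp: dvd_def)
    have "p + 100 * x = q + 100 * y \<longleftrightarrow> p = q \<and> x = y" if "p < 100" "q < 100" for p q
    proof -
      have "p = q" if eq: "p + 100 * x = q + 100 * y"
      proof -
        have "p = (p + 100 * x) mod 100" using \<open>p < 100\<close> by simp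
        also have "\<dots> = (q + 100 * y) mod 100" by (simp only: eq)
        also have "\<dots> = q" using \<open>q < 100\<close> by simp
        finally show ?thesis .
      qed
      then show ?thesis by auto
    qed
    then show ?thesis
      unfolding split x y mult_cancel1 using Suc.prems(1)[of 0] Suc.prems(2)[of 0] by simp
  qed
  also have "(\<Sum>i<n. a (Suc i) * 100 ^ Suc i) = (\<Sum>i<n. b (Suc i) * 100 ^ Suc i) \<longleftrightarrow> (\<forall>i<n. a (Suc i) = b (Suc i))"
    using Suc.prems by (intro Suc.IH) auto
  also have "a 0 = b 0 \<and> (\<forall>i<n. a (Suc i) = b (Suc i)) \<longleftrightarrow> (\<forall>i<Suc n. a i = b i)"
    by (simp add: All_less_Suc2)
  finally show ?case .
qed simp

text \<open>With fewer than 100 vertices every class size is a single digit in base 100, so no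
  carries occur and the total determines the content.\<close>

lemma content_eq_iff_code:
  assumes fin: "finite V" and card: "card V < 100" and ran: "\<kappa> ` V \<subseteq> {1..n}"
    and a: "\<And>i. i < n \<Longrightarrow> a i < 100"
  shows "content V \<kappa> = expo n a \<longleftrightarrow> (\<Sum>v\<in>V. 100 ^ \<kappa> v) = (\<Sum>i<n. a i * 100 ^ Suc i)"
proof -
  define m where "m i = card {v \<in> V. \<kappa> v = Suc i}" for i
  have m: "m i < 100" for i
    unfolding m_def by (rule le_less_trans[OF card_mono card]) (use fin in auto)
  have "content V \<kappa> = expo n m"
    using expo_of_keys[of "content V \<kappa>" n] ran
    by (simp add: keys_content[OF fin] lookup_content[OF fin] m_def[abs_def])
  moreover have "(\<Sum>v\<in>V. 100 ^ \<kappa> v) = (\<Sum>i<n. m i * 100 ^ Suc i)"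
  proof -
    have "(\<Sum>v\<in>V. 100 ^ \<kappa> v :: nat) = (\<Sum>k\<in>{1..n}. \<Sum>v | v \<in> V \<and> \<kappa> v = k. 100 ^ \<kappa> v)"
      by (rule sum.group[symmetric]) (use fin ran in auto)
    also have "\<dots> = (\<Sum>k\<in>{1..n}. card {v \<in> V. \<kappa> v = k} * 100 ^ k)"
      by (rule sum.cong) auto
    also have "\<dots> = (\<Sum>i<n. m i * 100 ^ Suc i)"
      by (rule sum.reindex_bij_witness[where i=Suc and j="\<lambda>i. i - 1"]) (auto simp: m_def)
    finally show ?thesis .
  qed
  ultimately show ?thesis
    using base_100_eq_iff[of n m a] m a by (simp add: expo_eq_iff)
qed

lemma bij_betw_colorings_lists:
  assumes "distinct vs" "inj \<phi>"
  shows "bij_betw (\<lambda>\<kappa>. map (\<lambda>v. \<phi> (\<kappa> v)) vs) (set vs \<rightarrow>\<^sub>E A) {ds. set ds \<subseteq> \<phi> ` A \<and> length ds = length vs}"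
  unfolding bij_betw_def
proof
  show "inj_on (\<lambda>\<kappa>. map (\<lambda>v. \<phi> (\<kappa> v)) vs) (set vs \<rightarrow>\<^sub>E A)"
    by (rule inj_onI) (use inj_eq[OF assms(2)] in \<open>auto intro: PiE_ext\<close>)
  show "(\<lambda>\<kappa>. map (\<lambda>v. \<phi> (\<kappa> v)) vs) ` (set vs \<rightarrow>\<^sub>E A) = {ds. set ds \<subseteq> \<phi> ` A \<and> length ds = length vs}"
  proof safe
    fix ds assume ds: "set ds \<subseteq> \<phi> ` A" "length ds = length vs"
    define \<kappa> where "\<kappa> = restrict (\<lambda>v. inv_into A \<phi> (the (map_of (zip vs ds) v))) (set vs)"
    have nth: "\<kappa> (vs ! i) = inv_into A \<phi> (ds ! i)" if "i < length vs" for i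
      using that assms(1) ds(2) by (simp add: \<kappa>_def map_of_zip_nth)
    have mem: "ds ! i \<in> \<phi> ` A" if "i < length vs" for i using ds that by (metis nth_mem subsetD)
    have "\<kappa> \<in> set vs \<rightarrow>\<^sub>E A"
    proof (rule PiE_I)
      fix v assume "v \<in> set vs"
      then obtain i where i: "i < length vs" "v = vs ! i" by (metis in_set_conv_nth)
      then show "\<kappa> v \<in> A" using nth mem inv_into_into by metis
    qed (simp add: \<kappa>_def)
    moreover have "map (\<lambda>v. \<phi> (\<kappa> v)) vs = ds"
      by (rule nth_equalityI) (simp_all add: ds(2) nth f_inv_into_f[OF mem])
    ultimately show "ds \<in> (\<lambda>\<kappa>. map (\<lambda>v. \<phi> (\<kappa> v)) vs) ` (set vs \<rightarrow>\<^sub>E A)" by blast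
  qed auto
qed

text \<open>Exchanging the sums over permutations and colourings turns 24 coefficients into one
  weighted count, in which the weight of a colouring depends only on its code.\<close>

lemma alternating_coeff_G2: "alternating_coeff 4 (\<lambda>_. 3) (chromatic_sym G2) = - 40"
proof -
  define \<phi> :: "nat \<Rightarrow> nat" where "\<phi> k = 100 ^ k" for k
  have inj: "inj \<phi>" by (rule injI) (simp add: \<phi>_def)
  let ?V = "verts G2" and ?C = "[100, 10000, 1000000, 100000000] :: nat list"
  let ?P = "{\<kappa> \<in> ?V \<rightarrow>\<^sub>E {1..4}. compatible G2_earlier [] (map (\<lambda>v. \<phi> (\<kappa> v)) G2_order)}"
  let ?c = "\<lambda>w i. 3 + w i - i :: nat"
  have fin: "finite ?V" by (simp add: verts_G2)
  have card: "card ?V = 12"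
    using distinct_card[OF distinct_G2_order] by (simp add: verts_G2 G2_order_def)
  have finP: "finite ?P" by (rule finite_subset[of _ "?V \<rightarrow>\<^sub>E {1..4}"]) (auto intro: finite_PiE fin)
  have code: "content ?V \<kappa> = expo 4 (?c w) \<longleftrightarrow> (\<Sum>v\<in>?V. \<phi> (\<kappa> v)) = (\<Sum>i<4. ?c w i * 100 ^ Suc i)"
    if "\<kappa> \<in> ?P" "w permutes {..<4}" for \<kappa> w
    unfolding \<phi>_def
  proof (rule content_eq_iff_code[OF fin])
    show "\<kappa> ` ?V \<subseteq> {1..4}" using that(1) by auto
    fix i :: nat assume "i < 4"
    then have "w i < 4" using permutes_in_image[OF that(2), of i] by simp
    then show "?c w i < 100" by simp
  qed (simp add: card)
  have X: "chromatic_sym G2 (expo 4 a) = (\<Sum>\<kappa>\<in>?P. if content ?V \<kappa> = expo 4 a then 1 else 0)" for a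
  proof -
    \<comment> \<open>A content of the form \<open>expo 4 a\<close> confines the colours to
      \<open>{1..4}\<close>, so the colourings range over a finite set that does not depend on
      \<open>a\<close>.\<close>
    have "{\<kappa> \<in> proper_colorings G2. content ?V \<kappa> = expo 4 a} = {\<kappa> \<in> ?P. content ?V \<kappa> = expo 4 a}"
      using coloring_entries[OF fin, of _ 4 a]
      by (auto simp: proper_colorings_def proper_iff_compatible[OF inj, symmetric] PiE_def Pi_def)
    then show ?thesis
      using finP by (simp add: chromatic_sym_def sum.If_cases Int_def)
  qed
  \<comment> \<open>The guard \<open>i \<le> 3 + w i\<close> holds for all \<open>i < 4\<close>, so
    no permutation is excluded.\<close>
  have "alternating_coeff 4 (\<lambda>_. 3) (chromatic_sym G2)
      = (\<Sum>w | w permutes {..<4}. \<Sum>\<kappa>\<in>?P. sign w * (if content ?V \<kappa> = expo 4 (?c w) then 1 else 0))"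
    unfolding alternating_coeff_def X sum_distrib_left[symmetric]
    by (intro sum.cong refl) auto
  also have "\<dots> = (\<Sum>\<kappa>\<in>?P. \<Sum>w | w permutes {..<4}. sign w * (if content ?V \<kappa> = expo 4 (?c w) then 1 else 0))"
    by (rule sum.swap)
  also have "\<dots> = (\<Sum>\<kappa>\<in>?P. schur_weight (\<Sum>v\<in>?V. \<phi> (\<kappa> v)))"
    unfolding schur_weight_eq
  proof (intro sum.cong refl)
    fix \<kappa> w assume "\<kappa> \<in> ?P" "w \<in> {w. w permutes {..<4::nat}}"
    then show "sign w * (if content ?V \<kappa> = expo 4 (?c w) then 1 else 0)
       = sign w * (if (\<Sum>v\<in>?V. \<phi> (\<kappa> v)) = (\<Sum>i<4. ?c w i * 100 ^ Suc i) then 1 else 0)"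
      using code[of \<kappa> w] by simp
  qed
  also have "\<dots> = (\<Sum>\<kappa>\<in>?P. schur_weight (0 + sum_list (map (\<lambda>v. \<phi> (\<kappa> v)) G2_order)))"
    by (simp add: verts_G2 sum_list_distinct_conv_sum_set[OF distinct_G2_order])
  also have "\<dots> = (\<Sum>ds | set ds \<subseteq> set ?C \<and> compatible G2_earlier [] ds. schur_weight (0 + sum_list ds))"
  proof (rule sum.reindex_bij_betw)
    have "\<phi> ` {1..4} = set ?C"
    proof -
      have "{1..4::nat} = {1, 2, 3, 4}" by auto
      then show ?thesis by (simp add: \<phi>_def)
    qed
    then have bij: "bij_betw (\<lambda>\<kappa>. map (\<lambda>v. \<phi> (\<kappa> v)) G2_order) (?V \<rightarrow>\<^sub>E {1..4})
        {ds. set ds \<subseteq> set ?C \<and> length ds = length G2_order}"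
      using bij_betw_colorings_lists[OF distinct_G2_order inj, of "{1..4}"] by (simp add: verts_G2)
    have len: "compatible G2_earlier [] ds \<Longrightarrow> length ds = length G2_order" for ds
      using compatible_length[of G2_earlier "[]" ds] by (simp add: G2_earlier_def G2_order_def)
    show "bij_betw (\<lambda>\<kappa>. map (\<lambda>v. \<phi> (\<kappa> v)) G2_order) ?P {ds. set ds \<subseteq> set ?C \<and> compatible G2_earlier [] ds}"
      unfolding bij_betw_def
    proof
      show "inj_on (\<lambda>\<kappa>. map (\<lambda>v. \<phi> (\<kappa> v)) G2_order) ?P"
        by (rule inj_on_subset[OF bij_betw_imp_inj_on[OF bij]]) auto
      have "{ds. set ds \<subseteq> set ?C \<and> compatible G2_earlier [] ds}
          = {ds \<in> (\<lambda>\<kappa>. map (\<lambda>v. \<phi> (\<kappa> v)) G2_order) ` (?V \<rightarrow>\<^sub>E {1..4}). compatible G2_earlier [] ds}"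
        unfolding bij_betw_imp_surj_on[OF bij] using len by blast
      moreover have "f ` {x \<in> A. Q (f x)} = {y \<in> f ` A. Q y}" for f :: "(nat set \<Rightarrow> nat) \<Rightarrow> nat list" and A Q
        by blast
      ultimately show "(\<lambda>\<kappa>. map (\<lambda>v. \<phi> (\<kappa> v)) G2_order) ` ?P = {ds. set ds \<subseteq> set ?C \<and> compatible G2_earlier [] ds}"
        by (rule trans[OF _ sym, rotated])
    qed
  qed
  also have "\<dots> = coloring_sum schur_weight ?C G2_earlier 0 []"
    by (rule coloring_sum_eq[symmetric]) simp
  also have "\<dots> = - 40" by (rule signed_coloring_sum)
  finally show ?thesis .
qed

section \<open>The negative coefficient and the counterexamples\<close>

lemma alternating_coeff_cong:
  assumes "\<And>i. i < n \<Longrightarrow> l i = m i"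
  shows "alternating_coeff n l f = alternating_coeff n m f"
proof -
  have "expo n (\<lambda>i. l i + w i - i) = expo n (\<lambda>i. m i + w i - i)" for w
    by (rule expo_cong) (simp add: assms)
  moreover have "(\<forall>i<n. i \<le> l i + w i) \<longleftrightarrow> (\<forall>i<n. i \<le> m i + w i)" for w
    using assms by auto
  ultimately show ?thesis by (simp only: alternating_coeff_def)
qed

abbreviation hook_square :: "nat \<Rightarrow> nat list" where
  "hook_square t \<equiv> replicate 4 4 @ replicate (t - 4) 1"

lemma is_partition_hook_square: "is_partition (hook_square t)"
proof -
  have "sorted_wrt (\<ge>) (replicate k c)" for k and c :: nat by (induction k) auto
  then show ?thesis by (simp add: is_partition_def sorted_wrt_append)
qed

text \<open>The shape has exactly \<open>t\<close> parts, so the extraction works with as many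
  variables as the clique has vertices. Beyond the first four positions its parts are 1, as
  \<open>alternating_coeff_hook_tail\<close> requires, and lowering the first four leaves 3.\<close>

lemma schur_coeff_F:
  assumes "4 \<le> t"
  shows "schur_coeff (hook_square t) (chromatic_sym (F t)) = - 40 * (int t - 1) * fact (t - 1)"
proof -
  have t: "1 \<le> t" using assms by simp
  have v: "{2, 7} \<in> verts G2" by (simp add: G2_def line_graph_def H2_def)
  have fin: "finite (verts (F t))" using finite_verts_G2 by (simp add: F_eq verts_attach_clique)
  have len: "length (hook_square t) = t" using assms by simp
  have row: "part_row (hook_square t) i = (if i < 4 then 4 else 1)" if "i < t" for i
    using that assms by (simp add: part_row_def nth_append)
  have "schur_coeff (hook_square t) (chromatic_sym (F t))
      = alternating_coeff t (part_row (hook_square t)) (chromatic_sym (F t))"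
    using schur_coeff_chromatic[OF fin is_partition_hook_square, of t] unfolding len .
  also have "\<dots> = alternating_coeff t (\<lambda>i. if i < 4 then 4 else 1) (chromatic_sym (F t))"
    by (rule alternating_coeff_cong) (rule row)
  also have "\<dots> = (int t - 1) * fact (t - 1) *
      alternating_coeff 4 (\<lambda>i. (if i < 4 then 4 else 1) - 1) (chromatic_sym G2)"
    unfolding F_eq
  proof (rule alternating_coeff_hook_tail[OF assms])
    show "0 < a i" if "chromatic_sym (attach_clique G2 {2, 7} t) (expo t a) \<noteq> 0" "i < t" for a i
      by (rule chromatic_attach_clique_pos[OF finite_verts_G2 v t that])
    show "chromatic_sym (attach_clique G2 {2, 7} t) (expo t (\<lambda>i. b i + 1))
        = (int t - 1) * fact (t - 1) * chromatic_sym G2 (expo t b)" for b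
      by (rule chromatic_attach_clique[OF finite_verts_G2 v t])
  qed auto
  also have "alternating_coeff 4 (\<lambda>i. (if i < 4 then 4 else 1) - 1) (chromatic_sym G2)
      = alternating_coeff 4 (\<lambda>_. 3) (chromatic_sym G2)"
    by (rule alternating_coeff_cong) simp
  also have "\<dots> = - 40" by (rule alternating_coeff_G2)
  also have "(int t - 1) * fact (t - 1) * (- 40) = - 40 * (int t - 1) * fact (t - 1)"
    by (simp only: mult_ac)
  finally show ?thesis .
qed

lemma schur_coeff_F_negative: "4 \<le> t \<Longrightarrow> - 40 * (int t - 1) * fact (t - 1) < 0"
  by (rule mult_neg_pos) simp_all

text \<open>Stated up to isomorphism to serve both \<open>F t\<close> itself and its copy on natural
  numbers.\<close>

lemma F_not_schur_positive:
  assumes "4 \<le> t" and iso: "graph_iso (F t) H"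
  shows "\<not> schur_positive H"
proof
  assume "schur_positive H"
  then have "0 \<le> schur_coeff (hook_square t) (chromatic_sym (F t))"
    using is_partition_hook_square[of t] unfolding schur_positive_def chromatic_sym_iso[OF iso] by blast
  then show False
    unfolding schur_coeff_F[OF assms(1)] using schur_coeff_F_negative[OF assms(1)] by (metis not_le)
qed

lemma graph_iso_refl: "graph_iso G G"
  unfolding graph_iso_def by (rule exI[of _ id]) simp

theorem theorem3p4:
  shows "(\<forall>t\<ge>4. simple_graph (F t) \<and> connected_graph (F t) \<and> is_line_graph (F t) \<and>
            schur_coeff (replicate 4 4 @ replicate (t - 4) 1) (chromatic_sym (F t))
              = - 40 * (int t - 1) * fact (t - 1) \<and>
            - 40 * (int t - 1) * fact (t - 1) < 0)
       \<and> (\<forall>t\<ge>4. claw_free (F t) \<and> \<not> schur_positive (F t))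
       \<and> (\<forall>s\<ge>4. \<forall>t\<ge>4. s \<noteq> t \<longrightarrow> \<not> graph_iso (F s) (F t))
       \<and> \<not> (\<forall>G :: nat ugraph. simple_graph G \<and> claw_free G \<longrightarrow> schur_positive G)"
proof (intro conjI allI impI)
  fix t :: nat assume t: "4 \<le> t"
  then have t1: "1 \<le> t" by simp
  show "simple_graph (F t)" "connected_graph (F t)" "is_line_graph (F t)"
    by (rule simple_F[OF t1] connected_F[OF t1] line_graph_F[OF t1])+
  show "schur_coeff (replicate 4 4 @ replicate (t - 4) 1) (chromatic_sym (F t))
      = - 40 * (int t - 1) * fact (t - 1)"
    by (rule schur_coeff_F[OF t])
  show "- 40 * (int t - 1) * fact (t - 1) < 0" by (rule schur_coeff_F_negative[OF t])
  show "claw_free (F t)" by (rule line_graph_claw_free[OF line_graph_F[OF t1]])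
  show "\<not> schur_positive (F t)" by (rule F_not_schur_positive[OF t graph_iso_refl])
next
  fix s t :: nat assume "s \<noteq> t"
  then show "\<not> graph_iso (F s) (F t)" by (rule F_not_iso)
next
  show "\<not> (\<forall>G :: nat ugraph. simple_graph G \<and> claw_free G \<longrightarrow> schur_positive G)"
  proof
    assume *: "\<forall>G :: nat ugraph. simple_graph G \<and> claw_free G \<longrightarrow> schur_positive G"
    \<comment> \<open>Any \<open>t \<ge> 4\<close> would do; the copy inherits the line graph
      property and the chromatic symmetric function.\<close>
    obtain H :: "nat ugraph" where H: "simple_graph H" "graph_iso (F 4) H"
      using iso_to_nat_graph[OF simple_F[of 4]] by auto
    have "is_line_graph H"
      using line_graph_F[of 4] graph_iso_trans[OF graph_iso_sym[OF H(2)]]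
      by (auto simp: is_line_graph_def)
    then have "claw_free H" by (rule line_graph_claw_free)
    then have "schur_positive H" using * H(1) by blast
    then show False using F_not_schur_positive[OF _ H(2)] by simp
  qed
qed

end
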